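(* Let $m\ge1$ and let $\Phi:\overline{\Omega}\to\mathbb{R}$ be non-anticipative, bounded from above and upper semicontinuous. Let $\boldsymbol{\mu}=(\mu_1,\dots,\mu_m)$ be a centered peacock. Let $(\boldsymbol{K}^n)_{n\ge1}$, $\boldsymbol{K}^n=(K^n_1,\dots,K^n_n)$ with $K^n_1<\dots<K^n_n$, be an increasing sequence of strike vectors (i.e. $\{K^n_1,\dots,K^n_n\}\subset\{K^{n+1}_1,\dots,K^{n+1}_{n+1}\}$ for all $n$) such that $\lim_{n\to\infty}|\boldsymbol{K}^n|=+\infty$ and $\lim_{n\to\infty}\Delta\boldsymbol{K}^n=0$. Let $\boldsymbol{C}^n=(C^n_{i,j})_{1\le i\le m,1\le j\le n}$ with $C^n_{i,j}=\int_{\mathbb{R}}(x-K^n_j)^+\,d\mu_i(x)$. Then $$\lim_{n\to\infty}\mathsf{P}(\boldsymbol{K}^n,\boldsymbol{C}^n)=\mathsf{P}(\boldsymbol{\mu}).$$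
   Context: $|\boldsymbol{K}^n|:=(K^n_1)^-\wedge(K^n_n)^+$ and $\Delta\boldsymbol{K}^n:=\max_{1<i\le n}(K^n_i-K^n_{i-1})$. $\Omega$ is the space of continuous paths $\omega=(\omega_t)_{t\ge0}$ on $\mathbb{R}_+$ with $\omega_0=0$, with the topology of locally uniform convergence. $\Theta^m=\{\theta\in\mathbb{R}_+^m:\theta_1\le\dots\le\theta_m\}$, and $\overline{\Omega}=\Omega\times\Theta^m$ has the product topology. The canonical element is $(B,T)$, $B(\omega,\theta)=\omega$, $T(\omega,\theta)=\theta$, $T=(T_1,\dots,T_m)$. The filtration $\overline{\mathbb{F}}$ is $\overline{\mathcal{F}}_t=\sigma(B_s,s\le t)\vee\sigma(\{T_i\le s\}, s\le t,1\le i\le m)$. $\Phi$ is non-anticipative if it is measurable and $\Phi(\omega,\theta)=\Phi(\omega_{\theta_m\wedge\cdot},\theta)$ for all $(\omega,\theta)\in\overline{\Omega}$. $\overline{\mathcal{P}}$ is the set of Borel probability measures $\overline{\mathbb{P}}$ on $\overline{\Omega}$ under which $B$ is an $\overline{\mathbb{F}}$-Brownian motion and $B_{T_m\wedge\cdot}$ is uniformly integrable. A vector $\boldsymbol{\mu}=(\mu_1,\dots,\mu_m)$ of probability measures on $\mathbb{R}$ is a centered peacock if each $\mu_i$ has finite first moment and mean zero and $i\mapsto\int\phi\,d\mu_i$ is non-decreasing for every convex $\phi$. Put $\overline{\mathcal{P}}(\boldsymbol{\mu})=\{\overline{\mathbb{P}}\in\overline{\mathcal{P}}:B_{T_i}\sim\mu_i\text{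 under }\overline{\mathbb{P}},\ i=1,\dots,m\}$ and $\mathsf{P}(\boldsymbol{\mu})=\sup_{\overline{\mathbb{P}}\in\overline{\mathcal{P}}(\boldsymbol{\mu})}\mathbb{E}^{\overline{\mathbb{P}}}[\Phi(B,T)]$. For $\boldsymbol{K}=(K_1,\dots,K_n)$ and $\boldsymbol{C}=(C_{i,j})$, $\overline{\mathcal{P}}(\boldsymbol{K},\boldsymbol{C})$ is the set of $\overline{\mathbb{P}}\in\overline{\mathcal{P}}$ with $\mathbb{E}^{\overline{\mathbb{P}}}[(B_{T_i}-K_j)^+]=C_{i,j}$ for all $i,j$, and $\mathsf{P}(\boldsymbol{K},\boldsymbol{C})=\sup_{\overline{\mathbb{P}}\in\overline{\mathcal{P}}(\boldsymbol{K},\boldsymbol{C})}\mathbb{E}^{\overline{\mathbb{P}}}[\Phi(B,T)]$. *)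

theory Defs
  imports "HOL-Probability.Probability"
begin

section \<open>The canonical space\<close>

text \<open>
  Functions on \<open>\<real>\<^sub>+\<close> are represented as extensional functions on \<^term>\<open>{0::real..}\<close>, and
  vectors in \<open>\<real>\<^sup>m\<close> as extensional functions on \<^term>\<open>{1..m::nat}\<close>.
\<close>

definition paths :: "(real \<Rightarrow> real) set" where
  "paths = {\<omega> \<in> extensional {0..}. continuous_on {0..} \<omega> \<and> \<omega> 0 = 0}"

text \<open>
  The topology of locally uniform convergence: the sets
  \<open>{\<eta>. sup\<^bsub>t \<le> u\<^esub> \<bar>\<eta> t - \<omega> t\<bar> < e}\<close> form a neighbourhood base at \<open>\<omega>\<close>.
\<close>

definition open_paths :: "(real \<Rightarrow> real) set \<Rightarrow> bool" where
  "open_paths U \<longleftrightarrow> U \<subseteq> paths \<and>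
     (\<forall>\<omega>\<in>U. \<exists>u\<ge>0. \<exists>e>0. \<forall>\<eta>\<in>paths. (\<forall>t\<in>{0..u}. \<bar>\<eta> t - \<omega> t\<bar> < e) \<longrightarrow> \<eta> \<in> U)"

definition path_topology :: "(real \<Rightarrow> real) topology" where
  "path_topology = topology open_paths"

lemma istopology_open_paths: "istopology open_paths"
  unfolding istopology_def
proof (intro conjI allI impI)
  fix S T assume S: "open_paths S" and T: "open_paths T"
  show "open_paths (S \<inter> T)"
    unfolding open_paths_def
  proof (intro conjI ballI)
    show "S \<inter> T \<subseteq> paths" using S by (auto simp: open_paths_def)
  next
    fix \<omega> assume \<omega>: "\<omega> \<in> S \<inter> T"
    obtain u e where 1: "u \<ge> 0" "e > 0"
      "\<forall>\<eta>\<in>paths. (\<forall>t\<in>{0..u}. \<bar>\<eta> t - \<omega> t\<bar> < e) \<longrightarrow> \<eta> \<in> S"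
      using S \<omega> unfolding open_paths_def by blast
    obtain v d where 2: "v \<ge> 0" "d > 0"
      "\<forall>\<eta>\<in>paths. (\<forall>t\<in>{0..v}. \<bar>\<eta> t - \<omega> t\<bar> < d) \<longrightarrow> \<eta> \<in> T"
      using T \<omega> unfolding open_paths_def by blast
    have "\<forall>\<eta>\<in>paths. (\<forall>t\<in>{0..max u v}. \<bar>\<eta> t - \<omega> t\<bar> < min e d) \<longrightarrow> \<eta> \<in> S \<inter> T"
    proof (intro ballI impI IntI)
      fix \<eta> assume \<eta>: "\<eta> \<in> paths" and near: "\<forall>t\<in>{0..max u v}. \<bar>\<eta> t - \<omega> t\<bar> < min e d"
      have "\<forall>t\<in>{0..u}. \<bar>\<eta> t - \<omega> t\<bar> < e" using near by fastforce
      then show "\<eta> \<in> S" using 1(3) \<eta> by blast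
      have "\<forall>t\<in>{0..v}. \<bar>\<eta> t - \<omega> t\<bar> < d" using near by fastforce
      then show "\<eta> \<in> T" using 2(3) \<eta> by blast
    qed
    moreover have "max u v \<ge> 0" "min e d > 0" using 1 2 by auto
    ultimately show "\<exists>u\<ge>0. \<exists>e>0. \<forall>\<eta>\<in>paths. (\<forall>t\<in>{0..u}. \<bar>\<eta> t - \<omega> t\<bar> < e) \<longrightarrow> \<eta> \<in> S \<inter> T"
      by blast
  qed
next
  fix \<K> assume \<K>: "\<forall>K\<in>\<K>. open_paths K"
  show "open_paths (\<Union>\<K>)"
    unfolding open_paths_def
  proof (intro conjI ballI)
    show "\<Union>\<K> \<subseteq> paths" using \<K> by (auto simp: open_paths_def)
  next
    fix \<omega> assume "\<omega> \<in> \<Union>\<K>"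
    then obtain K where K: "K \<in> \<K>" "\<omega> \<in> K" by blast
    then obtain u e where "u \<ge> 0" "e > 0"
      "\<forall>\<eta>\<in>paths. (\<forall>t\<in>{0..u}. \<bar>\<eta> t - \<omega> t\<bar> < e) \<longrightarrow> \<eta> \<in> K"
      using \<K> unfolding open_paths_def by blast
    then show "\<exists>u\<ge>0. \<exists>e>0. \<forall>\<eta>\<in>paths. (\<forall>t\<in>{0..u}. \<bar>\<eta> t - \<omega> t\<bar> < e) \<longrightarrow> \<eta> \<in> \<Union>\<K>"
      using K(1) by blast
  qed
qed

lemma openin_path_topology: "openin path_topology U \<longleftrightarrow> open_paths U"
  by (simp add: path_topology_def istopology_open_paths topology_inverse')

lemma topspace_path_topology: "topspace path_topology = paths"
proof -
  have "open_paths paths" by (auto simp: open_paths_def intro!: exI[of _ "1::real"])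
  then have "paths \<subseteq> topspace path_topology"
    by (simp add: openin_path_topology openin_subset)
  moreover have "topspace path_topology \<subseteq> paths"
    using openin_topspace[of path_topology] unfolding openin_path_topology open_paths_def by blast
  ultimately show ?thesis by blast
qed

definition ordered_times :: "nat \<Rightarrow> (nat \<Rightarrow> real) set" where
  "ordered_times m = {\<theta> \<in> {1..m} \<rightarrow>\<^sub>E {0..}. \<forall>i\<in>{1..m}. \<forall>j\<in>{1..m}. i \<le> j \<longrightarrow> \<theta> i \<le> \<theta> j}"

definition times_topology :: "nat \<Rightarrow> (nat \<Rightarrow> real) topology" where
  "times_topology m =
     subtopology (product_topology (\<lambda>_. euclideanreal) {1..m}) (ordered_times m)"

definition canonical_topology :: "nat \<Rightarrow> ((real \<Rightarrow> real) \<times> (nat \<Rightarrow> real)) topology" where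
  "canonical_topology m = prod_topology path_topology (times_topology m)"

definition canonical_space :: "nat \<Rightarrow> ((real \<Rightarrow> real) \<times> (nat \<Rightarrow> real)) set" where
  "canonical_space m = paths \<times> ordered_times m"

lemma topspace_canonical_topology: "topspace (canonical_topology m) = canonical_space m"
proof -
  have "ordered_times m \<subseteq> (\<Pi>\<^sub>E i\<in>{1..m}. UNIV)"
    unfolding ordered_times_def PiE_def by blast
  then show ?thesis
    unfolding canonical_topology_def canonical_space_def times_topology_def
    by (simp add: topspace_path_topology Int_absorb1)
qed

definition borel_of :: "'a topology \<Rightarrow> 'a measure" where
  "borel_of X = sigma (topspace X) {U. openin X U}"

definition B :: "real \<Rightarrow> (real \<Rightarrow> real) \<times> (nat \<Rightarrow> real) \<Rightarrow> real" where
  "B t x = fst x t"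

definition T :: "nat \<Rightarrow> (real \<Rightarrow> real) \<times> (nat \<Rightarrow> real) \<Rightarrow> real" where
  "T i x = snd x i"

definition canonical_filtration ::
    "nat \<Rightarrow> real \<Rightarrow> ((real \<Rightarrow> real) \<times> (nat \<Rightarrow> real)) measure" where
  "canonical_filtration m t = sigma (canonical_space m)
     ({{x \<in> canonical_space m. B s x \<in> A} | s A. 0 \<le> s \<and> s \<le> t \<and> A \<in> sets borel} \<union>
      {{x \<in> canonical_space m. T i x \<le> s} | i s. 0 \<le> s \<and> s \<le> t \<and> i \<in> {1..m}})"


section \<open>Processes\<close>

definition brownian_motion ::
    "'a measure \<Rightarrow> (real \<Rightarrow> 'a measure) \<Rightarrow> (real \<Rightarrow> 'a \<Rightarrow> real) \<Rightarrow> bool" where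
  "brownian_motion M F W \<longleftrightarrow>
     (\<forall>t\<ge>0. W t \<in> borel_measurable (F t)) \<and>
     (\<forall>x\<in>space M. W 0 x = 0 \<and> continuous_on {0..} (\<lambda>t. W t x)) \<and>
     (\<forall>s t. 0 \<le> s \<and> s < t \<longrightarrow>
        distributed M lborel (\<lambda>x. W t x - W s x) (normal_density 0 (sqrt (t - s))) \<and>
        prob_space.indep_set M (sets (F s))
          (sets (vimage_algebra (space M) (\<lambda>x. W t x - W s x) borel)))"

definition uniformly_integrable :: "'a measure \<Rightarrow> 'i set \<Rightarrow> ('i \<Rightarrow> 'a \<Rightarrow> real) \<Rightarrow> bool" where
  "uniformly_integrable M I X \<longleftrightarrow>
     (\<forall>i\<in>I. X i \<in> borel_measurable M) \<and>
     (\<forall>e>0. \<exists>c. \<forall>i\<in>I.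
        (\<integral>\<^sup>+x. ennreal \<bar>X i x\<bar> * indicator {x. c \<le> \<bar>X i x\<bar>} x \<partial>M) \<le> ennreal e)"

text \<open>
  The integral with values in the extended reals, needed because the payoff may have expectation
  \<open>-\<infinity>\<close> and a convex function may have integral \<open>\<infinity>\<close>. It is only used where one of the
  two parts is finite.
\<close>

definition ext_integral :: "'a measure \<Rightarrow> ('a \<Rightarrow> real) \<Rightarrow> ereal" where
  "ext_integral M f =
     enn2ereal (\<integral>\<^sup>+x. ennreal (f x) \<partial>M) - enn2ereal (\<integral>\<^sup>+x. ennreal (- f x) \<partial>M)"


section \<open>Payoffs\<close>

definition non_anticipative ::
    "nat \<Rightarrow> ((real \<Rightarrow> real) \<times> (nat \<Rightarrow> real) \<Rightarrow> real) \<Rightarrow> bool" where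
  "non_anticipative m \<Phi> \<longleftrightarrow>
     \<Phi> \<in> borel_measurable (borel_of (canonical_topology m)) \<and>
     (\<forall>\<omega> \<theta>. (\<omega>, \<theta>) \<in> canonical_space m \<longrightarrow>
        \<Phi> (\<omega>, \<theta>) = \<Phi> (\<lambda>t\<in>{0..}. \<omega> (min (\<theta> m) t), \<theta>))"

definition upper_semicontinuous :: "'a topology \<Rightarrow> ('a \<Rightarrow> real) \<Rightarrow> bool" where
  "upper_semicontinuous X f \<longleftrightarrow> (\<forall>a. openin X {x \<in> topspace X. f x < a})"


section \<open>Embeddings and the two optimization problems\<close>

definition embeddings :: "nat \<Rightarrow> ((real \<Rightarrow> real) \<times> (nat \<Rightarrow> real)) measure set" where
  "embeddings m = {P. prob_space P \<and> sets P = sets (borel_of (canonical_topology m)) \<and>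
     brownian_motion P (canonical_filtration m) B \<and>
     uniformly_integrable P {0..} (\<lambda>t x. B (min (T m x) t) x)}"

definition centered_peacock :: "nat \<Rightarrow> (nat \<Rightarrow> real measure) \<Rightarrow> bool" where
  "centered_peacock m \<mu> \<longleftrightarrow>
     (\<forall>i\<in>{1..m}. prob_space (\<mu> i) \<and> sets (\<mu> i) = sets borel \<and>
        integrable (\<mu> i) (\<lambda>x. x) \<and> (\<integral>x. x \<partial>\<mu> i) = 0) \<and>
     (\<forall>\<phi>. convex_on UNIV \<phi> \<longrightarrow>
        (\<forall>i\<in>{1..m}. \<forall>j\<in>{1..m}. i \<le> j \<longrightarrow> ext_integral (\<mu> i) \<phi> \<le> ext_integral (\<mu> j) \<phi>))"

definition embeddings_marginals ::
    "nat \<Rightarrow> (nat \<Rightarrow> real measure) \<Rightarrow> ((real \<Rightarrow> real) \<times> (nat \<Rightarrow> real)) measure set" where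
  "embeddings_marginals m \<mu> =
     {P \<in> embeddings m. \<forall>i\<in>{1..m}. distr P borel (\<lambda>x. B (T i x) x) = \<mu> i}"

definition price_marginals ::
    "nat \<Rightarrow> ((real \<Rightarrow> real) \<times> (nat \<Rightarrow> real) \<Rightarrow> real) \<Rightarrow> (nat \<Rightarrow> real measure) \<Rightarrow> ereal" where
  "price_marginals m \<Phi> \<mu> = (SUP P\<in>embeddings_marginals m \<mu>. ext_integral P \<Phi>)"

definition embeddings_calls ::
    "nat \<Rightarrow> nat \<Rightarrow> (nat \<Rightarrow> real) \<Rightarrow> (nat \<Rightarrow> nat \<Rightarrow> real) \<Rightarrow>
     ((real \<Rightarrow> real) \<times> (nat \<Rightarrow> real)) measure set" where
  "embeddings_calls m n K C =
     {P \<in> embeddings m. \<forall>i\<in>{1..m}. \<forall>j\<in>{1..n}.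
        has_bochner_integral P (\<lambda>x. max 0 (B (T i x) x - K j)) (C i j)}"

definition price_calls ::
    "nat \<Rightarrow> ((real \<Rightarrow> real) \<times> (nat \<Rightarrow> real) \<Rightarrow> real) \<Rightarrow>
     nat \<Rightarrow> (nat \<Rightarrow> real) \<Rightarrow> (nat \<Rightarrow> nat \<Rightarrow> real) \<Rightarrow> ereal" where
  "price_calls m \<Phi> n K C = (SUP P\<in>embeddings_calls m n K C. ext_integral P \<Phi>)"

definition strike_range :: "nat \<Rightarrow> (nat \<Rightarrow> real) \<Rightarrow> real" where
  "strike_range n K = min (max 0 (- K 1)) (max 0 (K n))"

text \<open>For \<open>n \<le> 1\<close> the maximum ranges over the empty set, and its value is irrelevant.\<close>

definition strike_mesh :: "nat \<Rightarrow> (nat \<Rightarrow> real) \<Rightarrow> real" where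
  "strike_mesh n K = Max ((\<lambda>i. K i - K (i - 1)) ` {1<..n})"

end

theory Submission
  imports Defs
begin

text \<open>
  Embeddings of \<open>\<mu>\<close> are admissible for all call constraints, and the constraints become more
  restrictive with \<open>n\<close>, so only the upper bound needs an argument. Near-optimal embeddings
  \<open>P\<^sub>n\<close> for the constraints \<open>(K\<^sup>n, C\<^sup>n)\<close> are tight: the path component always has the law of
  Brownian motion, and on \<open>{T\<^sub>m > L}\<close> the stopped path at time \<open>L\<close> is \<open>B\<^sub>L\<close>, which is large with high
  probability, whereas \<open>E \<bar>B\<^bsub>T\<^sub>m \<and> L\<^esub>\<bar> \<le> E \<bar>B\<^bsub>T\<^sub>m\<^esub>\<bar>\<close> is bounded by call prices. Along a subsequence the
  \<open>P\<^sub>n\<close> are the laws of random elements \<open>X\<^sub>n\<close> converging pointwise to some \<open>Y\<close>. The law of \<open>Y\<close> is again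
  an embedding: independence of increments is tested against continuous functions of the filtration at
  a slightly later time, and uniform integrability follows from Fatou's lemma because the call and put
  prices of the stopped process are dominated by those of its terminal value. Call prices at a dense
  set of strikes identify the marginals, and upper semicontinuity with Fatou's lemma
  carries the payoff bound to the limit.
\<close>

section \<open>Almost sure convergence along tight sequences\<close>

text \<open>Three obstacles shape the proof. Fatou's lemma wants pointwise convergence on a space
  that is not the real line; coding points by real numbers brings Helly selection and the Skorokhod
  representation to the canonical space, at the price of recovering a point from a limit of codes.
  The filtration contains the events \<open>T i x <= s\<close>, whose indicators are not continuous
  in the point, so independence does not pass to the limit directly: ramps reaching \<delta> beyond
  the level replace the indicators, and the increment starts \<delta> later, before \<delta> tends
  to 0. Finally, the approximating embeddings do not have the marginals \<open>\<mu>\<close>: at a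
  fixed strike the call price is correct only from some index on. One common strike bounds all first
  moments, since \<open>B\<close> at \<open>T m\<close> has mean zero by optional stopping, and put
  prices follow from calls by parity. Empty constraint sets form no separate case, because the
  suprema are extended reals.\<close>

lemma space_borel_of [simp]: "space (borel_of X) = topspace X"
  unfolding borel_of_def by (rule space_measure_of) (auto dest: openin_subset)

lemma sets_borel_of: "sets (borel_of X) = sigma_sets (topspace X) {U. openin X U}"
  unfolding borel_of_def by (rule sets_measure_of) (auto dest: openin_subset)

lemma openin_borel_of: "openin X U \<Longrightarrow> U \<in> sets (borel_of X)"
  by (auto simp: sets_borel_of)

lemma closedin_borel_of:
  assumes "closedin X C" shows "C \<in> sets (borel_of X)"
proof -
  have "space (borel_of X) - (topspace X - C) \<in> sets (borel_of X)"
    using assms by (intro sets.compl_sets openin_borel_of) blast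
  moreover have "space (borel_of X) - (topspace X - C) = C"
    using closedin_subset[OF assms] by auto
  ultimately show ?thesis by simp
qed

lemma measurable_borel_ofI:
  assumes "f \<in> space N \<rightarrow> topspace X"
    and "\<And>U. openin X U \<Longrightarrow> f -` U \<inter> space N \<in> sets N"
  shows "f \<in> N \<rightarrow>\<^sub>M borel_of X"
  unfolding borel_of_def
  by (rule measurable_measure_of) (use assms in \<open>auto dest: openin_subset\<close>)

context Metric_space
begin

text \<open>Membership of the limit in an open \<open>U\<close> is expressed with a margin: for some
  \<open>j\<close> the approximations eventually lie in \<open>V j\<close>, that is, keep distance
  1/(j+1) from the complement of \<open>U\<close>. The sets \<open>V j\<close> are closed, so the
  preimage of \<open>U\<close> arises by countable operations.\<close>

lemma measurable_limit:
  assumes f: "\<And>k. f k \<in> N \<rightarrow>\<^sub>M borel_of mtopology"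
    and g: "\<And>s. s \<in> space N \<Longrightarrow> g s \<in> M"
    and lim: "\<And>s. s \<in> space N \<Longrightarrow> (\<lambda>k. d (f k s) (g s)) \<longlonglongrightarrow> 0"
  shows "g \<in> N \<rightarrow>\<^sub>M borel_of mtopology"
proof (rule measurable_borel_ofI)
  show "g \<in> space N \<rightarrow> topspace mtopology" using g by auto
next
  fix U assume U: "openin mtopology U"
  have fM: "f k s \<in> M" if "s \<in> space N" for k s
    using measurable_space[OF f that] by simp
  define V where "V j = {x \<in> M. mball x (1 / real (Suc j)) \<subseteq> U}" for j
  have "V j = M - (\<Union>z\<in>M - U. mball z (1 / real (Suc j)))" for j
    by (auto simp: V_def commute)
  moreover have "openin mtopology (\<Union>z\<in>M - U. mball z (1 / real (Suc j)))" for j by blast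
  ultimately have "closedin mtopology (V j)" for j
    by (metis closedin_diff closedin_mspace)
  then have V: "V j \<in> sets (borel_of mtopology)" for j by (rule closedin_borel_of)
  have "g s \<in> U \<longleftrightarrow> (\<exists>j n. \<forall>k\<ge>n. f k s \<in> V j)" if s: "s \<in> space N" for s
  proof
    assume "g s \<in> U"
    then obtain r where r: "r > 0" "mball (g s) r \<subseteq> U" using U by (auto simp: openin_mtopology)
    obtain j where j: "1 / real (Suc j) < r / 2"
      using r(1) by (metis half_gt_zero nat_approx_posE)
    obtain n where n: "\<And>k. k \<ge> n \<Longrightarrow> d (f k s) (g s) < r / 2"
      using order_tendstoD(2)[OF lim[OF s], of "r / 2"] r(1) by (auto simp: eventually_sequentially)
    have "f k s \<in> V j" if "k \<ge> n" for k
    proof -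
      have "z \<in> U" if "z \<in> mball (f k s) (1 / real (Suc j))" for z
      proof -
        have "d (g s) z \<le> d (g s) (f k s) + d (f k s) z"
          using that g[OF s] fM[OF s] by (intro triangle) auto
        also have "\<dots> < r" using n[OF \<open>k \<ge> n\<close>] that j by (auto simp: commute)
        finally show ?thesis using r(2) that g[OF s] by auto
      qed
      then show ?thesis using fM[OF s] by (auto simp: V_def)
    qed
    then show "\<exists>j n. \<forall>k\<ge>n. f k s \<in> V j" by blast
  next
    assume "\<exists>j n. \<forall>k\<ge>n. f k s \<in> V j"
    then obtain j n where jn: "\<And>k. k \<ge> n \<Longrightarrow> f k s \<in> V j" by blast
    obtain n' where n': "\<And>k. k \<ge> n' \<Longrightarrow> d (f k s) (g s) < 1 / real (Suc j)"
      using order_tendstoD(2)[OF lim[OF s], of "1 / real (Suc j)"]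
      by (auto simp: eventually_sequentially)
    have "f (max n n') s \<in> V j" "d (f (max n n') s) (g s) < 1 / real (Suc j)"
      using jn n' by auto
    then show "g s \<in> U" using g[OF s] fM[OF s] by (auto simp: V_def)
  qed
  then have "g -` U \<inter> space N = (\<Union>j. \<Union>n. \<Inter>k\<in>{n..}. f k -` V j \<inter> space N)"
    by (intro set_eqI) (simp, blast)
  also have "\<dots> \<in> sets N"
  proof -
    have "(\<Inter>k\<in>{n..}. f k -` V j \<inter> space N) \<in> sets N" for j n
      by (rule sets.countable_INT') (use measurable_sets[OF f V] in auto)
    then show ?thesis by (intro sets.countable_nat_UN image_subsetI)
  qed
  finally show "g -` U \<inter> space N \<in> sets N" .
qed

end

text \<open>Only the digits 0 and 1 are used in base 3, so that all tails are at most 1/2 and the digits are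
  locally constant on the range of the code.\<close>

definition ternary_code :: "(nat \<Rightarrow> bool) \<Rightarrow> real" where
  "ternary_code b = (\<Sum>j. of_bool (b j) / 3 ^ Suc j)"

lemma summable_ternary: "summable (\<lambda>j. of_bool (b j) / 3 ^ Suc j :: real)"
proof (rule summable_comparison_test')
  show "summable (\<lambda>j. (1/3::real) ^ Suc j)"
    using summable_geometric[of "1/3::real"] by (simp add: summable_Suc_iff)
qed (auto simp: power_divide)

lemma ternary_code_bounds: "0 \<le> ternary_code b" "ternary_code b \<le> 1 / 2"
proof -
  show "0 \<le> ternary_code b"
    unfolding ternary_code_def by (rule suminf_nonneg[OF summable_ternary]) auto
  have "(\<lambda>j. (1/3::real) * (1/3) ^ j) sums ((1/3) * (1 / (1 - 1/3)))"
    by (intro sums_mult geometric_sums) auto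
  then have s: "(\<lambda>j. 1 / 3 ^ Suc j :: real) sums (1/2)"
    by (simp add: power_divide field_simps)
  have "ternary_code b \<le> (\<Sum>j. 1 / 3 ^ Suc j)"
    unfolding ternary_code_def
    by (rule suminf_le[OF _ summable_ternary sums_summable[OF s]]) (auto simp: divide_right_mono)
  then show "ternary_code b \<le> 1 / 2" using s by (simp add: sums_iff)
qed

lemma ternary_code_Suc: "3 * ternary_code b = of_bool (b 0) + ternary_code (\<lambda>j. b (Suc j))"
proof -
  have "ternary_code b = of_bool (b 0) / 3 + (\<Sum>j. of_bool (b (Suc j)) / 3 ^ Suc (Suc j))"
    unfolding ternary_code_def using suminf_split_head[OF summable_ternary[of b]] by simp
  also have "(\<Sum>j. of_bool (b (Suc j)) / 3 ^ Suc (Suc j) :: real)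
     = (\<Sum>j. of_bool (b (Suc j)) / 3 ^ Suc j) / 3"
    by (subst suminf_divide[OF summable_ternary, symmetric]) (simp add: field_simps)
  finally show ?thesis unfolding ternary_code_def by simp
qed

text \<open>Both equations share one \<open>z\<close>, which is the floor at level \<open>n\<close>;
  passing to the next level then exposes the digit \<open>b n\<close>. The induction runs on the
  second equation.\<close>

lemma ternary_code_shift:
  "\<exists>z::int. 3 ^ n * ternary_code b = z + ternary_code (\<lambda>j. b (j + n))
     \<and> 3 ^ Suc n * ternary_code b = 3 * z + of_bool (b n) + ternary_code (\<lambda>j. b (j + Suc n))"
proof (induction n)
  case 0
  show ?case using ternary_code_Suc[of b] by (intro exI[of _ 0]) auto
next
  case (Suc n)
  then obtain z :: int where z:
    "3 ^ Suc n * ternary_code b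
       = 3 * real_of_int z + of_bool (b n) + ternary_code (\<lambda>j. b (j + Suc n))"
    by blast
  let ?z = "3 * z + of_bool (b n)"
  have "3 ^ Suc (Suc n) * ternary_code b
    = 3 * real_of_int ?z + 3 * ternary_code (\<lambda>j. b (j + Suc n))"
    using z by (simp add: algebra_simps)
  also have "3 * ternary_code (\<lambda>j. b (j + Suc n))
    = of_bool (b (Suc n)) + ternary_code (\<lambda>j. b (j + Suc (Suc n)))"
    using ternary_code_Suc[of "\<lambda>j. b (j + Suc n)"] by simp
  finally show ?case using z by (intro exI[of _ ?z]) simp
qed

text \<open>The second claim provides the gap: fractional parts stay in [0, 1/2], so two scaled
  codes at distance below 1/2 have the same floor. The first claim lets the digit be read off modulo
  3.\<close>

lemma floor_ternary_code: 
  "\<lfloor>3 ^ Suc n * ternary_code b\<rfloor> = 3 * \<lfloor>3 ^ n * ternary_code b\<rfloor> + of_bool (b n)"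
  "3 ^ n * ternary_code b - \<lfloor>3 ^ n * ternary_code b\<rfloor> \<le> 1/2"
proof -
  obtain z :: int where z: "3 ^ n * ternary_code b = z + ternary_code (\<lambda>j. b (j + n))"
     "3 ^ Suc n * ternary_code b = 3 * real_of_int z + of_bool (b n) + ternary_code (\<lambda>j. b (j + Suc n))"
    using ternary_code_shift by blast
  have a: "\<lfloor>3 ^ n * ternary_code b\<rfloor> = z"
    using z(1) ternary_code_bounds[of "\<lambda>j. b (j + n)"] by linarith
  have "\<lfloor>3 ^ Suc n * ternary_code b\<rfloor> = 3 * z + of_bool (b n)"
    using z(2) ternary_code_bounds[of "\<lambda>j. b (j + Suc n)"] by (intro floor_unique) auto
  then show "\<lfloor>3 ^ Suc n * ternary_code b\<rfloor> = 3 * \<lfloor>3 ^ n * ternary_code b\<rfloor> + of_bool (b n)"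
    using a by simp
  show "3 ^ n * ternary_code b - \<lfloor>3 ^ n * ternary_code b\<rfloor> \<le> 1/2"
    using a z(1) ternary_code_bounds[of "\<lambda>j. b (j + n)"] by linarith
qed

definition ternary_bit :: "nat \<Rightarrow> real \<Rightarrow> bool" where
  "ternary_bit j y \<longleftrightarrow> \<lfloor>3 ^ Suc j * y\<rfloor> mod 3 = 1"

lemma ternary_bit_code [simp]: "ternary_bit j (ternary_code b) = b j"
  unfolding ternary_bit_def floor_ternary_code(1) by auto

lemma measurable_ternary_bit [measurable]: "Measurable.pred borel (ternary_bit j)"
  unfolding ternary_bit_def by measurable

lemma ternary_code_convergent_imp_bits:
  assumes "(\<lambda>n. ternary_code (b n)) \<longlonglongrightarrow> y"
  shows "\<exists>v. \<forall>\<^sub>F n in sequentially. b n j = v"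
proof -
  have "(\<lambda>n. 3 ^ Suc j * ternary_code (b n)) \<longlonglongrightarrow> 3 ^ Suc j * y"
    by (intro tendsto_intros assms)
  \<comment> \<open>A tolerance of 1/8 around the limit leaves at most 1/4 between two scaled codes,
    below the gap of 1/2.\<close>
  then obtain N where N: "\<And>n. n \<ge> N \<Longrightarrow> \<bar>3 ^ Suc j * ternary_code (b n) - 3 ^ Suc j * y\<bar> < 1/8"
    unfolding lim_sequentially dist_real_def by (metis zero_less_divide_1_iff zero_less_numeral)
  have "b n j = b N j" if "n \<ge> N" for n
  proof -
    have "\<bar>3 ^ Suc j * ternary_code (b n) - 3 ^ Suc j * ternary_code (b N)\<bar> < 1/4"
      using N[OF that] N[OF order_refl] by linarith
    then have "\<lfloor>3 ^ Suc j * ternary_code (b n)\<rfloor> = \<lfloor>3 ^ Suc j * ternary_code (b N)\<rfloor>"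
      using floor_ternary_code(2)[of "Suc j" "b n"] floor_ternary_code(2)[of "Suc j" "b N"]
      by linarith
    then show ?thesis
      by (metis ternary_bit_code ternary_bit_def)
  qed
  then show ?thesis by (auto simp: eventually_sequentially)
qed


text \<open>The cell indices of a point are coded by a real number; Helly's theorem and the Skorokhod
  representation on the line give convergent codes, whose digits eventually stabilise. Tightness rules
  out that an index escapes to infinity, and completeness turns stable indices into a limit point.\<close>

theorem (in Metric_space) Skorokhod_subsequence:
  fixes P :: "nat \<Rightarrow> 'a measure" and A :: "nat \<Rightarrow> nat \<Rightarrow> 'a set"
  assumes complete: mcomplete
    and P: "\<And>n. prob_space (P n)" "\<And>n. sets (P n) = sets (borel_of mtopology)"
    and A_meas: "\<And>k i. A k i \<in> sets (borel_of mtopology)"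
    and A_diam: "\<And>k i x y. x \<in> A k i \<Longrightarrow> y \<in> A k i \<Longrightarrow> d x y \<le> 1 / 2 ^ k"
    and A_cover: "\<And>k. M \<subseteq> (\<Union>i. A k i)"
    and A_tight: "\<And>k e. e > 0 \<Longrightarrow> \<exists>N. \<forall>n. measure (P n) (M - (\<Union>i\<le>N. A k i)) \<le> e"
  shows "\<exists>r (\<Omega>::real measure) X Y. strict_mono (r :: nat \<Rightarrow> nat) \<and> prob_space \<Omega> \<and>
    (\<forall>n. X n \<in> \<Omega> \<rightarrow>\<^sub>M borel_of mtopology \<and> distr \<Omega> (borel_of mtopology) (X n) = P (r n)) \<and>
    Y \<in> \<Omega> \<rightarrow>\<^sub>M borel_of mtopology \<and> (\<forall>s\<in>space \<Omega>. (\<lambda>n. d (X n s) (Y s)) \<longlonglongrightarrow> 0)"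
proof -
  note [measurable] = A_meas
  have sp: "space (P n) = M" for n
    using sets_eq_imp_space_eq[OF P(2)] by simp
  obtain x0 where x0: "x0 \<in> M"
    using prob_space.not_empty[OF P(1), of 0] sp by auto
  have AM: "A k i \<subseteq> M" for k i using sets.sets_into_space[OF A_meas[of k i]] by simp
  define c where "c k x = (LEAST i. x \<in> A k i)" for k x
  have cA: "x \<in> A k (c k x)" if "x \<in> M" for k x
    unfolding c_def using A_cover[of k] that by (intro LeastI_ex[of "\<lambda>i. x \<in> A k i"]) blast
  have c_meas [measurable]: "c k \<in> borel_of mtopology \<rightarrow>\<^sub>M count_space UNIV" for k
    unfolding c_def by measurable
  \<comment> \<open>The cell index is written in unary: the digit at (\<open>k\<close>,
    \<open>i\<close>) tells whether it equals \<open>i\<close>. All levels thus fit into one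
    sequence of bits.\<close>
  define b where "b x j = (case prod_decode j of (k, i) \<Rightarrow> c k x = i)" for x j
  have b_meas [measurable]: "Measurable.pred (borel_of mtopology) (\<lambda>x. b x j)" for j
    unfolding b_def by (cases "prod_decode j") simp
  define g where "g x = ternary_code (b x)" for x
  have g_meas [measurable]: "g \<in> borel_measurable (borel_of mtopology)"
    unfolding g_def ternary_code_def by measurable
  have bit_g: "ternary_bit (prod_encode (k, i)) (g x) \<longleftrightarrow> c k x = i" for k i x
    by (simp add: g_def b_def)
  define a where "a k y = (LEAST i. ternary_bit (prod_encode (k, i)) y)" for k y
  have a_g: "a k (g x) = c k x" for k x
    unfolding a_def bit_g by (intro Least_equality) auto
  have a_meas [measurable]: "a k \<in> borel \<rightarrow>\<^sub>M count_space UNIV" for k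
    unfolding a_def by measurable
  define p where "p k i = (if A k i = {} then x0 else SOME x. x \<in> A k i)" for k i
  have pA: "p k i \<in> A k i" if "x \<in> A k i" for x k i
    using that someI[of "\<lambda>x. x \<in> A k i" x] by (auto simp: p_def)
  have pM: "p k i \<in> M" for k i
    using pA[of _ k i] AM[of k i] x0 by (cases "A k i = {}") (auto simp: p_def)
  \<comment> \<open>\<open>G\<close> contains the code of every point, and on \<open>G\<close> the
    representatives read off from \<open>y\<close> form a Cauchy sequence with an explicit rate. The
    decoder \<open>h\<close> therefore exists on the whole line and is measurable as a limit of the
    maps \<open>z k\<close>.\<close>
  define G where "G = {y. \<forall>k l. d (p k (a k y)) (p l (a l y)) \<le> 1 / 2 ^ k + 1 / 2 ^ l}"
  have [measurable]: "(\<lambda>y. d (p k (a k y)) (p l (a l y))) \<in> borel_measurable borel" for k l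
  proof -
    have "(\<lambda>y. d (p k i) (p l (a l y))) \<in> borel_measurable borel" for i
      by (rule measurable_compose[OF a_meas]) simp
    then show ?thesis
      by (rule measurable_compose_countable[where f = "\<lambda>i y. d (p k i) (p l (a l y))", OF _ a_meas])
  qed
  have G_meas [measurable]: "G \<in> sets borel"
    unfolding G_def by measurable
  define z where "z k y = (if y \<in> G then p k (a k y) else x0)" for k y
  have z_meas: "z k \<in> borel \<rightarrow>\<^sub>M borel_of mtopology" for k
  proof -
    have "(\<lambda>y. p k (a k y)) \<in> borel \<rightarrow>\<^sub>M borel_of mtopology"
      by (rule measurable_compose[OF a_meas]) (simp add: pM)
    then show ?thesis unfolding z_def using x0
      by (intro measurable_If_set) (auto simp: G_meas)
  qed
  have zM: "z k y \<in> M" for k y by (auto simp: z_def pM x0)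
  have z_lim: "\<exists>x\<in>M. (\<lambda>k. d (z k y) x) \<longlonglongrightarrow> 0" for y
  proof (cases "y \<in> G")
    case True
    have "MCauchy (\<lambda>k. z k y)"
      unfolding MCauchy_def
    proof (intro conjI allI impI)
      show "range (\<lambda>k. z k y) \<subseteq> M" using zM by auto
      fix e :: real assume "e > 0"
      then obtain N where N: "(1 / 2) ^ N < e / 2"
        using real_arch_pow_inv[of "e / 2" "1 / 2"] by auto
      show "\<exists>N. \<forall>n n'. N \<le> n \<longrightarrow> N \<le> n' \<longrightarrow> d (z n y) (z n' y) < e"
      proof (intro exI allI impI)
        fix n n' assume n: "N \<le> n" "N \<le> n'"
        have *: "1 / 2 ^ n \<le> (1 / 2 :: real) ^ N" if "N \<le> n" for n
          using power_decreasing[OF that, of "1 / 2 :: real"] by (simp add: power_one_over)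
        have "d (z n y) (z n' y) \<le> 1 / 2 ^ n + 1 / 2 ^ n'"
          using True by (auto simp: z_def G_def)
        then show "d (z n y) (z n' y) < e" using *[OF n(1)] *[OF n(2)] N by linarith
      qed
    qed
    then obtain x where "limitin mtopology (\<lambda>k. z k y) x sequentially"
      using complete by (auto simp: mcomplete_def)
    then show ?thesis by (auto simp: limitin_metric_dist_null)
  next
    case False
    then show ?thesis using x0 by (intro bexI[of _ x0]) (auto simp: z_def)
  qed
  define h where "h y = (SOME x. x \<in> M \<and> (\<lambda>k. d (z k y) x) \<longlonglongrightarrow> 0)" for y
  have h: "h y \<in> M" "(\<lambda>k. d (z k y) (h y)) \<longlonglongrightarrow> 0" for y
    using someI_ex[OF z_lim[of y, unfolded Bex_def]] unfolding h_def by auto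
  have h_meas [measurable]: "h \<in> borel \<rightarrow>\<^sub>M borel_of mtopology"
    using h by (intro measurable_limit[OF z_meas]) auto
  have hg: "h (g x) = x" if x: "x \<in> M" for x
  proof -
    have dp: "d (p k (c k x)) x \<le> 1 / 2 ^ k" for k
      using A_diam[OF pA[OF cA[OF x]] cA[OF x]] .
    have "d (p k (c k x)) (p l (c l x)) \<le> 1 / 2 ^ k + 1 / 2 ^ l" for k l
      using triangle'[OF pM x pM, of k "c k x" l "c l x"] dp[of k] dp[of l] by linarith
    then have G: "g x \<in> G" by (auto simp: G_def a_g)
    have "(\<lambda>k. 1 / 2 ^ k + d (z k (g x)) (h (g x))) \<longlonglongrightarrow> 0 + 0"
      by (intro tendsto_add h(2) LIMSEQ_divide_realpow_zero) auto
    moreover have "d x (h (g x)) \<le> 1 / 2 ^ k + d (z k (g x)) (h (g x))" for k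
    proof -
      have "d x (h (g x)) \<le> d (z k (g x)) x + d (z k (g x)) (h (g x))"
        using triangle''[OF x zM h(1)] by blast
      then show ?thesis using dp[of k] G by (auto simp: z_def a_g)
    qed
    ultimately have "d x (h (g x)) \<le> 0"
      by (intro LIMSEQ_le_const[of "\<lambda>k. 1 / 2 ^ k + d (z k (g x)) (h (g x))"]) auto
    then have "d x (h (g x)) = 0" by (simp add: order_antisym)
    then show ?thesis using x h(1)[of "g x"] by simp
  qed
  have gP [measurable]: "g \<in> borel_measurable (P n)" for n
    using g_meas P(2) by (simp cong: measurable_cong_sets)
  have gb: "-1 < g x \<and> g x \<le> 1" for x
    using ternary_code_bounds[of "b x"] unfolding g_def by linarith
  define \<nu> where "\<nu> n = distr (P n) borel g" for n
  have \<nu>: "real_distribution (\<nu> n)" for n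
    unfolding \<nu>_def using prob_space.real_distribution_distr[OF P(1) gP] .
  \<comment> \<open>All codes lie in [0, 1/2], so tightness on the line is automatic. The tightness
    of \<open>P\<close> enters only in \<open>ae2\<close>.\<close>
  have "tight \<nu>"
    unfolding tight_def
  proof (intro conjI allI impI)
    fix e :: real assume "e > 0"
    have "measure (\<nu> n) {-1<..1} = 1" for n
    proof -
      have "g -` {-1<..1} \<inter> space (P n) = space (P n)"
        using gb by auto
      then show ?thesis
        unfolding \<nu>_def by (simp add: measure_distr prob_space.prob_space[OF P(1)])
    qed
    then show "\<exists>a b::real. a < b \<and> (\<forall>n. measure (\<nu> n) {a<..b} > 1 - e)"
      using \<open>e > 0\<close> by (intro exI[of _ "-1"] exI[of _ 1]) auto
  qed (rule \<nu>)
  then obtain r L where r: "strict_mono r" and L: "real_distribution L" "weak_conv_m (\<nu> \<circ> id \<circ> r) L"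
    using tight_imp_convergent_subsubsequence[of \<nu> id] strict_mono_id by blast
  obtain \<Omega> :: "real measure" and U :: "nat \<Rightarrow> real \<Rightarrow> real" and V :: "real \<Rightarrow> real" where
    \<Omega>: "prob_space \<Omega>" and U [measurable]: "\<And>n. U n \<in> borel_measurable \<Omega>"
    and U_distr: "\<And>n. distr \<Omega> borel (U n) = \<nu> (r n)"
    and UV: "\<And>s. s \<in> space \<Omega> \<Longrightarrow> (\<lambda>n. U n s) \<longlonglongrightarrow> V s"
  proof -
    have "real_distribution ((\<nu> \<circ> id \<circ> r) n)" for n by (simp add: \<nu>)
    from Skorohod[OF this L] obtain \<Omega> :: "real measure" and U V where
      "prob_space \<Omega>" "\<forall>n. U n \<in> borel_measurable \<Omega>"
      "\<forall>n. distr \<Omega> borel (U n) = (\<nu> \<circ> id \<circ> r) n"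
      "\<forall>s\<in>space \<Omega>. (\<lambda>n. U n s) \<longlonglongrightarrow> V s"
      by blast
    then show thesis by (intro that[of \<Omega> U V]) auto
  qed
  interpret \<Omega>: prob_space \<Omega> by fact
  define X' where "X' n s = h (U n s)" for n s
  have X' [measurable]: "X' n \<in> \<Omega> \<rightarrow>\<^sub>M borel_of mtopology" for n
    unfolding X'_def by measurable
  have X'M: "X' n s \<in> M" for n s by (simp add: X'_def h)
  have X'_distr: "distr \<Omega> (borel_of mtopology) (X' n) = P (r n)" for n
  proof -
    have "distr \<Omega> (borel_of mtopology) (X' n) = distr (distr \<Omega> borel (U n)) (borel_of mtopology) h"
      by (simp add: distr_distr X'_def[abs_def] comp_def)
    also have "\<dots> = distr (P (r n)) (borel_of mtopology) (h \<circ> g)"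
      unfolding U_distr \<nu>_def by (simp add: distr_distr)
    also have "\<dots> = distr (P (r n)) (P (r n)) (\<lambda>x. x)"
      by (rule distr_cong) (auto simp: P(2) sp hg)
    finally show ?thesis by (simp add: distr_id2)
  qed
  \<comment> \<open>The law of \<open>U n\<close> is carried by codes, so almost surely the digits
    of \<open>U n s\<close> are the cell indices of the decoded point \<open>X' n s\<close>.\<close>
  have ae1: "AE s in \<Omega>. U n s = g (X' n s)" for n
  proof -
    have "AE x in P (r n). g x = g (h (g x))"
      by (rule AE_I2) (simp add: sp hg)
    then have "AE y in \<nu> (r n). y = g (h y)"
      unfolding \<nu>_def by (subst AE_distr_iff) auto
    then have "AE y in distr \<Omega> borel (U n). y = g (h y)" unfolding U_distr .
    then show ?thesis unfolding X'_def by (subst (asm) AE_distr_iff) auto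
  qed
  \<comment> \<open>Asking for a bounded index only infinitely often makes the estimate easy: the
    event that the index exceeds \<open>N\<close> at all times from \<open>j\<close> on is contained
    in the event at time \<open>j\<close> alone, whose probability is at most \<open>e\<close> by
    tightness.\<close>
  have ae2: "AE s in \<Omega>. \<exists>N. \<exists>\<^sub>F n in sequentially. c k (X' n s) \<le> N" for k
  proof -
    define E where "E N j = {s \<in> space \<Omega>. \<forall>n\<ge>j. N < c k (X' n s)}" for N j :: nat
    have E_meas [measurable]: "E N j \<in> sets \<Omega>" for N j unfolding E_def by measurable
    let ?Z = "\<Inter>N. \<Union>j. E N j"
    have "emeasure \<Omega> ?Z \<le> ennreal e" if e: "e > 0" for e
    proof -
      obtain N where N: "\<And>n. measure (P n) (M - (\<Union>i\<le>N. A k i)) \<le> e"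
        using A_tight[OF e] by blast
      have "emeasure \<Omega> (E N j) \<le> ennreal e" for j
      proof -
        have "emeasure \<Omega> (E N j) \<le> emeasure \<Omega> (X' j -` (M - (\<Union>i\<le>N. A k i)) \<inter> space \<Omega>)"
        proof (rule emeasure_mono)
          show "E N j \<subseteq> X' j -` (M - (\<Union>i\<le>N. A k i)) \<inter> space \<Omega>"
          proof (rule subsetI)
            fix s assume "s \<in> E N j"
            then have s: "s \<in> space \<Omega>" "N < c k (X' j s)" by (auto simp: E_def)
            have "X' j s \<notin> A k i" if "i \<le> N" for i
              using s(2) that not_less_Least[of i "\<lambda>i. X' j s \<in> A k i"] unfolding c_def by linarith
            then show "s \<in> X' j -` (M - (\<Union>i\<le>N. A k i)) \<inter> space \<Omega>" using s X'M by blast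
          qed
          have "M - (\<Union>i\<le>N. A k i) \<in> sets (borel_of mtopology)"
            using sets.compl_sets[of "\<Union>i\<le>N. A k i" "borel_of mtopology"] by auto
          then show "X' j -` (M - (\<Union>i\<le>N. A k i)) \<inter> space \<Omega> \<in> sets \<Omega>"
            using X' by measurable
        qed
        also have "\<dots> = emeasure (distr \<Omega> (borel_of mtopology) (X' j)) (M - (\<Union>i\<le>N. A k i))"
          using sets.compl_sets[of "\<Union>i\<le>N. A k i" "borel_of mtopology"]
          by (subst emeasure_distr) auto
        also have "\<dots> = emeasure (P (r j)) (M - (\<Union>i\<le>N. A k i))"
          by (simp add: X'_distr)
        also have "\<dots> \<le> ennreal e"
          using N[of "r j"] finite_measure.emeasure_eq_measure[OF prob_space.finite_measure[OF P(1)]]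
          by (simp add: ennreal_leI)
        finally show ?thesis .
      qed
      moreover have "incseq (E N)" by (auto simp: E_def incseq_def)
      then have "(SUP j. emeasure \<Omega> (E N j)) = emeasure \<Omega> (\<Union>j. E N j)"
        by (intro SUP_emeasure_incseq) auto
      ultimately have "emeasure \<Omega> (\<Union>j. E N j) \<le> ennreal e"
        by (metis SUP_least)
      moreover have "emeasure \<Omega> ?Z \<le> emeasure \<Omega> (\<Union>j. E N j)"
        by (intro emeasure_mono) auto
      ultimately show ?thesis by simp
    qed
    then have "emeasure \<Omega> ?Z = 0"
      using ennreal_le_epsilon[of 0 "emeasure \<Omega> ?Z"] by (simp add: ennreal_zero_less_top)
    then have "?Z \<in> null_sets \<Omega>" by auto
    then show ?thesis
      by (rule AE_I') (auto simp: E_def frequently_def eventually_sequentially not_le, metis not_less)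
  qed
  have conv: "\<exists>x\<in>M. (\<lambda>n. d (X' n s) x) \<longlonglongrightarrow> 0"
    if s: "s \<in> space \<Omega>" and 1: "\<And>n. U n s = g (X' n s)"
      and 2: "\<And>k. \<exists>N. \<exists>\<^sub>F n in sequentially. c k (X' n s) \<le> N" for s
  proof -
    \<comment> \<open>Every digit is eventually constant. If the digits 0 to \<open>N\<close> were
      all eventually false, the index would eventually exceed \<open>N\<close>, against the bound
      that holds infinitely often.\<close>
    have digit: "\<exists>i. \<forall>\<^sub>F n in sequentially. c k (X' n s) = i" for k
    proof -
      have "(\<lambda>n. ternary_code (b (X' n s))) \<longlonglongrightarrow> V s"
        using UV[OF s] by (simp add: 1 g_def)
      note ternary_code_convergent_imp_bits[OF this]
      from this[of "prod_encode (k, i)" for i]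
      have "\<exists>v. \<forall>\<^sub>F n in sequentially. (c k (X' n s) = i) = v" for i
        by (simp add: b_def)
      then obtain v where v: "\<And>i. \<forall>\<^sub>F n in sequentially. (c k (X' n s) = i) = v i" by metis
      obtain N where N: "\<exists>\<^sub>F n in sequentially. c k (X' n s) \<le> N" using 2 by blast
      have "\<exists>i\<le>N. v i"
      proof (rule ccontr)
        assume nv: "\<not> (\<exists>i\<le>N. v i)"
        have "\<forall>\<^sub>F n in sequentially. c k (X' n s) \<noteq> i" if "i \<in> {..N}" for i
          using v[of i] by (rule eventually_mono) (use nv that in auto)
        then have "\<forall>i\<in>{..N}. \<forall>\<^sub>F n in sequentially. c k (X' n s) \<noteq> i" by blast
        then have "\<forall>\<^sub>F n in sequentially. \<forall>i\<in>{..N}. c k (X' n s) \<noteq> i"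
          by (intro eventually_ball_finite) auto
        then have "\<forall>\<^sub>F n in sequentially. \<not> c k (X' n s) \<le> N"
          by (rule eventually_mono) auto
        then show False using N by (simp add: frequently_def)
      qed
      then obtain i where "v i" by blast
      with v[of i] show ?thesis by auto
    qed
    have "MCauchy (\<lambda>n. X' n s)"
      unfolding MCauchy_def
    proof (intro conjI allI impI)
      show "range (\<lambda>n. X' n s) \<subseteq> M" using X'M by auto
      fix e :: real assume "e > 0"
      then obtain k where k: "(1 / 2) ^ k < e"
        using real_arch_pow_inv[of e "1 / 2"] by auto
      obtain i N where N: "\<And>n. n \<ge> N \<Longrightarrow> c k (X' n s) = i"
        using digit[of k] by (auto simp: eventually_sequentially)
      have "d (X' n s) (X' n' s) < e" if "N \<le> n" "N \<le> n'" for n n'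
      proof -
        have "d (X' n s) (X' n' s) \<le> 1 / 2 ^ k"
          using cA[OF X'M[of n s], of k] cA[OF X'M[of n' s], of k] N that by (intro A_diam[of _ k i]) auto
        then show ?thesis using k by (simp add: power_one_over)
      qed
      then show "\<exists>N. \<forall>n n'. N \<le> n \<longrightarrow> N \<le> n' \<longrightarrow> d (X' n s) (X' n' s) < e" by blast
    qed
    then obtain x where "limitin mtopology (\<lambda>n. X' n s) x sequentially"
      using complete by (auto simp: mcomplete_def)
    then show ?thesis by (auto simp: limitin_metric_dist_null)
  qed
  have "AE s in \<Omega>. (\<forall>n. U n s = g (X' n s)) \<and> (\<forall>k. \<exists>N. \<exists>\<^sub>F n in sequentially. c k (X' n s) \<le> N)"
    using ae1 ae2 by (simp add: AE_all_countable)
  then obtain Z where Z: "Z \<in> null_sets \<Omega>"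
    "\<And>s. s \<in> space \<Omega> \<Longrightarrow> s \<notin> Z \<Longrightarrow> \<exists>x\<in>M. (\<lambda>n. d (X' n s) x) \<longlonglongrightarrow> 0"
    using conv by (elim AE_E3) blast
  have [measurable]: "Z \<in> sets \<Omega>" using Z by auto
  \<comment> \<open>A change on a null set keeps the laws and turns almost sure convergence into
    convergence at every point.\<close>
  define X where "X n s = (if s \<in> Z then x0 else X' n s)" for n s
  have X [measurable]: "X n \<in> \<Omega> \<rightarrow>\<^sub>M borel_of mtopology" for n
    unfolding X_def using x0 by (intro measurable_If_set) auto
  have "distr \<Omega> (borel_of mtopology) (X n) = distr \<Omega> (borel_of mtopology) (X' n)" for n
    using AE_not_in[OF Z(1)] by (intro distr_cong_AE) (auto simp: X_def)
  then have X_distr: "distr \<Omega> (borel_of mtopology) (X n) = P (r n)" for n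
    by (simp add: X'_distr)
  have "\<forall>s\<in>space \<Omega>. \<exists>x\<in>M. (\<lambda>n. d (X n s) x) \<longlonglongrightarrow> 0"
  proof
    fix s assume "s \<in> space \<Omega>"
    then show "\<exists>x\<in>M. (\<lambda>n. d (X n s) x) \<longlonglongrightarrow> 0"
      using Z(2)[of s] x0 by (cases "s \<in> Z") (auto simp: X_def intro!: bexI[of _ x0] simp del: nonneg)
  qed
  then obtain Y where Y: "\<And>s. s \<in> space \<Omega> \<Longrightarrow> Y s \<in> M"
      "\<And>s. s \<in> space \<Omega> \<Longrightarrow> (\<lambda>n. d (X n s) (Y s)) \<longlonglongrightarrow> 0"
    by metis
  have "Y \<in> \<Omega> \<rightarrow>\<^sub>M borel_of mtopology"
    using X Y by (rule measurable_limit)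
  then show ?thesis using r \<Omega> X X_distr Y(2) by blast
qed

section \<open>The canonical space as a complete metric space\<close>

text \<open>Used for the evaluations of a path at fixed, random and truncated times, whose
  sequential continuity is what locally uniform convergence yields directly.\<close>

lemma (in Metric_space) seq_continuous_imp_borel_measurable:
  fixes f :: "'a \<Rightarrow> real"
  assumes f: "\<And>X y. (\<And>n. X n \<in> M) \<Longrightarrow> y \<in> M \<Longrightarrow> (\<lambda>n. d (X n) y) \<longlonglongrightarrow> 0 \<Longrightarrow> (\<lambda>n. f (X n)) \<longlonglongrightarrow> f y"
  shows "f \<in> borel_measurable (borel_of mtopology)"
proof (rule borel_measurableI)
  fix S :: "real set" assume S: "open S"
  have "openin mtopology (f -` S \<inter> M)"
    unfolding openin_mtopology
  proof (intro conjI allI impI)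
    fix y assume y: "y \<in> f -` S \<inter> M"
    show "\<exists>r>0. mball y r \<subseteq> f -` S \<inter> M"
    proof (rule ccontr)
      assume "\<not> ?thesis"
      then have "\<exists>x\<in>mball y (1 / real (Suc n)). x \<notin> f -` S" for n
        by (metis IntI in_mball of_nat_0_less_iff subsetI zero_less_Suc zero_less_divide_1_iff)
      then obtain X where X: "\<And>n. X n \<in> mball y (1 / real (Suc n))" "\<And>n. X n \<notin> f -` S"
        by metis
      have "(\<lambda>n. d (X n) y) \<longlonglongrightarrow> 0"
      proof (rule tendsto_sandwich[of "\<lambda>_. 0"])
        show "(\<lambda>n. 1 / real (Suc n)) \<longlonglongrightarrow> 0"
          by (rule LIMSEQ_inverse_real_of_nat[unfolded inverse_eq_divide])
        show "\<forall>\<^sub>F n in sequentially. d (X n) y \<le> 1 / real (Suc n)"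
          using X(1) by (intro always_eventually) (auto simp: commute less_imp_le)
      qed auto
      then have "(\<lambda>n. f (X n)) \<longlonglongrightarrow> f y" using X(1) y by (intro f) auto
      then have "\<forall>\<^sub>F n in sequentially. f (X n) \<in> S" using S y by (intro topological_tendstoD) auto
      then show False using X(2) by auto
    qed
  qed auto
  then show "f -` S \<inter> space (borel_of mtopology) \<in> sets (borel_of mtopology)"
    by (simp add: openin_borel_of)
qed

text \<open>One parameter controls both the accuracy \<open>e\<close> and the time horizon
  1/\<open>e\<close>, so that a single number metrises locally uniform convergence together with
  convergence of the times.\<close>

definition close_within :: "nat \<Rightarrow> real \<Rightarrow> (real \<Rightarrow> real) \<times> (nat \<Rightarrow> real) \<Rightarrow> (real \<Rightarrow> real) \<times> (nat \<Rightarrow> real) \<Rightarrow> bool"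
  where "close_within m e x y \<longleftrightarrow>
    (\<forall>t\<in>{0..1 / e}. \<bar>B t x - B t y\<bar> \<le> e) \<and> (\<forall>i\<in>{1..m}. \<bar>T i x - T i y\<bar> \<le> e)"

text \<open>The value 0 off the canonical space is a convention: a metric in the sense of
  \<^locale>\<open>Metric_space\<close> has to be nonnegative and symmetric at all arguments.\<close>

definition canonical_dist :: "nat \<Rightarrow> (real \<Rightarrow> real) \<times> (nat \<Rightarrow> real) \<Rightarrow> (real \<Rightarrow> real) \<times> (nat \<Rightarrow> real) \<Rightarrow> real"
  where "canonical_dist m x y =
    (if x \<in> canonical_space m \<and> y \<in> canonical_space m
     then Inf {e. e > 0 \<and> close_within m e x y} else 0)"

lemma canonical_spaceD:
  assumes "x \<in> canonical_space m"
  shows "continuous_on {0..} (\<lambda>t. B t x)" "B 0 x = 0" "fst x \<in> extensional {0..}"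
    "snd x \<in> extensional {1..m}" "i \<in> {1..m} \<Longrightarrow> 0 \<le> T i x"
    "i \<in> {1..m} \<Longrightarrow> j \<in> {1..m} \<Longrightarrow> i \<le> j \<Longrightarrow> T i x \<le> T j x"
  using assms by (auto simp: canonical_space_def paths_def ordered_times_def B_def T_def PiE_iff)

lemma close_within_mono:
  assumes "close_within m e x y" "0 < e" "e \<le> e'" shows "close_within m e' x y"
proof -
  have "1 / e' \<le> 1 / e" using assms by (simp add: frac_le)
  then show ?thesis using assms unfolding close_within_def by (meson atLeastAtMost_iff order.trans)
qed

lemma close_within_commute: "close_within m e x y = close_within m e y x"
  unfolding close_within_def by (simp add: abs_minus_commute)

text \<open>The horizon 1/(e + e') is shorter than 1/e and 1/e', so both estimates are available on
  it; the reciprocal form of the horizon is what makes the triangle inequality work.\<close>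

lemma close_within_triangle:
  assumes "close_within m e x y" "close_within m e' y z" "e > 0" "e' > 0"
  shows "close_within m (e + e') x z"
proof -
  have "1 / (e + e') \<le> 1 / e" "1 / (e + e') \<le> 1 / e'" using assms by (simp_all add: frac_le)
  moreover have "\<bar>a - c\<bar> \<le> e + e'" if "\<bar>a - b\<bar> \<le> e" "\<bar>b - c\<bar> \<le> e'" for a b c :: real
    using that by linarith
  ultimately show ?thesis
    using assms(1,2) unfolding close_within_def by (meson atLeastAtMost_iff order.trans)
qed

text \<open>Guarantees that the infimum defining \<open>canonical_dist\<close> is taken over a
  nonempty set. An accuracy of at least 1 keeps the horizon inside [0, 1], where the difference of
  the two paths is bounded.\<close>

lemma ex_close_within:
  assumes "x \<in> canonical_space m" "y \<in> canonical_space m"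
  shows "\<exists>e>0. close_within m e x y"
proof -
  have "continuous_on {0..1} (\<lambda>t. B t x - B t y)"
    using assms by (intro continuous_on_diff) (auto intro: continuous_on_subset canonical_spaceD)
  then have "bounded ((\<lambda>t. B t x - B t y) ` {0..1})"
    by (intro compact_imp_bounded compact_continuous_image) auto
  then obtain b where "\<forall>z\<in>(\<lambda>t. B t x - B t y) ` {0..1}. norm z \<le> b"
    unfolding bounded_iff by blast
  then have b: "\<And>t. t \<in> {0..1} \<Longrightarrow> \<bar>B t x - B t y\<bar> \<le> b" by auto
  let ?S = "\<Sum>i\<in>{1..m}. \<bar>T i x - T i y\<bar>"
  let ?e = "max 1 (max b ?S)"
  have "\<bar>T i x - T i y\<bar> \<le> ?S" if "i \<in> {1..m}" for i
    using that by (intro member_le_sum) auto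
  moreover have "1 / ?e \<le> 1" by simp
  then have "{0..1 / ?e} \<subseteq> {0..1}" by simp
  ultimately have "close_within m ?e x y"
    unfolding close_within_def using b by (meson le_max_iff_disj subsetD)
  then show ?thesis by (intro exI[of _ ?e]) auto
qed

lemma canonical_dist_lessD:
  assumes "canonical_dist m x y < e" "x \<in> canonical_space m" "y \<in> canonical_space m"
  shows "close_within m e x y"
proof -
  have lt: "Inf {e. e > 0 \<and> close_within m e x y} < e" using assms by (simp add: canonical_dist_def)
  have ne: "{e. e > 0 \<and> close_within m e x y} \<noteq> {}" using ex_close_within[OF assms(2,3)] by blast
  obtain e' where "e' > 0" "close_within m e' x y" "e' < e"
    using cInf_lessD[OF ne lt] by blast
  then show ?thesis using close_within_mono[of m e' x y e] by simp
qed

lemma canonical_dist_le: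
  assumes "close_within m e x y" "0 < e"
  shows "canonical_dist m x y \<le> e"
  using assms unfolding canonical_dist_def
  by (auto intro!: cInf_lower bdd_belowI[of _ 0])

interpretation canonical: Metric_space "canonical_space m" "canonical_dist m" for m
proof
  fix x y z :: "(real \<Rightarrow> real) \<times> (nat \<Rightarrow> real)"
  show nonneg: "0 \<le> canonical_dist m x y" for x y
    using ex_close_within[of x m y] unfolding canonical_dist_def
    by (auto intro!: cInf_greatest)
  show "canonical_dist m x y = canonical_dist m y x"
    by (auto simp: canonical_dist_def close_within_commute)
  { assume xy: "x \<in> canonical_space m" "y \<in> canonical_space m"
    show "canonical_dist m x y = 0 \<longleftrightarrow> x = y"
    proof
      assume "canonical_dist m x y = 0"
      then have c: "close_within m e x y" if "e > 0" for e
        using canonical_dist_lessD[OF _ xy, of e] that by simp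
      have "\<bar>B t x - B t y\<bar> \<le> 0 + e" if "t \<ge> 0" "e > 0" for t e
      proof -
        \<comment> \<open>Capping the accuracy by 1/(t + 1) makes the horizon at least t + 1, so
          that time \<open>t\<close> is seen. The same cap recurs below.\<close>
        have "t \<le> 1 / min e (1 / (t + 1))"
          using that by (auto simp: min_def field_simps)
        then show ?thesis using c[of "min e (1 / (t + 1))"] that unfolding close_within_def by auto
      qed
      then have "B t x = B t y" if "t \<ge> 0" for t
        using field_le_epsilon[of "\<bar>B t x - B t y\<bar>" 0] that by fastforce
      then have 1: "fst x = fst y"
        using canonical_spaceD(3)[OF xy(1)] canonical_spaceD(3)[OF xy(2)]
        by (intro extensionalityI[of _ "{0..}"]) (auto simp: B_def)
      have "\<bar>T i x - T i y\<bar> \<le> 0 + e" if "i \<in> {1..m}" "e > 0" for i e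
        using c[of e] that unfolding close_within_def by auto
      then have "T i x = T i y" if "i \<in> {1..m}" for i
        using field_le_epsilon[of "\<bar>T i x - T i y\<bar>" 0] that by fastforce
      then have "snd x = snd y"
        using canonical_spaceD(4)[OF xy(1)] canonical_spaceD(4)[OF xy(2)]
        by (intro extensionalityI[of _ "{1..m}"]) (auto simp: T_def)
      with 1 show "x = y" by (simp add: prod_eq_iff)
    next
      assume "x = y"
      then have "canonical_dist m x y \<le> 0 + e" if "e > 0" for e
        using that by (auto intro!: canonical_dist_le simp: close_within_def)
      then show "canonical_dist m x y = 0"
        using nonneg[of x y] field_le_epsilon[of "canonical_dist m x y" 0] by fastforce
    qed
    assume z: "z \<in> canonical_space m"
    show "canonical_dist m x z \<le> canonical_dist m x y + canonical_dist m y z"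
    proof (rule field_le_epsilon)
      fix e :: real assume e: "e > 0"
      have "close_within m (canonical_dist m x y + e / 2) x y"
        "close_within m (canonical_dist m y z + e / 2) y z"
        using e xy z by (auto intro!: canonical_dist_lessD)
      then have "close_within m (canonical_dist m x y + e / 2 + (canonical_dist m y z + e / 2)) x z"
        by (rule close_within_triangle) (use e nonneg[of x y] nonneg[of y z] in linarith)+
      then have "canonical_dist m x z \<le> canonical_dist m x y + e / 2 + (canonical_dist m y z + e / 2)"
        using e nonneg[of x y] nonneg[of y z] by (intro canonical_dist_le) auto
      then show "canonical_dist m x z \<le> canonical_dist m x y + canonical_dist m y z + e" by simp
    qed }
qed

lemma canonical_tendsto_T:
  assumes "\<And>n. X n \<in> canonical_space m" "y \<in> canonical_space m"
    and "(\<lambda>n. canonical_dist m (X n) y) \<longlonglongrightarrow> 0" "i \<in> {1..m}"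
  shows "(\<lambda>n. T i (X n)) \<longlonglongrightarrow> T i y"
proof (rule metric_LIMSEQ_I)
  fix r :: real assume "r > 0"
  then obtain N where N: "\<And>n. n \<ge> N \<Longrightarrow> canonical_dist m (X n) y < r / 2"
    using order_tendstoD(2)[OF assms(3), of "r / 2"] by (auto simp: eventually_sequentially)
  have "dist (T i (X n)) (T i y) < r" if "n \<ge> N" for n
  proof -
    have "\<bar>T i (X n) - T i y\<bar> \<le> r / 2"
      using canonical_dist_lessD[OF N[OF that] assms(1,2)] assms(4) by (simp add: close_within_def)
    then show ?thesis using \<open>r > 0\<close> by (simp add: dist_real_def)
  qed
  then show "\<exists>N. \<forall>n\<ge>N. dist (T i (X n)) (T i y) < r" by blast
qed

text \<open>Joint continuity in the path and the time; this is what makes the path evaluated at its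
  own stopping time continuous on the canonical space.\<close>

lemma canonical_tendsto_B:
  assumes X: "\<And>n. X n \<in> canonical_space m" and y: "y \<in> canonical_space m"
    and lim: "(\<lambda>n. canonical_dist m (X n) y) \<longlonglongrightarrow> 0" and t: "\<And>n. t n \<ge> 0" "t \<longlonglongrightarrow> u"
  shows "(\<lambda>n. B (t n) (X n)) \<longlonglongrightarrow> B u y"
proof -
  have u: "u \<ge> 0" using t by (intro LIMSEQ_le_const[OF t(2)]) auto
  have 1: "(\<lambda>n. B (t n) y) \<longlonglongrightarrow> B u y"
    using t u by (intro continuous_on_tendsto_compose[OF canonical_spaceD(1)[OF y]]) auto
  have "(\<lambda>n. B (t n) (X n) - B (t n) y) \<longlonglongrightarrow> 0"
  proof (rule metric_LIMSEQ_I)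
    fix r :: real assume r: "r > 0"
    \<comment> \<open>The extra 1 in the horizon leaves room for the times \<open>t n\<close>, which
      may exceed their limit \<open>u\<close>.\<close>
    define e where "e = min (r / 2) (1 / (u + 1))"
    have e: "e > 0" "e < r" "u + 1 \<le> 1 / e" using r u by (auto simp: e_def min_def field_simps)
    have "\<forall>\<^sub>F n in sequentially. canonical_dist m (X n) y < e \<and> t n < u + 1"
      using order_tendstoD(2)[OF lim e(1)] order_tendstoD(2)[OF t(2), of "u + 1"]
      by (auto intro: eventually_conj)
    then have "\<forall>\<^sub>F n in sequentially. dist (B (t n) (X n) - B (t n) y) 0 < r"
    proof (rule eventually_mono)
      fix n assume n: "canonical_dist m (X n) y < e \<and> t n < u + 1"
      then have "close_within m e (X n) y" using X y by (intro canonical_dist_lessD) auto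
      moreover have "t n \<in> {0..1 / e}" using n e t(1)[of n] by auto
      ultimately have "\<bar>B (t n) (X n) - B (t n) y\<bar> \<le> e" by (auto simp: close_within_def)
      then show "dist (B (t n) (X n) - B (t n) y) 0 < r" using e by simp
    qed
    then show "\<exists>N. \<forall>n\<ge>N. dist (B (t n) (X n) - B (t n) y) 0 < r"
      by (simp add: eventually_sequentially)
  qed
  from tendsto_add[OF this 1] show ?thesis by simp
qed

lemma canonical_mcomplete: "canonical.mcomplete m"
  unfolding canonical.mcomplete_def
proof (intro allI impI)
  fix \<sigma> assume \<sigma>: "canonical.MCauchy m \<sigma>"
  then have M: "\<sigma> n \<in> canonical_space m" for n by (auto simp: canonical.MCauchy_def)
  have C: "\<exists>N. \<forall>n\<ge>N. \<forall>n'\<ge>N. close_within m e (\<sigma> n) (\<sigma> n')" if "e > 0" for e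
    using \<sigma> that M unfolding canonical.MCauchy_def by (meson canonical_dist_lessD)
  have "Cauchy (\<lambda>n. B t (\<sigma> n))" if t: "t \<ge> 0" for t
  proof (rule metric_CauchyI)
    fix r :: real assume r: "r > 0"
    define e where "e = min (r / 2) (1 / (t + 1))"
    have e: "e > 0" "e < r" "t \<le> 1 / e" using r t by (auto simp: e_def min_def field_simps)
    obtain N where "\<And>n n'. n \<ge> N \<Longrightarrow> n' \<ge> N \<Longrightarrow> close_within m e (\<sigma> n) (\<sigma> n')" using C e by blast
    then have "dist (B t (\<sigma> n)) (B t (\<sigma> n')) < r" if "n \<ge> N" "n' \<ge> N" for n n'
      using e t that unfolding close_within_def dist_real_def
      by (metis atLeastAtMost_iff le_less_trans)
    then show "\<exists>N. \<forall>n\<ge>N. \<forall>n'\<ge>N. dist (B t (\<sigma> n)) (B t (\<sigma> n')) < r" by blast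
  qed
  then obtain w where w: "\<And>t. t \<ge> 0 \<Longrightarrow> (\<lambda>n. B t (\<sigma> n)) \<longlonglongrightarrow> w t"
    unfolding Cauchy_convergent_iff convergent_def by metis
  have "Cauchy (\<lambda>n. T i (\<sigma> n))" if i: "i \<in> {1..m}" for i
  proof (rule metric_CauchyI)
    fix r :: real assume r: "r > 0"
    obtain N where "\<And>n n'. n \<ge> N \<Longrightarrow> n' \<ge> N \<Longrightarrow> close_within m (r/2) (\<sigma> n) (\<sigma> n')"
      using C[of "r / 2"] r by auto
    then have "dist (T i (\<sigma> n)) (T i (\<sigma> n')) < r" if "n \<ge> N" "n' \<ge> N" for n n'
      using i that r unfolding close_within_def dist_real_def by (smt (verit) field_sum_of_halves)
    then show "\<exists>N. \<forall>n\<ge>N. \<forall>n'\<ge>N. dist (T i (\<sigma> n)) (T i (\<sigma> n')) < r" by blast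
  qed
  then obtain \<theta> where \<theta>: "\<And>i. i \<in> {1..m} \<Longrightarrow> (\<lambda>n. T i (\<sigma> n)) \<longlonglongrightarrow> \<theta> i"
    unfolding Cauchy_convergent_iff convergent_def by metis
  define y where "y = (restrict w {0..}, restrict \<theta> {1..m})"
  have yB: "B t y = w t" if "t \<ge> 0" for t using that by (simp add: y_def B_def)
  have yT: "T i y = \<theta> i" if "i \<in> {1..m}" for i using that by (simp add: y_def T_def)
  \<comment> \<open>Letting \<open>n'\<close> tend to infinity in the Cauchy estimate preserves it,
    because \<open>close_within\<close> uses non-strict bounds. Uniformity in time then gives
    continuity of the limit path.\<close>
  have close_y: "\<exists>N. \<forall>n\<ge>N. close_within m e (\<sigma> n) y" if e: "e > 0" for e
  proof -
    obtain N where N: "\<And>n n'. n \<ge> N \<Longrightarrow> n' \<ge> N \<Longrightarrow> close_within m e (\<sigma> n) (\<sigma> n')" using C e by blast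
    have "close_within m e (\<sigma> n) y" if n: "n \<ge> N" for n
      unfolding close_within_def
    proof (intro conjI ballI)
      fix t assume t: "t \<in> {0..1 / e}"
      have "(\<lambda>n'. \<bar>B t (\<sigma> n) - B t (\<sigma> n')\<bar>) \<longlonglongrightarrow> \<bar>B t (\<sigma> n) - B t y\<bar>"
        using t w[of t] yB[of t] by (intro tendsto_intros) auto
      then show "\<bar>B t (\<sigma> n) - B t y\<bar> \<le> e"
        by (rule LIMSEQ_le_const2, intro exI[of _ N] allI impI)
          (use N[OF n] t in \<open>auto simp: close_within_def\<close>)
    next
      fix i assume i: "i \<in> {1..m}"
      have "(\<lambda>n'. \<bar>T i (\<sigma> n) - T i (\<sigma> n')\<bar>) \<longlonglongrightarrow> \<bar>T i (\<sigma> n) - T i y\<bar>"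
        using \<theta>[OF i] yT[OF i] by (intro tendsto_intros) auto
      then show "\<bar>T i (\<sigma> n) - T i y\<bar> \<le> e"
        by (rule LIMSEQ_le_const2, intro exI[of _ N] allI impI)
          (use N[OF n] i in \<open>auto simp: close_within_def\<close>)
    qed
    then show ?thesis by blast
  qed
  have "continuous_on {0..} w"
    unfolding continuous_on_iff
  proof (intro ballI allI impI)
    fix t r :: real assume t: "t \<in> {0..}" and r: "r > 0"
    define e where "e = min (r / 4) (1 / (t + 1))"
    have e: "e > 0" "e \<le> r / 4" "t + 1 \<le> 1 / e" using r t by (auto simp: e_def min_def field_simps)
    obtain n where n: "close_within m e (\<sigma> n) y" using close_y[OF e(1)] by blast
    obtain \<delta> where \<delta>: "\<delta> > 0" "\<And>s. s \<in> {0..} \<Longrightarrow> dist s t < \<delta> \<Longrightarrow> dist (B s (\<sigma> n)) (B t (\<sigma> n)) < r / 4"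
      using canonical_spaceD(1)[OF M[of n]] t r unfolding continuous_on_iff
      by (metis zero_less_divide_iff zero_less_numeral)
    have "dist (w s) (w t) < r" if s: "s \<in> {0..}" "dist s t < min \<delta> 1" for s
    proof -
      have "s \<in> {0..1 / e}" "t \<in> {0..1 / e}"
        using s t e by (auto simp: dist_real_def)
      then have "\<bar>B s (\<sigma> n) - w s\<bar> \<le> e" "\<bar>B t (\<sigma> n) - w t\<bar> \<le> e"
        using n yB by (auto simp: close_within_def)
      moreover have "\<bar>B s (\<sigma> n) - B t (\<sigma> n)\<bar> < r / 4" using \<delta>(2)[of s] s by (simp add: dist_real_def)
      ultimately show ?thesis using e(2) r unfolding dist_real_def by linarith
    qed
    then show "\<exists>d>0. \<forall>s\<in>{0..}. dist s t < d \<longrightarrow> dist (w s) (w t) < r"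
      using \<delta>(1) by (intro exI[of _ "min \<delta> 1"]) auto
  qed
  then have "continuous_on {0..} (restrict w {0..})"
    by (subst continuous_on_cong[OF refl, of _ _ w]) auto
  moreover have "w 0 = 0"
    using w[of 0] canonical_spaceD(2)[OF M] by (simp add: LIMSEQ_const_iff)
  moreover have "0 \<le> \<theta> i" if "i \<in> {1..m}" for i
    using canonical_spaceD(5)[OF M that] by (intro LIMSEQ_le_const[OF \<theta>[OF that]]) auto
  moreover have "\<theta> i \<le> \<theta> j" if "i \<in> {1..m}" "j \<in> {1..m}" "i \<le> j" for i j
    using canonical_spaceD(6)[OF M that] by (intro LIMSEQ_le[OF \<theta>[OF that(1)] \<theta>[OF that(2)]]) auto
  ultimately have y: "y \<in> canonical_space m"
    unfolding y_def canonical_space_def paths_def ordered_times_def by auto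
  have "(\<lambda>n. canonical_dist m (\<sigma> n) y) \<longlonglongrightarrow> 0"
  proof (rule metric_LIMSEQ_I)
    fix r :: real assume r: "r > 0"
    obtain N where "\<And>n. n \<ge> N \<Longrightarrow> close_within m (r / 2) (\<sigma> n) y" using close_y[of "r / 2"] r by auto
    then have "\<And>n. n \<ge> N \<Longrightarrow> canonical_dist m (\<sigma> n) y \<le> r / 2" using r by (intro canonical_dist_le) auto
    then show "\<exists>N. \<forall>n\<ge>N. dist (canonical_dist m (\<sigma> n) y) 0 < r"
      using r by (intro exI[of _ N]) fastforce
  qed
  then show "\<exists>x. limitin (canonical.mtopology m) \<sigma> x sequentially"
    using M y by (intro exI[of _ y]) (simp add: canonical.limitin_metric_dist_null)
qed

lemma canonical_mtopology: "canonical.mtopology m = canonical_topology m"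
  unfolding topology_eq
proof (intro allI iffI)
  fix S assume S: "openin (canonical.mtopology m) S"
  show "openin (canonical_topology m) S"
    unfolding canonical_topology_def openin_prod_topology_alt
  proof (intro allI impI)
    fix \<omega> \<theta> assume "(\<omega>, \<theta>) \<in> S"
    then obtain r where r: "r > 0" "canonical.mball m (\<omega>, \<theta>) r \<subseteq> S" and M: "(\<omega>, \<theta>) \<in> canonical_space m"
      using S unfolding canonical.openin_mtopology by blast
    \<comment> \<open>Requiring one bound \<open>a\<close> below r/2 for all times, instead of a
      strict inequality at each time, leaves a uniform margin and makes \<open>U\<close> open. The
      horizon 2/r belongs to the accuracy r/2.\<close>
    define U where "U = {\<eta> \<in> paths. \<exists>a<r/2. \<forall>t\<in>{0..2/r}. \<bar>\<eta> t - \<omega> t\<bar> \<le> a}"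
    define V where "V = ordered_times m \<inter> (\<Pi>\<^sub>E i\<in>{1..m}. {\<theta> i - r/2<..<\<theta> i + r/2})"
    have "open_paths U"
      unfolding open_paths_def
    proof (intro conjI ballI)
      fix \<eta> assume "\<eta> \<in> U"
      then obtain a where a: "a < r / 2" "\<And>t. t \<in> {0..2/r} \<Longrightarrow> \<bar>\<eta> t - \<omega> t\<bar> \<le> a" by (auto simp: U_def)
      have "\<zeta> \<in> U" if "\<zeta> \<in> paths" "\<And>t. t \<in> {0..2/r} \<Longrightarrow> \<bar>\<zeta> t - \<eta> t\<bar> < (r / 2 - a) / 2" for \<zeta>
      proof -
        have "\<bar>\<zeta> t - \<omega> t\<bar> \<le> a + (r / 2 - a) / 2" if t: "t \<in> {0..2/r}" for t
          using a(2)[OF t] \<open>\<And>t. t \<in> {0..2/r} \<Longrightarrow> \<bar>\<zeta> t - \<eta> t\<bar> < (r / 2 - a) / 2\<close>[OF t] by linarith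
        then show ?thesis using that(1) a(1) unfolding U_def
          by (intro CollectI conjI exI[of _ "a + (r / 2 - a) / 2"]) (auto simp: field_simps)
      qed
      then show "\<exists>u\<ge>0. \<exists>e>0. \<forall>\<zeta>\<in>paths. (\<forall>t\<in>{0..u}. \<bar>\<zeta> t - \<eta> t\<bar> < e) \<longrightarrow> \<zeta> \<in> U"
        using a(1) r(1) by (intro exI[of _ "2 / r"] conjI exI[of _ "(r / 2 - a) / 2"]) auto
    qed (auto simp: U_def)
    then have "openin path_topology U" by (simp add: openin_path_topology)
    moreover have "openin (times_topology m) V"
      unfolding times_topology_def V_def Int_commute[of "ordered_times m"]
      by (intro openin_subtopology_Int) (auto simp: openin_PiE_gen)
    moreover have "\<omega> \<in> U" using M r(1) by (auto simp: U_def canonical_space_def intro!: exI[of _ 0])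
    moreover have "\<theta> \<in> V" using M r(1) by (auto simp: V_def canonical_space_def ordered_times_def PiE_iff)
    moreover have "U \<times> V \<subseteq> S"
    proof clarify
      fix \<eta> \<phi> assume "\<eta> \<in> U" "\<phi> \<in> V"
      then obtain a where a: "a < r / 2" "\<And>t. t \<in> {0..2/r} \<Longrightarrow> \<bar>\<eta> t - \<omega> t\<bar> \<le> a"
        and \<phi>: "\<And>i. i \<in> {1..m} \<Longrightarrow> \<phi> i \<in> {\<theta> i - r/2<..<\<theta> i + r/2}"
        and "(\<eta>, \<phi>) \<in> canonical_space m"
        unfolding U_def V_def canonical_space_def by blast
      moreover have "close_within m (r / 2) (\<omega>, \<theta>) (\<eta>, \<phi>)"
        unfolding close_within_def B_def T_def
      proof (intro conjI ballI)
        show "\<bar>fst (\<omega>, \<theta>) t - fst (\<eta>, \<phi>) t\<bar> \<le> r / 2" if "t \<in> {0..1 / (r / 2)}" for t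
          using a(1) a(2)[of t] that by (auto simp: abs_minus_commute)
        show "\<bar>snd (\<omega>, \<theta>) i - snd (\<eta>, \<phi>) i\<bar> \<le> r / 2" if "i \<in> {1..m}" for i
          using \<phi>[OF that] unfolding snd_conv greaterThanLessThan_iff by linarith
      qed
      ultimately have "canonical_dist m (\<omega>, \<theta>) (\<eta>, \<phi>) \<le> r / 2" "(\<eta>, \<phi>) \<in> canonical_space m"
        using r(1) canonical_dist_le[of m "r / 2"] by simp_all
      then have "(\<eta>, \<phi>) \<in> canonical.mball m (\<omega>, \<theta>) r" using r(1) M by auto
      then show "(\<eta>, \<phi>) \<in> S" using r(2) by blast
    qed
    ultimately show "\<exists>U V. openin path_topology U \<and> openin (times_topology m) V \<and> \<omega> \<in> U \<and> \<theta> \<in> V \<and> U \<times> V \<subseteq> S"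
      by blast
  qed
next
  fix S assume S: "openin (canonical_topology m) S"
  have SM: "S \<subseteq> canonical_space m" using openin_subset[OF S] by (simp add: topspace_canonical_topology)
  show "openin (canonical.mtopology m) S"
    unfolding canonical.openin_mtopology
  proof (intro conjI allI impI SM)
    fix x assume x: "x \<in> S"
    then obtain U V where UV: "openin path_topology U" "openin (times_topology m) V"
      "fst x \<in> U" "snd x \<in> V" "U \<times> V \<subseteq> S"
      using S unfolding canonical_topology_def openin_prod_topology_alt by (metis prod.collapse)
    obtain u e where ue: "u \<ge> 0" "e > 0" "\<And>\<eta>. \<eta> \<in> paths \<Longrightarrow> (\<And>t. t \<in> {0..u} \<Longrightarrow> \<bar>\<eta> t - fst x t\<bar> < e) \<Longrightarrow> \<eta> \<in> U"
      using UV(1,3) unfolding openin_path_topology open_paths_def by meson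
    obtain W where W: "openin (product_topology (\<lambda>_. euclideanreal) {1..m}) W" "V = W \<inter> ordered_times m"
      using UV(2) unfolding times_topology_def openin_subtopology by blast
    have "snd x \<in> W" using W UV(4) by blast
    then have "\<exists>Z. finite {i \<in> {1..m}. Z i \<noteq> topspace euclideanreal} \<and>
        (\<forall>i\<in>{1..m}. openin euclideanreal (Z i)) \<and> snd x \<in> Pi\<^sub>E {1..m} Z \<and> Pi\<^sub>E {1..m} Z \<subseteq> W"
      using W(1) unfolding openin_product_topology_alt by (elim conjE bspec)
    then obtain Z where Z: "\<And>i. i \<in> {1..m} \<Longrightarrow> open (Z i)" "snd x \<in> Pi\<^sub>E {1..m} Z" "Pi\<^sub>E {1..m} Z \<subseteq> W"
      unfolding open_openin[symmetric] by blast
    have "\<forall>i\<in>{1..m}. \<exists>c>0. ball (T i x) c \<subseteq> Z i"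
      using Z by (auto simp: T_def PiE_iff open_contains_ball)
    then obtain c where c: "\<And>i. i \<in> {1..m} \<Longrightarrow> c i > 0" "\<And>i. i \<in> {1..m} \<Longrightarrow> ball (T i x) (c i) \<subseteq> Z i"
      by metis
    define r where "r = Min (insert (e / 2) (insert (1 / (u + 1)) ((\<lambda>i. c i / 2) ` {1..m})))"
    have r: "r > 0" "r \<le> e / 2" "r \<le> 1 / (u + 1)" "\<And>i. i \<in> {1..m} \<Longrightarrow> r \<le> c i / 2"
    proof -
      show "r > 0" using c(1) ue(1,2) by (auto simp: r_def)
      show "r \<le> e / 2" "r \<le> 1 / (u + 1)" "\<And>i. i \<in> {1..m} \<Longrightarrow> r \<le> c i / 2"
        unfolding r_def by (rule Min_le; blast)+
    qed
    have ur: "u \<le> 1 / r"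
    proof -
      have "1 / (1 / (u + 1)) \<le> 1 / r" using r ue(1) by (intro frac_le) auto
      then show ?thesis by simp
    qed
    have "canonical.mball m x r \<subseteq> S"
    proof
      fix y assume "y \<in> canonical.mball m x r"
      then have y: "y \<in> canonical_space m" "close_within m r x y"
        by (auto intro: canonical_dist_lessD)
      have "fst y \<in> U"
      proof (rule ue(3))
        show "fst y \<in> paths" using y by (auto simp: canonical_space_def)
        fix t assume "t \<in> {0..u}"
        then have "\<bar>fst x t - fst y t\<bar> \<le> r" using y(2) ur by (auto simp: close_within_def B_def)
        then show "\<bar>fst y t - fst x t\<bar> < e" using r(2) ue(2) by linarith
      qed
      moreover have "snd y \<in> Pi\<^sub>E {1..m} Z"
        unfolding PiE_iff
      proof (intro conjI ballI)
        show "snd y \<in> extensional {1..m}" using canonical_spaceD(4)[OF y(1)] .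
        fix i assume i: "i \<in> {1..m}"
        then have "\<bar>T i x - T i y\<bar> \<le> r" using y(2) by (auto simp: close_within_def)
        then have "T i y \<in> ball (T i x) (c i)" using r(4)[OF i] c(1)[OF i] by (auto simp: dist_real_def)
        then show "snd y i \<in> Z i" using c(2)[OF i] by (auto simp: T_def)
      qed
      then have "snd y \<in> V" using W Z(3) y(1) by (auto simp: canonical_space_def)
      ultimately show "y \<in> S" using UV(5) by (metis mem_Sigma_iff prod.collapse subsetD)
    qed
    then show "\<exists>r>0. canonical.mball m x r \<subseteq> S" using r(1) by blast
  qed
qed

section \<open>Uniqueness of the path law\<close>

abbreviation canonical_borel :: "nat \<Rightarrow> ((real \<Rightarrow> real) \<times> (nat \<Rightarrow> real)) measure" where
  "canonical_borel m \<equiv> borel_of (canonical_topology m)"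

lemma space_canonical_borel: "space (canonical_borel m) = canonical_space m"
  by (simp add: topspace_canonical_topology)

section \<open>Continuous and measurable evaluations on the canonical space\<close>

lemma measurable_T: "i \<in> {1..m} \<Longrightarrow> T i \<in> borel_measurable (canonical_borel m)"
  unfolding canonical_mtopology[symmetric]
  by (rule canonical.seq_continuous_imp_borel_measurable) (rule canonical_tendsto_T)

lemma measurable_B: "0 \<le> t \<Longrightarrow> B t \<in> borel_measurable (canonical_borel m)"
  unfolding canonical_mtopology[symmetric]
  by (rule canonical.seq_continuous_imp_borel_measurable) (rule canonical_tendsto_B; simp)

lemma canonical_tendsto_B_T:
  assumes "\<And>n. X n \<in> canonical_space m" "y \<in> canonical_space m"
    and "(\<lambda>n. canonical_dist m (X n) y) \<longlonglongrightarrow> 0" and i: "i \<in> {1..m}"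
  shows "(\<lambda>n. B (T i (X n)) (X n)) \<longlonglongrightarrow> B (T i y) y"
  using assms canonical_spaceD(5)[OF assms(1) i]
  by (intro canonical_tendsto_B canonical_tendsto_T[OF assms]) auto

lemma canonical_tendsto_B_min_T:
  assumes "\<And>n. X n \<in> canonical_space m" "y \<in> canonical_space m"
    and "(\<lambda>n. canonical_dist m (X n) y) \<longlonglongrightarrow> 0" and i: "i \<in> {1..m}" and t: "0 \<le> t"
  shows "(\<lambda>n. B (min (T i (X n)) t) (X n)) \<longlonglongrightarrow> B (min (T i y) t) y"
  using assms canonical_spaceD(5)[OF assms(1) i]
  by (intro canonical_tendsto_B tendsto_min canonical_tendsto_T[OF assms(1-4)]) auto

lemma measurable_B_T: "i \<in> {1..m} \<Longrightarrow> (\<lambda>x. B (T i x) x) \<in> borel_measurable (canonical_borel m)"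
  unfolding canonical_mtopology[symmetric]
  by (rule canonical.seq_continuous_imp_borel_measurable) (rule canonical_tendsto_B_T)

lemma measurable_B_min_T:
  "i \<in> {1..m} \<Longrightarrow> 0 \<le> t \<Longrightarrow> (\<lambda>x. B (min (T i x) t) x) \<in> borel_measurable (canonical_borel m)"
  unfolding canonical_mtopology[symmetric]
  by (rule canonical.seq_continuous_imp_borel_measurable) (rule canonical_tendsto_B_min_T)

section \<open>The canonical filtration\<close>

definition filtration_generator :: "nat \<Rightarrow> real \<Rightarrow> ((real \<Rightarrow> real) \<times> (nat \<Rightarrow> real)) set set" where
  "filtration_generator m t =
      {{x \<in> canonical_space m. B s x \<in> A} | s A. 0 \<le> s \<and> s \<le> t \<and> A \<in> sets borel} \<union>
      {{x \<in> canonical_space m. T i x \<le> s} | i s. 0 \<le> s \<and> s \<le> t \<and> i \<in> {1..m}}"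

lemma filtration_generator_Pow: "filtration_generator m t \<subseteq> Pow (canonical_space m)"
  by (auto simp: filtration_generator_def)

lemma space_filtration [simp]: "space (canonical_filtration m t) = canonical_space m"
  unfolding canonical_filtration_def filtration_generator_def[symmetric]
  using filtration_generator_Pow by (rule space_measure_of)

lemma sets_filtration:
  "sets (canonical_filtration m t) = sigma_sets (canonical_space m) (filtration_generator m t)"
  unfolding canonical_filtration_def filtration_generator_def[symmetric]
  using filtration_generator_Pow by (rule sets_measure_of)

lemma filtration_mono:
  assumes "s \<le> t"
  shows "sets (canonical_filtration m s) \<subseteq> sets (canonical_filtration m t)"
  unfolding sets_filtration
proof (rule sigma_sets_mono', rule subsetI)
  have *: "r \<le> t" if "r \<le> s" for r using assms that by simp
  fix C assume "C \<in> filtration_generator m s"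
  then consider r A where "C = {x \<in> canonical_space m. B r x \<in> A}" "0 \<le> r" "r \<le> t" "A \<in> sets borel"
    | i r where "C = {x \<in> canonical_space m. T i x \<le> r}" "0 \<le> r" "r \<le> t" "i \<in> {1..m}"
    unfolding filtration_generator_def using * by blast
  then show "C \<in> filtration_generator m t"
    unfolding filtration_generator_def by cases blast+
qed

lemma B_adapted: "0 \<le> s \<Longrightarrow> s \<le> t \<Longrightarrow> B s \<in> borel_measurable (canonical_filtration m t)"
  by (rule measurableI)
    (auto simp: sets_filtration filtration_generator_def vimage_def Int_def conj_commute
      intro!: sigma_sets.Basic)

lemma T_stopping:
  "i \<in> {1..m} \<Longrightarrow> s \<le> t \<Longrightarrow> {x \<in> canonical_space m. T i x \<le> s} \<in> sets (canonical_filtration m t)"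
proof (cases "0 \<le> s")
  case False
  assume "i \<in> {1..m}"
  then have "{x \<in> canonical_space m. T i x \<le> s} = {}"
    using False canonical_spaceD(5)[of _ m i] by fastforce
  then show ?thesis by (metis sets.empty_sets)
qed (auto simp: sets_filtration filtration_generator_def intro!: sigma_sets.Basic)

text \<open>Independence makes the joint law a product, and Tonelli's theorem integrates out
  \<open>Y\<close> with \<open>X\<close> frozen. It serves to average over a Brownian increment
  given the past.\<close>

lemma (in prob_space) nn_integral_indep:
  assumes [measurable]: "X \<in> M \<rightarrow>\<^sub>M S" "Y \<in> M \<rightarrow>\<^sub>M N" "h \<in> borel_measurable (S \<Otimes>\<^sub>M N)"
    and indep: "\<And>a b. a \<in> sets S \<Longrightarrow> b \<in> sets N \<Longrightarrow>
      prob ((X -` a \<inter> space M) \<inter> (Y -` b \<inter> space M)) = prob (X -` a \<inter> space M) * prob (Y -` b \<inter> space M)"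
  shows "(\<integral>\<^sup>+x. h (X x, Y x) \<partial>M) = (\<integral>\<^sup>+x. \<integral>\<^sup>+y. h (X x, y) \<partial>distr M N Y \<partial>M)"
proof -
  interpret X: prob_space "distr M S X" by (rule prob_space_distr) measurable
  interpret Y: prob_space "distr M N Y" by (rule prob_space_distr) measurable
  have "distr M S X \<Otimes>\<^sub>M distr M N Y = distr M (S \<Otimes>\<^sub>M N) (\<lambda>x. (X x, Y x))"
  proof (rule pair_measure_eqI)
    fix a b assume ab: "a \<in> sets (distr M S X)" "b \<in> sets (distr M N Y)"
    then have "emeasure (distr M (S \<Otimes>\<^sub>M N) (\<lambda>x. (X x, Y x))) (a \<times> b)
      = prob ((X -` a \<inter> space M) \<inter> (Y -` b \<inter> space M))"
      by (subst emeasure_distr) (auto simp: emeasure_eq_measure intro!: arg_cong[where f = prob])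
    then show "emeasure (distr M S X) a * emeasure (distr M N Y) b
      = emeasure (distr M (S \<Otimes>\<^sub>M N) (\<lambda>x. (X x, Y x))) (a \<times> b)"
      using ab indep by (simp add: emeasure_distr emeasure_eq_measure ennreal_mult')
  qed (auto intro: X.sigma_finite_measure_axioms Y.sigma_finite_measure_axioms)
  note prod = this
  have h': "h \<in> borel_measurable (distr M S X \<Otimes>\<^sub>M distr M N Y)" by simp
  have "(\<integral>\<^sup>+x. h (X x, Y x) \<partial>M) = (\<integral>\<^sup>+z. h z \<partial>distr M (S \<Otimes>\<^sub>M N) (\<lambda>x. (X x, Y x)))"
    by (subst nn_integral_distr) auto
  also have "\<dots> = (\<integral>\<^sup>+z. h z \<partial>(distr M S X \<Otimes>\<^sub>M distr M N Y))"
    by (simp add: prod)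
  also have "\<dots> = (\<integral>\<^sup>+x. \<integral>\<^sup>+y. h (x, y) \<partial>distr M N Y \<partial>distr M S X)"
    using h' by (rule Y.nn_integral_fst[symmetric])
  also have "\<dots> = (\<integral>\<^sup>+x. \<integral>\<^sup>+y. h (X x, y) \<partial>distr M N Y \<partial>M)"
    by (subst nn_integral_distr) (auto intro!: Y.borel_measurable_nn_integral)
  finally show ?thesis .
qed

lemma measurable_fst_canonical: "fst \<in> canonical_borel m \<rightarrow>\<^sub>M (\<Pi>\<^sub>M t\<in>{0..}. borel)"
proof (rule measurable_PiM_single')
  show "(\<lambda>x. fst x t) \<in> borel_measurable (canonical_borel m)" if "t \<in> {0..}" for t
    using measurable_B[of t m] that by (simp add: B_def[abs_def])
  show "fst \<in> space (canonical_borel m) \<rightarrow> {0..} \<rightarrow>\<^sub>E space borel"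
    unfolding space_canonical_borel using canonical_spaceD(3)[of _ m] by (auto simp: PiE_def)
qed

section \<open>Embeddings and their independent increments\<close>

locale embedding = prob_space P for m :: nat and P :: "((real \<Rightarrow> real) \<times> (nat \<Rightarrow> real)) measure" +
  assumes embedding: "P \<in> embeddings m"
begin

lemma sets_P: "sets P = sets (canonical_borel m)"
  using embedding by (simp add: embeddings_def)

lemma space_P: "space P = canonical_space m"
  using sets_eq_imp_space_eq[OF sets_P] unfolding space_canonical_borel .

lemma measurable_P: "borel_measurable (canonical_borel m) = borel_measurable P"
  using sets_P by (intro measurable_cong_sets) auto

lemmas P_measurable = measurable_T[of _ m, unfolded measurable_P]
  measurable_B[of _ m, unfolded measurable_P] measurable_B_T[of _ m, unfolded measurable_P]
  measurable_B_min_T[of _ m, unfolded measurable_P]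

lemma fst_measurable: "fst \<in> P \<rightarrow>\<^sub>M (\<Pi>\<^sub>M t\<in>{0..}. borel)"
  using measurable_fst_canonical sets_P by (simp cong: measurable_cong_sets)

lemma bm: "brownian_motion P (canonical_filtration m) B"
  using embedding by (simp add: embeddings_def)

lemma increment_distributed:
  "0 \<le> s \<Longrightarrow> s < t \<Longrightarrow> distributed P lborel (\<lambda>x. B t x - B s x) (normal_density 0 (sqrt (t - s)))"
  using bm unfolding brownian_motion_def by blast

text \<open>Measurability is part of \<open>indep_set\<close>, which \<open>brownian_motion\<close>
  asserts for the increment from \<open>s\<close> to s + 1.\<close>

lemma filtration_subset: "0 \<le> s \<Longrightarrow> sets (canonical_filtration m s) \<subseteq> events"
  using bm unfolding brownian_motion_def indep_sets2_eq
  by (meson less_add_one)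

lemma filtration_measurable:
  "0 \<le> s \<Longrightarrow> f \<in> canonical_filtration m s \<rightarrow>\<^sub>M N \<Longrightarrow> f \<in> P \<rightarrow>\<^sub>M N"
  using filtration_subset[of s] by (auto simp: measurable_def space_P)

lemma increment_measurable:
  "0 \<le> s \<Longrightarrow> s \<le> t \<Longrightarrow> (\<lambda>x. B t x - B s x) \<in> borel_measurable P"
  by (intro borel_measurable_diff P_measurable) auto

lemma increment_indep_set:
  assumes "0 \<le> s" "s < t" "a \<in> sets (canonical_filtration m s)" "b \<in> sets borel"
  shows "prob (a \<inter> ((\<lambda>x. B t x - B s x) -` b \<inter> space P))
     = prob a * prob ((\<lambda>x. B t x - B s x) -` b \<inter> space P)"
proof -
  have "indep_set (sets (canonical_filtration m s))
          (sets (vimage_algebra (space P) (\<lambda>x. B t x - B s x) borel))"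
    using bm assms unfolding brownian_motion_def by blast
  then show ?thesis
    by (rule indep_setD) (use assms in \<open>auto simp: sets_vimage_algebra\<close>)
qed

lemma increment_indep:
  assumes st: "0 \<le> s" "s < t" and X: "X \<in> borel_measurable (canonical_filtration m s)"
  shows "indep_var borel X borel (\<lambda>x. B t x - B s x)"
proof -
  have D: "(\<lambda>x. B t x - B s x) \<in> borel_measurable P"
    using st by (intro increment_measurable) auto
  have ind: "indep_set (sets (canonical_filtration m s))
          (sets (vimage_algebra (space P) (\<lambda>x. B t x - B s x) borel))"
    using bm st unfolding brownian_motion_def by blast
  have "sigma_sets (space P) {X -` A \<inter> space P |A. A \<in> sets borel} \<subseteq> sets (canonical_filtration m s)"
    using sets.sigma_sets_subset[of "{X -` A \<inter> space P |A. A \<in> sets borel}" "canonical_filtration m s"]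
      measurable_sets[OF X] by (auto simp: space_P)
  then have "indep_set (sigma_sets (space P) {X -` A \<inter> space P |A. A \<in> sets borel})
      (sigma_sets (space P) {(\<lambda>x. B t x - B s x) -` A \<inter> space P |A. A \<in> sets borel})"
    using ind unfolding indep_sets2_eq sets_vimage_algebra by blast
  then show ?thesis
    using filtration_measurable[OF st(1) X] D by (simp add: indep_var_eq)
qed

end

lemma embeddingI: "P \<in> embeddings m \<Longrightarrow> embedding m P"
  by (auto simp: embedding_def embedding_axioms_def embeddings_def)

text \<open>Induction on the largest time \<open>b\<close>: the increment after the preceding time
  \<open>s\<close> is Gaussian and independent of the past, so integrating it out turns the factor
  at \<open>b\<close> into a factor \<open>g\<close> at \<open>s\<close>. Since a factor changes,
  \<open>f\<close> is arbitrary in the induction. Time 0 is always included so that a preceding time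
  exists; there the path vanishes.\<close>

lemma finite_dimensional_law_unique:
  assumes P: "P \<in> embeddings m" and Q: "Q \<in> embeddings m" and J: "finite J" "J \<subseteq> {0..}"
    and f: "\<And>t. f t \<in> borel_measurable borel"
  shows "(\<integral>\<^sup>+x. (\<Prod>t\<in>insert 0 J. f t (B t x)) \<partial>P) = (\<integral>\<^sup>+x. (\<Prod>t\<in>insert 0 J. f t (B t x)) \<partial>Q)"
  using J f
proof (induction J arbitrary: f rule: finite_linorder_max_induct)
  case empty
  have "(\<integral>\<^sup>+x. f 0 (B 0 x) \<partial>P) = f 0 0" if "P \<in> embeddings m" for P
  proof -
    interpret embedding m P using that by (rule embeddingI)
    have "(\<integral>\<^sup>+x. f 0 (B 0 x) \<partial>P) = (\<integral>\<^sup>+x. f 0 0 \<partial>P)"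
      by (rule nn_integral_cong) (simp add: space_P canonical_spaceD)
    then show ?thesis by (simp add: emeasure_space_1)
  qed
  then show ?case using P Q by simp
next
  case (insert b A)
  note [measurable] = insert.prems(2)
  show ?case
  proof (cases "b = 0")
    case True
    then show ?thesis using insert.IH[of f] insert.prems by simp
  next
    case False
    then have b: "b > 0" using insert.prems by auto
    define s where "s = Max (insert 0 A)"
    have s: "0 \<le> s" "s < b" "s \<in> insert 0 A" "\<And>a. a \<in> insert 0 A \<Longrightarrow> a \<le> s"
      using insert.hyps b Max_in[of "insert 0 A"] by (auto simp: s_def)
    define g where "g y = (\<integral>\<^sup>+z. f b (y + z) \<partial>density lborel (normal_density 0 (sqrt (b - s))))" for y
    interpret N: prob_space "density lborel (normal_density 0 (sqrt (b - s)))"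
      using s by (intro prob_space_normal_density) auto
    have [measurable]: "g \<in> borel_measurable borel"
      unfolding g_def by (rule N.borel_measurable_nn_integral) measurable
    define f' where "f' = f(s := \<lambda>y. f s y * g y)"
    have [measurable]: "f' t \<in> borel_measurable borel" for t
      by (simp add: f'_def)
    have bA: "b \<notin> insert 0 A" using s by fastforce
    have step: "(\<integral>\<^sup>+x. (\<Prod>t\<in>insert 0 (insert b A). f t (B t x)) \<partial>P)
        = (\<integral>\<^sup>+x. (\<Prod>t\<in>insert 0 A. f' t (B t x)) \<partial>P)" if "P \<in> embeddings m" for P
    proof -
      interpret embedding m P using that by (rule embeddingI)
      define X where "X x = ((\<Prod>t\<in>insert 0 A. f t (B t x)), B s x)" for x
      have "B t \<in> borel_measurable (canonical_filtration m s)" if "t \<in> insert 0 A" for t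
        using that s insert.prems by (intro B_adapted) auto
      then have X: "X \<in> canonical_filtration m s \<rightarrow>\<^sub>M borel \<Otimes>\<^sub>M borel"
        unfolding X_def using s(3)
        by (intro measurable_Pair borel_measurable_prod_ennreal measurable_compose[OF _ insert.prems(2)]) auto
      have I: "(\<integral>\<^sup>+x. h (X x, B b x - B s x) \<partial>P)
          = (\<integral>\<^sup>+x. \<integral>\<^sup>+y. h (X x, y) \<partial>distr P borel (\<lambda>x. B b x - B s x) \<partial>P)"
        if "h \<in> borel_measurable ((borel \<Otimes>\<^sub>M borel) \<Otimes>\<^sub>M borel)" for h
      proof (rule nn_integral_indep[OF filtration_measurable[OF s(1) X] _ that])
        show "(\<lambda>x. B b x - B s x) \<in> borel_measurable P"
          using s by (intro increment_measurable) auto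
        show "prob ((X -` a \<inter> space P) \<inter> ((\<lambda>x. B b x - B s x) -` c \<inter> space P))
          = prob (X -` a \<inter> space P) * prob ((\<lambda>x. B b x - B s x) -` c \<inter> space P)"
          if "a \<in> sets (borel \<Otimes>\<^sub>M borel)" "c \<in> sets borel" for a c
          using s that measurable_sets[OF X that(1)] by (intro increment_indep_set) (auto simp: space_P)
      qed
      have "distr P borel (\<lambda>x. B b x - B s x) = distr P lborel (\<lambda>x. B b x - B s x)"
        by (rule distr_cong) auto
      then have D: "distr P borel (\<lambda>x. B b x - B s x) = density lborel (normal_density 0 (sqrt (b - s)))"
        using distributed_distr_eq_density[OF increment_distributed[OF s(1,2)]] by simp
      have "(\<integral>\<^sup>+x. (\<Prod>t\<in>insert 0 (insert b A). f t (B t x)) \<partial>P)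
         = (\<integral>\<^sup>+x. f b (snd (X x) + (B b x - B s x)) * fst (X x) \<partial>P)"
        using bA insert.hyps(1) by (simp add: X_def insert_commute[of 0 b])
      also have "\<dots> = (\<integral>\<^sup>+x. \<integral>\<^sup>+z. f b (snd (X x) + z) * fst (X x)
            \<partial>distr P borel (\<lambda>x. B b x - B s x) \<partial>P)"
        using I[of "\<lambda>(p, z). f b (snd p + z) * fst p"] by simp
      also have "\<dots> = (\<integral>\<^sup>+x. (\<Prod>t\<in>insert 0 A. f t (B t x)) * g (B s x) \<partial>P)"
        unfolding D g_def X_def by (simp add: nn_integral_multc mult.commute)
      also have "\<dots> = (\<integral>\<^sup>+x. (\<Prod>t\<in>insert 0 A. f' t (B t x)) \<partial>P)"
      proof (rule nn_integral_cong)
        fix x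
        have "(\<Prod>t\<in>insert 0 A. f' t (B t x)) = f' s (B s x) * (\<Prod>t\<in>insert 0 A - {s}. f' t (B t x))"
          using s insert.hyps(1) by (intro prod.remove) auto
        also have "(\<Prod>t\<in>insert 0 A - {s}. f' t (B t x)) = (\<Prod>t\<in>insert 0 A - {s}. f t (B t x))"
          by (intro prod.cong) (auto simp: f'_def)
        also have "f' s (B s x) * \<dots> = (f s (B s x) * (\<Prod>t\<in>insert 0 A - {s}. f t (B t x))) * g (B s x)"
          by (simp add: f'_def ac_simps)
        also have "f s (B s x) * (\<Prod>t\<in>insert 0 A - {s}. f t (B t x)) = (\<Prod>t\<in>insert 0 A. f t (B t x))"
          using s insert.hyps(1) by (intro prod.remove[symmetric]) auto
        finally show "(\<Prod>t\<in>insert 0 A. f t (B t x)) * g (B s x) = (\<Prod>t\<in>insert 0 A. f' t (B t x))" ..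
      qed
      finally show ?thesis .
    qed
    have "(\<integral>\<^sup>+x. (\<Prod>t\<in>insert 0 A. f' t (B t x)) \<partial>P) = (\<integral>\<^sup>+x. (\<Prod>t\<in>insert 0 A. f' t (B t x)) \<partial>Q)"
      using insert.prems by (intro insert.IH) auto
    then show ?thesis unfolding step[OF P] step[OF Q] .
  qed
qed

lemma path_law_unique:
  assumes P: "P \<in> embeddings m" and Q: "Q \<in> embeddings m"
  shows "distr P (\<Pi>\<^sub>M t\<in>{0..}. borel) fst = distr Q (\<Pi>\<^sub>M t\<in>{0..}. borel) fst"
proof (rule measure_eqI_PiM_infinite)
  fix A :: "real \<Rightarrow> real set" and J :: "real set"
  assume J: "finite J" "J \<subseteq> {0..}" and A: "\<And>t. t \<in> J \<Longrightarrow> A t \<in> sets borel"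
  \<comment> \<open>The factor 1 outside \<open>J\<close> makes the additional time 0
    harmless.\<close>
  define f :: "real \<Rightarrow> real \<Rightarrow> ennreal" where "f t y = (if t \<in> J then indicator (A t) y else 1)" for t y
  have f: "f t \<in> borel_measurable borel" for t
    using A by (cases "t \<in> J") (auto simp: f_def[abs_def])
  have *: "emeasure (distr P (\<Pi>\<^sub>M t\<in>{0..}. borel) fst) (prod_emb {0..} (\<lambda>_. borel) J (Pi\<^sub>E J A))
      = (\<integral>\<^sup>+x. (\<Prod>t\<in>insert 0 J. f t (B t x)) \<partial>P)" if "P \<in> embeddings m" for P
  proof -
    interpret embedding m P using that by (rule embeddingI)
    have "emeasure (distr P (\<Pi>\<^sub>M t\<in>{0..}. borel) fst) (prod_emb {0..} (\<lambda>_. borel) J (Pi\<^sub>E J A))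
      = emeasure P (fst -` prod_emb {0..} (\<lambda>_. borel) J (Pi\<^sub>E J A) \<inter> space P)"
      using J A by (intro emeasure_distr fst_measurable sets_PiM_I) auto
    also have "\<dots> = (\<integral>\<^sup>+x. indicator (fst -` prod_emb {0..} (\<lambda>_. borel) J (Pi\<^sub>E J A) \<inter> space P) x \<partial>P)"
      using J A by (intro nn_integral_indicator[symmetric] measurable_sets[OF fst_measurable] sets_PiM_I) auto
    also have "\<dots> = (\<integral>\<^sup>+x. (\<Prod>t\<in>insert 0 J. f t (B t x)) \<partial>P)"
    proof (rule nn_integral_cong)
      fix x assume x: "x \<in> space P"
      have "(\<Prod>t\<in>insert 0 J. f t (B t x)) = (\<Prod>t\<in>J. f t (B t x))"
        using J(1) by (cases "0 \<in> J") (auto simp: insert_absorb f_def)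
      also have "\<dots> = (\<Prod>t\<in>J. indicator (A t) (B t x))" by (intro prod.cong) (auto simp: f_def)
      also have "\<dots> = indicator (fst -` prod_emb {0..} (\<lambda>_. borel) J (Pi\<^sub>E J A) \<inter> space P) x"
      proof (cases "\<forall>t\<in>J. B t x \<in> A t")
        case True
        then show ?thesis using x canonical_spaceD(3)[of x m]
          by (auto simp: space_P prod_emb_def PiE_def B_def space_PiM indicator_def)
      next
        case False
        then have "x \<notin> fst -` prod_emb {0..} (\<lambda>_. borel) J (Pi\<^sub>E J A)"
          by (auto simp: prod_emb_def B_def PiE_iff)
        moreover have "(\<Prod>t\<in>J. indicator (A t) (B t x)) = (0::ennreal)"
          using False J(1) by (intro prod_zero) (auto simp: indicator_def)
        ultimately show ?thesis by simp
      qed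
      finally show "indicator (fst -` prod_emb {0..} (\<lambda>_. borel) J (Pi\<^sub>E J A) \<inter> space P) x
         = (\<Prod>t\<in>insert 0 J. f t (B t x))" ..
    qed
    finally show ?thesis .
  qed
  show "emeasure (distr P (\<Pi>\<^sub>M t\<in>{0..}. borel) fst) (prod_emb {0..} (\<lambda>_. borel) J (Pi\<^sub>E J A))
    = emeasure (distr Q (\<Pi>\<^sub>M t\<in>{0..}. borel) fst) (prod_emb {0..} (\<lambda>_. borel) J (Pi\<^sub>E J A))"
    unfolding *[OF P] *[OF Q] using finite_dimensional_law_unique[OF P Q J f] .
next
  interpret embedding m P using P by (rule embeddingI)
  show "finite_measure (distr P (\<Pi>\<^sub>M t\<in>{0..}. borel) fst)"
    using prob_space_distr[OF fst_measurable] by (rule prob_space.finite_measure)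
qed auto

section \<open>Optional stopping\<close>

lemma (in prob_space) uniformly_integrable_imp_integrable:
  assumes UI: "uniformly_integrable M I f" and i: "i \<in> I"
  shows "integrable M (f i)"
proof -
  have [measurable]: "f i \<in> borel_measurable M" using assms by (simp add: uniformly_integrable_def)
  obtain c where c: "(\<integral>\<^sup>+x. ennreal \<bar>f i x\<bar> * indicator {x. c \<le> \<bar>f i x\<bar>} x \<partial>M) \<le> ennreal 1"
    using UI i unfolding uniformly_integrable_def by (metis zero_less_one)
  have "(\<integral>\<^sup>+x. ennreal \<bar>f i x\<bar> \<partial>M)
     \<le> (\<integral>\<^sup>+x. ennreal \<bar>c\<bar> + ennreal \<bar>f i x\<bar> * indicator {x. c \<le> \<bar>f i x\<bar>} x \<partial>M)"
    by (rule nn_integral_mono) (auto simp: indicator_def not_le intro!: ennreal_leI)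
  also have "\<dots> = ennreal \<bar>c\<bar> + (\<integral>\<^sup>+x. ennreal \<bar>f i x\<bar> * indicator {x. c \<le> \<bar>f i x\<bar>} x \<partial>M)"
    by (subst nn_integral_add) (auto simp: emeasure_space_1)
  also have "\<dots> \<le> ennreal \<bar>c\<bar> + ennreal 1" using c by (intro add_left_mono)
  also have "\<dots> < \<infinity>" by simp
  finally show ?thesis by (intro integrableI_bounded) auto
qed

text \<open>Vitali's convergence theorem for pointwise limits. The excess over the level
  \<open>c\<close> is continuous in the value, so Fatou's lemma carries the tail bound to
  \<open>g\<close>; the truncated parts converge by dominated convergence.\<close>

lemma (in prob_space) uniformly_integrable_LIMSEQ:
  fixes f :: "nat \<Rightarrow> 'a \<Rightarrow> real"
  assumes UI: "uniformly_integrable M UNIV f"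
    and lim: "\<And>x. x \<in> space M \<Longrightarrow> (\<lambda>n. f n x) \<longlonglongrightarrow> g x"
  shows "integrable M g" and "(\<lambda>n. \<integral>x. \<bar>f n x - g x\<bar> \<partial>M) \<longlonglongrightarrow> 0"
proof -
  have fi: "integrable M (f n)" for n by (rule uniformly_integrable_imp_integrable[OF UI]) simp
  then have [measurable]: "f n \<in> borel_measurable M" for n by auto
  have [measurable]: "g \<in> borel_measurable M"
    using lim by (intro borel_measurable_LIMSEQ_real[of _ f g]) auto
  have tail: "\<exists>c>0. (\<forall>n. (\<integral>\<^sup>+x. ennreal (max 0 (\<bar>f n x\<bar> - c)) \<partial>M) \<le> ennreal e)
      \<and> (\<integral>\<^sup>+x. ennreal (max 0 (\<bar>g x\<bar> - c)) \<partial>M) \<le> ennreal e" if e: "e > 0" for e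
  proof -
    obtain c where c: "\<And>n. (\<integral>\<^sup>+x. ennreal \<bar>f n x\<bar> * indicator {x. c \<le> \<bar>f n x\<bar>} x \<partial>M) \<le> ennreal e"
      using UI e unfolding uniformly_integrable_def by (metis UNIV_I)
    have 1: "(\<integral>\<^sup>+x. ennreal (max 0 (\<bar>f n x\<bar> - max 1 c)) \<partial>M) \<le> ennreal e" for n
    proof -
      have "(\<integral>\<^sup>+x. ennreal (max 0 (\<bar>f n x\<bar> - max 1 c)) \<partial>M)
        \<le> (\<integral>\<^sup>+x. ennreal \<bar>f n x\<bar> * indicator {x. c \<le> \<bar>f n x\<bar>} x \<partial>M)"
        by (rule nn_integral_mono) (auto simp: indicator_def max_def intro!: ennreal_leI)
      then show ?thesis using c[of n] by simp
    qed
    have "(\<integral>\<^sup>+x. ennreal (max 0 (\<bar>g x\<bar> - max 1 c)) \<partial>M)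
      = (\<integral>\<^sup>+x. liminf (\<lambda>n. ennreal (max 0 (\<bar>f n x\<bar> - max 1 c))) \<partial>M)"
    proof (rule nn_integral_cong)
      fix x assume "x \<in> space M"
      then have "(\<lambda>n. ennreal (max 0 (\<bar>f n x\<bar> - max 1 c))) \<longlonglongrightarrow> ennreal (max 0 (\<bar>g x\<bar> - max 1 c))"
        by (intro tendsto_ennrealI tendsto_intros lim)
      then show "ennreal (max 0 (\<bar>g x\<bar> - max 1 c)) = liminf (\<lambda>n. ennreal (max 0 (\<bar>f n x\<bar> - max 1 c)))"
        by (simp add: lim_imp_Liminf)
    qed
    also have "\<dots> \<le> liminf (\<lambda>n. \<integral>\<^sup>+x. ennreal (max 0 (\<bar>f n x\<bar> - max 1 c)) \<partial>M)"
      by (rule nn_integral_liminf) auto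
    also have "\<dots> \<le> ennreal e"
      using 1 by (intro Liminf_le) auto
    finally show ?thesis using 1 by (intro exI[of _ "max 1 c"]) auto
  qed
  have tail': "integrable M (\<lambda>x. max 0 (\<bar>h x\<bar> - c)) \<and> (\<integral>x. max 0 (\<bar>h x\<bar> - c) \<partial>M) \<le> e"
    if "(\<integral>\<^sup>+x. ennreal (max 0 (\<bar>h x\<bar> - c)) \<partial>M) \<le> ennreal e" "h \<in> borel_measurable M" "e > 0" for h c e
  proof
    have [measurable]: "h \<in> borel_measurable M" by fact
    show i: "integrable M (\<lambda>x. max 0 (\<bar>h x\<bar> - c))"
      using that le_less_trans[OF that(1)] by (intro integrableI_nonneg) auto
    show "(\<integral>x. max 0 (\<bar>h x\<bar> - c) \<partial>M) \<le> e"
      using that nn_integral_eq_integral[OF i] by simp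
  qed
  show gi: "integrable M g"
  proof -
    obtain c where c: "c > 0" "(\<integral>\<^sup>+x. ennreal (max 0 (\<bar>g x\<bar> - c)) \<partial>M) \<le> ennreal 1"
      using tail[of 1] by auto
    have "integrable M (\<lambda>x. c + max 0 (\<bar>g x\<bar> - c))"
      using tail'[OF c(2)] by auto
    then show ?thesis by (rule Bochner_Integration.integrable_bound) auto
  qed
  show "(\<lambda>n. \<integral>x. \<bar>f n x - g x\<bar> \<partial>M) \<longlonglongrightarrow> 0"
  proof (rule LIMSEQ_I)
    fix r :: real assume "r > 0"
    then obtain c where c: "c > 0" "\<And>n. (\<integral>\<^sup>+x. ennreal (max 0 (\<bar>f n x\<bar> - c)) \<partial>M) \<le> ennreal (r / 4)"
      "(\<integral>\<^sup>+x. ennreal (max 0 (\<bar>g x\<bar> - c)) \<partial>M) \<le> ennreal (r / 4)"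
      using tail[of "r / 4"] by auto
    \<comment> \<open>Clamping to [-c, c] moves \<open>y\<close> by exactly its excess over the
      level \<open>c\<close>. Two excess terms of at most r/4 and a truncated term below r/4 stay
      below \<open>r\<close>.\<close>
    define k where "k y = max (- c) (min c y)" for y :: real
    have [measurable]: "k \<in> borel_measurable borel" unfolding k_def by measurable
    have kb: "\<bar>k y - k z\<bar> \<le> 2 * c" for y z using c(1) by (auto simp: k_def)
    have ki: "integrable M (\<lambda>x. \<bar>k (f n x) - k (g x)\<bar>)" for n
      using kb by (intro integrable_const_bound[where B = "2 * c"]) auto
    have "(\<lambda>n. \<integral>x. \<bar>k (f n x) - k (g x)\<bar> \<partial>M) \<longlonglongrightarrow> (\<integral>x. 0 \<partial>M)"
    proof (rule integral_dominated_convergence[where w = "\<lambda>_. 2 * c"])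
      show "AE x in M. (\<lambda>n. \<bar>k (f n x) - k (g x)\<bar>) \<longlonglongrightarrow> 0"
      proof (rule AE_I2)
        fix x assume "x \<in> space M"
        then have "(\<lambda>n. \<bar>k (f n x) - k (g x)\<bar>) \<longlonglongrightarrow> \<bar>k (g x) - k (g x)\<bar>"
          unfolding k_def by (intro tendsto_intros lim)
        then show "(\<lambda>n. \<bar>k (f n x) - k (g x)\<bar>) \<longlonglongrightarrow> 0" by simp
      qed
    qed (use kb in auto)
    then obtain N where N: "\<And>n. n \<ge> N \<Longrightarrow> (\<integral>x. \<bar>k (f n x) - k (g x)\<bar> \<partial>M) < r / 4"
      using order_tendstoD(2)[of _ 0 sequentially "r / 4"] \<open>r > 0\<close> by (auto simp: eventually_sequentially)
    have "norm ((\<integral>x. \<bar>f n x - g x\<bar> \<partial>M) - 0) < r" if "n \<ge> N" for n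
    proof -
      have r4: "0 < r / 4" using \<open>r > 0\<close> by simp
      note tf = tail'[OF c(2)[of n] _ r4] and tg = tail'[OF c(3) _ r4]
      have "(\<integral>x. \<bar>f n x - g x\<bar> \<partial>M)
        \<le> (\<integral>x. \<bar>k (f n x) - k (g x)\<bar> + (max 0 (\<bar>f n x\<bar> - c) + max 0 (\<bar>g x\<bar> - c)) \<partial>M)"
      proof (rule integral_mono)
        show "\<bar>f n x - g x\<bar> \<le> \<bar>k (f n x) - k (g x)\<bar> + (max 0 (\<bar>f n x\<bar> - c) + max 0 (\<bar>g x\<bar> - c))" for x
          using c(1) by (auto simp: k_def max_def min_def abs_if)
      qed (use fi gi ki tf tg in auto)
      also have "\<dots> = (\<integral>x. \<bar>k (f n x) - k (g x)\<bar> \<partial>M)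
          + ((\<integral>x. max 0 (\<bar>f n x\<bar> - c) \<partial>M) + (\<integral>x. max 0 (\<bar>g x\<bar> - c) \<partial>M))"
        using ki tf tg by simp
      also have "\<dots> < r"
        using N[OF that] tf tg \<open>r > 0\<close> by simp
      finally show ?thesis by simp
    qed
    then show "\<exists>N. \<forall>n\<ge>N. norm ((\<integral>x. \<bar>f n x - g x\<bar> \<partial>M) - 0) < r" by blast
  qed
qed

text \<open>Where |f n| is at least \<open>c\<close>, it is at most its square divided by
  \<open>c\<close>; the tail is therefore at most C/c, uniformly in \<open>n\<close>.\<close>

lemma (in prob_space) square_bounded_uniformly_integrable:
  fixes f :: "nat \<Rightarrow> 'a \<Rightarrow> real"
  assumes f: "\<And>n. f n \<in> borel_measurable M" "\<And>n. integrable M (\<lambda>x. (f n x)\<^sup>2)"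
    and C: "\<And>n. (\<integral>x. (f n x)\<^sup>2 \<partial>M) \<le> C"
  shows "uniformly_integrable M UNIV f"
  unfolding uniformly_integrable_def
proof (intro conjI allI impI ballI)
  fix e :: real assume e: "e > 0"
  have "0 \<le> (\<integral>x. (f 0 x)\<^sup>2 \<partial>M)" by simp
  then have "0 \<le> C" using C[of 0] by linarith
  define c where "c = max 1 (C / e)"
  have c: "c > 0" "C / c \<le> e" using e \<open>0 \<le> C\<close> by (auto simp: c_def max_def field_simps)
  have "(\<integral>\<^sup>+x. ennreal \<bar>f n x\<bar> * indicator {x. c \<le> \<bar>f n x\<bar>} x \<partial>M) \<le> ennreal e" for n
  proof -
    have "(\<integral>\<^sup>+x. ennreal \<bar>f n x\<bar> * indicator {x. c \<le> \<bar>f n x\<bar>} x \<partial>M) \<le> (\<integral>\<^sup>+x. ennreal ((f n x)\<^sup>2 / c) \<partial>M)"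
    proof (rule nn_integral_mono)
      fix x
      have "\<bar>f n x\<bar> \<le> (f n x)\<^sup>2 / c" if "c \<le> \<bar>f n x\<bar>"
        using mult_right_mono[OF that, of "\<bar>f n x\<bar>"] c(1)
        by (simp add: field_simps power2_eq_square abs_mult_self_eq)
      then show "ennreal \<bar>f n x\<bar> * indicator {x. c \<le> \<bar>f n x\<bar>} x \<le> ennreal ((f n x)\<^sup>2 / c)"
        by (auto simp: indicator_def intro!: ennreal_leI)
    qed
    also have "\<dots> = ennreal (\<integral>x. (f n x)\<^sup>2 / c \<partial>M)"
      using f c(1) by (intro nn_integral_eq_integral) auto
    also have "\<dots> \<le> ennreal e"
      using C[of n] c by (intro ennreal_leI) (simp add: divide_right_mono order_trans[OF divide_right_mono])
    finally show ?thesis .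
  qed
  then show "\<exists>c. \<forall>n\<in>UNIV. (\<integral>\<^sup>+x. ennreal \<bar>f n x\<bar> * indicator {x. c \<le> \<bar>f n x\<bar>} x \<partial>M) \<le> ennreal e"
    by blast
qed (rule f)


text \<open>Turns the discrete integral of the indicator of not yet having stopped into the value at
  the stopped grid point.\<close>

lemma sum_of_bool_telescope:
  "(\<Sum>l<N. of_bool (l < a) * (b (Suc l) - b l)) = (b (min N a) - b 0 :: real)"
proof (induction N)
  case (Suc N)
  then show ?case by (cases "N < a") (auto simp: min_def)
qed simp

section \<open>Stopping on a grid and its limit\<close>

context embedding
begin

lemma increment_moments:
  assumes "0 \<le> s" "s < t"
  shows "integrable P (\<lambda>x. B t x - B s x)" "expectation (\<lambda>x. B t x - B s x) = 0"
    "integrable P (\<lambda>x. (B t x - B s x)\<^sup>2)" "expectation (\<lambda>x. (B t x - B s x)\<^sup>2) = t - s"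
proof -
  note D = increment_distributed[OF assms]
  have \<sigma>: "sqrt (t - s) > 0" using assms by simp
  show "integrable P (\<lambda>x. B t x - B s x)"
    by (rule distributed_integrable_var[OF D]) (auto intro: integrable_normal_moment_nz_1[OF \<sigma>])
  show 0: "expectation (\<lambda>x. B t x - B s x) = 0"
    by (rule normal_distributed_expectation[OF \<sigma> D])
  have "integrable lborel (\<lambda>y. normal_density 0 (sqrt (t - s)) y * y\<^sup>2)"
    using integrable_normal_moment[OF \<sigma>, of 0 2] by simp
  then show "integrable P (\<lambda>x. (B t x - B s x)\<^sup>2)"
    using distributed_integrable[OF D, of "\<lambda>y. y\<^sup>2"] by simp
  show "expectation (\<lambda>x. (B t x - B s x)\<^sup>2) = t - s"
    using normal_distributed_variance[OF \<sigma> D] 0 assms by simp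
qed

text \<open>One summand of a discrete stochastic integral. The increment is centered and independent
  of everything known at \<open>s\<close>, so the mean is unchanged and the cross term in the square
  vanishes; since the integrand is an indicator, the remaining term adds at most t - s.\<close>

lemma stochastic_integral_step:
  assumes st: "0 \<le> s" "s < t" and A: "A \<in> sets (canonical_filtration m s)"
    and Z: "Z \<in> borel_measurable (canonical_filtration m s)" "integrable P (\<lambda>x. (Z x)\<^sup>2)"
    and Z': "Z' = (\<lambda>x. Z x + indicator A x * (B t x - B s x))"
  shows "Z' \<in> borel_measurable (canonical_filtration m t)" "integrable P (\<lambda>x. (Z' x)\<^sup>2)"
    "expectation Z' = expectation Z"
    "expectation (\<lambda>x. (Z' x)\<^sup>2) \<le> expectation (\<lambda>x. (Z x)\<^sup>2) + (t - s)"
proof -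
  let ?D = "\<lambda>x. B t x - B s x"
  have up: "f \<in> borel_measurable (canonical_filtration m t)"
    if "f \<in> borel_measurable (canonical_filtration m s)" for f :: "_ \<Rightarrow> real"
    using that filtration_mono[of s t m] st by (auto simp: measurable_def)
  have [measurable]: "A \<in> sets (canonical_filtration m t)" using A filtration_mono[of s t m] st by auto
  have [measurable]: "B t \<in> borel_measurable (canonical_filtration m t)" "B s \<in> borel_measurable (canonical_filtration m t)"
    using st by (auto intro: B_adapted)
  note [measurable] = up[OF Z(1)]
  show "Z' \<in> borel_measurable (canonical_filtration m t)" unfolding Z' by measurable
  have [measurable]: "A \<in> events" using A filtration_subset[OF st(1)] by blast
  have ZP [measurable]: "Z \<in> borel_measurable P" using Z(1) st by (intro filtration_measurable)
  note D = increment_moments[OF st]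
  have [measurable]: "?D \<in> borel_measurable P" using D(1) by auto
  have Zi: "integrable P Z" using ZP Z(2) by (rule square_integrable_imp_integrable)
  have iA: "indicator A \<in> borel_measurable (canonical_filtration m s)" using A by simp
  have iZA: "(\<lambda>x. Z x * indicator A x) \<in> borel_measurable (canonical_filtration m s)" using A Z(1) by simp
  have iZAi: "integrable P (\<lambda>x. Z x * indicator A x)"
    using Zi by (rule Bochner_Integration.integrable_bound) (auto simp: indicator_def)
  note AD = indep_var_lebesgue_integral[OF increment_indep[OF st iA] _ D(1)]
    indep_var_integrable[OF increment_indep[OF st iA] _ D(1)]
  note ZAD = indep_var_lebesgue_integral[OF increment_indep[OF st iZA] iZAi D(1)]
    indep_var_integrable[OF increment_indep[OF st iZA] iZAi D(1)]
  have iAi: "integrable P (indicator A :: _ \<Rightarrow> real)" by (auto simp: emeasure_eq_measure)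
  have sq: "(Z' x)\<^sup>2 = (Z x)\<^sup>2 + 2 * (Z x * indicator A x * ?D x) + indicator A x * (?D x)\<^sup>2" for x
    by (cases "x \<in> A") (auto simp: Z' power2_eq_square algebra_simps)
  have iAD2: "integrable P (\<lambda>x. indicator A x * (?D x)\<^sup>2)"
    using D(3) by (rule Bochner_Integration.integrable_bound) (auto simp: indicator_def)
  show "integrable P (\<lambda>x. (Z' x)\<^sup>2)"
    unfolding sq using Z(2) ZAD(2) iAD2 by simp
  show "expectation Z' = expectation Z"
    unfolding Z' using Zi AD(1)[OF iAi] AD(2)[OF iAi] D(2) by simp
  have "expectation (\<lambda>x. indicator A x * (?D x)\<^sup>2) \<le> expectation (\<lambda>x. (?D x)\<^sup>2)"
    using iAD2 D(3) by (intro integral_mono) (auto simp: indicator_def)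
  then show "expectation (\<lambda>x. (Z' x)\<^sup>2) \<le> expectation (\<lambda>x. (Z x)\<^sup>2) + (t - s)"
    unfolding sq using Z(2) ZAD iAD2 D(2,4) by simp
qed

text \<open>The stopping time is approximated from above by its values on a grid, where stopping amounts
  to a discrete stochastic integral; the second moments stay bounded.\<close>

lemma optional_stopping_aux:
  assumes i: "i \<in> {1..m}" and tu: "0 \<le> t" "t < u"
    and A: "A \<in> sets (canonical_filtration m t)" "A \<subseteq> {x. t < T i x}"
  shows "integrable P (\<lambda>x. indicator A x * (B (min (T i x) u) x - B t x))"
    "expectation (\<lambda>x. indicator A x * (B (min (T i x) u) x - B t x)) = 0"
proof -
  define g where "g N l = t + real l * ((u - t) / real (Suc N))" for N l
  have g0: "g N 0 = t" for N by (simp add: g_def)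
  have g_Suc: "g N (Suc l) - g N l = (u - t) / real (Suc N)" for N l
    unfolding g_def of_nat_Suc[of l] by (simp only: distrib_right)
  have g_less: "g N l < g N (Suc l)" for N l using tu g_Suc[of N l] by (smt (verit) divide_pos_pos of_nat_0_less_iff zero_less_Suc)
  have g_ge: "t \<le> g N l" for N l using tu by (simp add: g_def)
  have g_end: "g N (Suc N) = u" for N by (simp add: g_def)
  define Z where "Z N j x = (\<Sum>l<j. indicator (A \<inter> {x. g N l < T i x}) x * (B (g N (Suc l)) x - B (g N l) x))" for N j x
  have Z: "Z N j \<in> borel_measurable (canonical_filtration m (g N j)) \<and> integrable P (\<lambda>x. (Z N j x)\<^sup>2)
      \<and> expectation (Z N j) = 0 \<and> expectation (\<lambda>x. (Z N j x)\<^sup>2) \<le> real j * ((u - t) / real (Suc N))" for N j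
  proof (induction j)
    case 0
    show ?case by (simp add: Z_def)
  next
    case (Suc j)
    have "A \<subseteq> canonical_space m" using sets.sets_into_space[OF A(1)] by simp
    then have "A \<inter> {x. g N j < T i x} = A - {x \<in> canonical_space m. T i x \<le> g N j}" by auto
    moreover have "A \<in> sets (canonical_filtration m (g N j))" using A(1) filtration_mono g_ge by blast
    moreover have "{x \<in> canonical_space m. T i x \<le> g N j} \<in> sets (canonical_filtration m (g N j))"
      using i by (intro T_stopping) auto
    ultimately have A': "A \<inter> {x. g N j < T i x} \<in> sets (canonical_filtration m (g N j))" by simp
    have g_nonneg: "0 \<le> g N j" using g_ge[of N j] tu by simp
    have Z_Suc: "Z N (Suc j) = (\<lambda>x. Z N j x + indicator (A \<inter> {x. g N j < T i x}) x * (B (g N (Suc j)) x - B (g N j) x))"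
      by (rule ext) (simp only: Z_def sum.lessThan_Suc)
    note step = stochastic_integral_step[OF g_nonneg g_less A' _ _ Z_Suc]
    have "real (Suc j) * ((u - t) / real (Suc N)) = real j * ((u - t) / real (Suc N)) + (g N (Suc j) - g N j)"
      unfolding g_Suc of_nat_Suc[of j] by (simp only: distrib_right mult_1)
    then show ?case
      using step Suc.IH by (metis (no_types, lifting) add_right_mono order_trans)
  qed
  have ZP: "Z N j \<in> borel_measurable P" for N j
    using Z[of N j] g_ge[of N j] tu by (intro filtration_measurable[of "g N j"]) auto
  have UI: "uniformly_integrable P UNIV (\<lambda>N. Z N (Suc N))"
  \<comment> \<open>There are N + 1 grid steps, each contributing at most (u - t)/(N + 1), so the
    bound u - t does not depend on the mesh.\<close>
  proof (rule square_bounded_uniformly_integrable[where C = "u - t"])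
    show "expectation (\<lambda>x. (Z N (Suc N) x)\<^sup>2) \<le> u - t" for N
      using Z[of N "Suc N"] by simp
  qed (use Z ZP in auto)
  have lim: "(\<lambda>N. Z N (Suc N) x) \<longlonglongrightarrow> indicator A x * (B (min (T i x) u) x - B t x)" if x: "x \<in> space P" for x
  proof (cases "x \<in> A")
    case False
    then show ?thesis by (simp add: Z_def)
  next
    case True
    then have Tt: "t < T i x" using A by auto
    define h where "h N = (u - t) / real (Suc N)" for N
    have h: "h N > 0" for N using tu by (simp add: h_def)
    \<comment> \<open>The index of the first grid point that is not before \<open>T i x\<close>;
      here the grid is thought of as continuing beyond \<open>u\<close>.\<close>
    define a where "a N = nat \<lceil>(T i x - t) / h N\<rceil>" for N
    have lt: "g N l < T i x \<longleftrightarrow> l < a N" for N l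
    proof -
      have "g N l < T i x \<longleftrightarrow> real l < (T i x - t) / h N"
      proof -
        have "g N l = t + real l * h N" by (simp add: g_def h_def)
        then show ?thesis using h[of N] by (simp add: pos_less_divide_eq algebra_simps)
      qed
      also have "\<dots> \<longleftrightarrow> l < a N"
        unfolding a_def by (simp add: zless_nat_eq_int_zless less_ceiling_iff)
      finally show ?thesis .
    qed
    \<comment> \<open>That grid point, cut off at the end \<open>u\<close> of the grid. It differs
      from the truncated stopping time by at most one mesh width.\<close>
    define e where "e N = g N (min (Suc N) (a N))" for N
    have "Z N (Suc N) x = (\<Sum>l<Suc N. of_bool (l < a N) * (B (g N (Suc l)) x - B (g N l) x))" for N
      unfolding Z_def using True by (intro sum.cong) (auto simp: indicator_def lt)
    then have Ze: "Z N (Suc N) x = B (e N) x - B t x" for N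
      by (simp only: sum_of_bool_telescope[of "a N" "\<lambda>l. B (g N l) x"] g0 e_def)
    have near: "\<bar>e N - min (T i x) u\<bar> \<le> h N" for N
    proof (cases "a N \<le> Suc N")
      case True
      have "T i x \<le> g N (a N)" using lt[of N "a N"] by simp
      moreover have "g N (a N) \<le> T i x + h N"
      proof -
        have "0 < (T i x - t) / h N" using Tt h[of N] by simp
        then have "a N > 0" by (simp add: a_def)
        then have "g N (a N - 1) < T i x" "g N (a N) = g N (a N - 1) + h N"
          using lt[of N "a N - 1"] g_Suc[of N "a N - 1"] by (auto simp: h_def)
        then show ?thesis by simp
      qed
      moreover have "g N (a N) \<le> u"
      proof -
        have "real (a N) * h N \<le> real (Suc N) * h N" using True h[of N] by (intro mult_right_mono) auto
        then show ?thesis using g_end[of N] by (simp add: g_def h_def)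
      qed
      ultimately show ?thesis using True h[of N] by (auto simp: e_def min_def abs_if)
    next
      case False
      then have "u < T i x" using lt[of N "Suc N"] by (simp add: g_end)
      then show ?thesis using False h[of N] by (simp add: e_def g_end)
    qed
    have "h \<longlonglongrightarrow> 0" unfolding h_def
      by (rule filterlim_compose[OF lim_const_over_n filterlim_Suc])
    then have "(\<lambda>N. e N - min (T i x) u) \<longlonglongrightarrow> 0"
      by (rule Lim_null_comparison[rotated]) (use near in auto)
    then have "e \<longlonglongrightarrow> min (T i x) u" by (simp add: LIM_zero_iff)
    moreover have "e N \<in> {0..}" for N using g_ge[of N "min (Suc N) (a N)"] tu by (simp add: e_def)
    moreover have "min (T i x) u \<in> {0..}" using Tt tu by auto
    ultimately have "(\<lambda>N. B (e N) x) \<longlonglongrightarrow> B (min (T i x) u) x"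
      using canonical_spaceD(1)[of x m] x
      by (intro continuous_on_tendsto_compose[of "{0..}" "\<lambda>t. B t x"]) (auto simp: space_P)
    then show ?thesis unfolding Ze using True by (auto intro!: tendsto_intros)
  qed
  note conv = uniformly_integrable_LIMSEQ[OF UI lim]
  show int: "integrable P (\<lambda>x. indicator A x * (B (min (T i x) u) x - B t x))"
    by (rule conv(1))
  let ?g = "\<lambda>x. indicator A x * (B (min (T i x) u) x - B t x)"
  \<comment> \<open>The grid sums have mean zero, so the mean of their limit is at most their
    distance to it in mean, which tends to 0.\<close>
  have "\<bar>expectation ?g\<bar> \<le> (\<integral>x. \<bar>Z N (Suc N) x - ?g x\<bar> \<partial>P)" for N
  proof -
    have Zi: "integrable P (Z N (Suc N))" using ZP Z by (blast intro: square_integrable_imp_integrable)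
    have "\<bar>expectation ?g\<bar> = \<bar>expectation (\<lambda>x. Z N (Suc N) x - ?g x)\<bar>"
      using Z[of N "Suc N"] Zi int by simp
    also have "\<dots> \<le> (\<integral>x. \<bar>Z N (Suc N) x - ?g x\<bar> \<partial>P)" by (rule integral_abs_bound)
    finally show ?thesis .
  qed
  then have "\<bar>expectation ?g\<bar> \<le> 0"
    by (intro LIMSEQ_le_const[OF conv(2)]) auto
  then show "expectation ?g = 0" by simp
qed

end

section \<open>Comparison of stopped and terminal values\<close>

context embedding
begin

text \<open>Where the time has passed by \<open>t\<close>, both stopped values agree. Only the part
  of \<open>A\<close> with T i x > t contributes, and it still belongs to the filtration at
  \<open>t\<close>.\<close>

lemma optional_stopping:
  assumes i: "i \<in> {1..m}" and tu: "0 \<le> t" "t \<le> u" and A: "A \<in> sets (canonical_filtration m t)"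
  shows "expectation (\<lambda>x. indicator A x * (B (min (T i x) u) x - B (min (T i x) t) x)) = 0"
proof (cases "t = u")
  case False
  let ?A = "A - {x \<in> canonical_space m. T i x \<le> t}"
  have A': "?A \<in> sets (canonical_filtration m t)" "?A \<subseteq> {x. t < T i x}"
    using A i sets.sets_into_space[OF A] by (auto intro!: sets.Diff T_stopping)
  have "expectation (\<lambda>x. indicator A x * (B (min (T i x) u) x - B (min (T i x) t) x))
    = expectation (\<lambda>x. indicator ?A x * (B (min (T i x) u) x - B t x))"
    using tu by (intro Bochner_Integration.integral_cong) (auto simp: space_P indicator_def min_def)
  then show ?thesis using optional_stopping_aux(2)[OF i tu(1) _ A'] tu False by simp
qed simp

lemma stopped_integrable: "0 \<le> t \<Longrightarrow> integrable P (\<lambda>x. B (min (T m x) t) x)"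
  using embedding uniformly_integrable_imp_integrable[of "{0..}" "\<lambda>t x. B (min (T m x) t) x" t]
  by (auto simp: embeddings_def)

text \<open>At each point the stopped path is eventually constant in time, so uniform integrability
  lets the horizon \<open>u\<close> in \<open>optional_stopping\<close> tend to infinity along the
  integers.\<close>

lemma
  assumes m: "m \<ge> 1"
  shows terminal_integrable: "integrable P (\<lambda>x. B (T m x) x)"
    and terminal_optional_stopping: "0 \<le> t \<Longrightarrow> A \<in> sets (canonical_filtration m t) \<Longrightarrow>
      expectation (\<lambda>x. indicator A x * (B (T m x) x - B (min (T m x) t) x)) = 0"
proof -
  have "uniformly_integrable P {0..} (\<lambda>t x. B (min (T m x) t) x)"
    using embedding by (simp add: embeddings_def)
  then have UI: "uniformly_integrable P UNIV (\<lambda>n x. B (min (T m x) (real n)) x)"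
    unfolding uniformly_integrable_def by (meson atLeast_iff of_nat_0_le_iff)
  have lim: "(\<lambda>n. B (min (T m x) (real n)) x) \<longlonglongrightarrow> B (T m x) x" for x
  proof (rule tendsto_eventually)
    obtain N where "T m x \<le> real N" using real_arch_simple by blast
    then have "min (T m x) (real n) = T m x" if "n \<ge> N" for n
      using that by (simp add: min_def)
    then show "\<forall>\<^sub>F n in sequentially. B (min (T m x) (real n)) x = B (T m x) x"
      by (auto simp: eventually_sequentially intro!: exI[of _ N])
  qed
  note conv = uniformly_integrable_LIMSEQ[OF UI lim]
  show int: "integrable P (\<lambda>x. B (T m x) x)" by (rule conv(1))
  assume t: "0 \<le> t" and A: "A \<in> sets (canonical_filtration m t)"
  have [measurable]: "A \<in> events" using A filtration_subset[OF t] by blast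
  let ?S = "\<lambda>u x. B (min (T m x) u) x"
  have mult: "integrable P (\<lambda>x. indicator A x * (f x :: real))" if "integrable P f" for f
    using integrable_real_mult_indicator[of A P f] that \<open>A \<in> events\<close> by (simp add: mult.commute)
  have "\<bar>expectation (\<lambda>x. indicator A x * (B (T m x) x - ?S t x))\<bar> \<le> expectation (\<lambda>x. \<bar>?S (real n) x - B (T m x) x\<bar>)"
    if n: "t \<le> real n" for n
  proof -
    have i1: "integrable P (\<lambda>x. indicator A x * (B (T m x) x - ?S t x))"
      and i2: "integrable P (\<lambda>x. indicator A x * (?S (real n) x - ?S t x))"
      and i3: "integrable P (\<lambda>x. indicator A x * (B (T m x) x - ?S (real n) x))"
      using int stopped_integrable t by (auto intro!: mult)
    have "expectation (\<lambda>x. indicator A x * (B (T m x) x - ?S t x))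
      = expectation (\<lambda>x. indicator A x * (B (T m x) x - ?S t x))
        - expectation (\<lambda>x. indicator A x * (?S (real n) x - ?S t x))"
      using optional_stopping[OF _ t n A, of m] m by simp
    also have "\<dots> = expectation (\<lambda>x. indicator A x * (B (T m x) x - ?S (real n) x))"
      using i1 i2 by (subst Bochner_Integration.integral_diff[symmetric]) (auto simp: algebra_simps)
    also have "\<bar>\<dots>\<bar> \<le> expectation (\<lambda>x. \<bar>indicator A x * (B (T m x) x - ?S (real n) x)\<bar>)"
      by (rule integral_abs_bound)
    also have "\<dots> \<le> expectation (\<lambda>x. \<bar>?S (real n) x - B (T m x) x\<bar>)"
      using i3 int stopped_integrable[of "real n"]
      by (intro integral_mono integrable_abs Bochner_Integration.integrable_diff) (auto simp: indicator_def)
    finally show ?thesis .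
  qed
  moreover obtain N where "t \<le> real N" using real_arch_simple by blast
  then have "t \<le> real n" if "n \<ge> N" for n using that by (meson of_nat_mono order_trans)
  ultimately have "\<bar>expectation (\<lambda>x. indicator A x * (B (T m x) x - ?S t x))\<bar> \<le> 0"
    by (intro LIMSEQ_le_const[OF conv(2)]) blast
  then show "expectation (\<lambda>x. indicator A x * (B (T m x) x - ?S t x)) = 0" by simp
qed

lemma terminal_expectation:
  assumes m: "m \<ge> 1" shows "expectation (\<lambda>x. B (T m x) x) = 0"
proof -
  have "canonical_space m \<in> sets (canonical_filtration m 0)"
    using sets.top[of "canonical_filtration m 0"] by simp
  from terminal_optional_stopping[OF m order_refl this]
  have "expectation (\<lambda>x. indicator (canonical_space m) x * (B (T m x) x - B (min (T m x) 0) x)) = 0" .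
  moreover have "indicator (canonical_space m) x * (B (T m x) x - B (min (T m x) 0) x) = B (T m x) x"
    if "x \<in> space P" for x
    using that m canonical_spaceD(2)[of x m] canonical_spaceD(5)[of x m m] by (simp add: space_P min_def)
  ultimately show ?thesis by (simp cong: Bochner_Integration.integral_cong)
qed

text \<open>Conditional Jensen written out with subgradients: the payoff at the terminal value
  dominates the payoff at the stopped value plus slope times the remaining increment. The slope is
  known at time \<open>t\<close>, so this last term has mean zero.\<close>

lemma stopped_call_put_le:
  assumes m: "m \<ge> 1" and t: "0 \<le> t"
  shows "expectation (\<lambda>x. max 0 (B (min (T m x) t) x - k)) \<le> expectation (\<lambda>x. max 0 (B (T m x) x - k))"
    and "expectation (\<lambda>x. max 0 (k - B (min (T m x) t) x)) \<le> expectation (\<lambda>x. max 0 (k - B (T m x) x))"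
proof -
  let ?S = "\<lambda>x. B (min (T m x) t) x"
  have [measurable]: "B t \<in> borel_measurable (canonical_filtration m t)" using t by (intro B_adapted) auto
  have F: "{x \<in> canonical_space m. B t x \<in> C} - {x \<in> canonical_space m. T m x \<le> t} \<in> sets (canonical_filtration m t)"
    if "C \<in> sets borel" for C
  proof (rule sets.Diff)
    have "{x \<in> space (canonical_filtration m t). B t x \<in> C} \<in> sets (canonical_filtration m t)"
      using that by measurable
    then show "{x \<in> canonical_space m. B t x \<in> C} \<in> sets (canonical_filtration m t)" by simp
    show "{x \<in> canonical_space m. T m x \<le> t} \<in> sets (canonical_filtration m t)"
      using m by (intro T_stopping) auto
  qed
  have mult: "integrable P (\<lambda>x. indicator A x * (f x :: real))"
    if "integrable P f" "A \<in> sets (canonical_filtration m t)" for f A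
    using integrable_real_mult_indicator[of A P f] that filtration_subset[OF t]
    by (auto simp: mult.commute)
  have iT: "integrable P (\<lambda>x. B (T m x) x)" by (rule terminal_integrable[OF m])
  have iS: "integrable P ?S" by (rule stopped_integrable[OF t])
  have pos: "integrable P (\<lambda>x. max 0 (f x))" if "integrable P f" for f :: "_ \<Rightarrow> real"
    using that by (intro integrable_max) auto
  \<comment> \<open>The slope of the call is 1 above the strike. After stopping there is no
    remaining increment, so only T m x > t is kept, where the stopped value is
    \<open>B t x\<close>.\<close>
  define A\<^sub>1 where "A\<^sub>1 = {x \<in> canonical_space m. B t x \<in> {k<..}} - {x \<in> canonical_space m. T m x \<le> t}"
  have A\<^sub>1: "A\<^sub>1 \<in> sets (canonical_filtration m t)" unfolding A\<^sub>1_def by (rule F) simp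
  have "expectation (\<lambda>x. max 0 (?S x - k)) = expectation (\<lambda>x. max 0 (?S x - k) + indicator A\<^sub>1 x * (B (T m x) x - ?S x))"
    using terminal_optional_stopping[OF m t A\<^sub>1] iT iS
    by (subst Bochner_Integration.integral_add) (auto intro!: pos mult A\<^sub>1)
  also have "\<dots> \<le> expectation (\<lambda>x. max 0 (B (T m x) x - k))"
  proof (rule integral_mono)
    show "max 0 (?S x - k) + indicator A\<^sub>1 x * (B (T m x) x - ?S x) \<le> max 0 (B (T m x) x - k)"
      if "x \<in> space P" for x
      using that by (cases "T m x \<le> t"; cases "k < B t x") (auto simp: space_P min_def A\<^sub>1_def)
  qed (use iT iS in \<open>auto intro!: pos mult A\<^sub>1 Bochner_Integration.integrable_add\<close>)
  finally show "expectation (\<lambda>x. max 0 (?S x - k)) \<le> expectation (\<lambda>x. max 0 (B (T m x) x - k))" .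
  \<comment> \<open>The slope of the put is -1 below the strike, hence the subtraction.\<close>
  define A\<^sub>2 where "A\<^sub>2 = {x \<in> canonical_space m. B t x \<in> {..<k}} - {x \<in> canonical_space m. T m x \<le> t}"
  have A\<^sub>2: "A\<^sub>2 \<in> sets (canonical_filtration m t)" unfolding A\<^sub>2_def by (rule F) simp
  have "expectation (\<lambda>x. max 0 (k - ?S x)) = expectation (\<lambda>x. max 0 (k - ?S x) - indicator A\<^sub>2 x * (B (T m x) x - ?S x))"
    using terminal_optional_stopping[OF m t A\<^sub>2] iT iS
    by (subst Bochner_Integration.integral_diff) (auto intro!: pos mult A\<^sub>2)
  also have "\<dots> \<le> expectation (\<lambda>x. max 0 (k - B (T m x) x))"
  proof (rule integral_mono)
    show "max 0 (k - ?S x) - indicator A\<^sub>2 x * (B (T m x) x - ?S x) \<le> max 0 (k - B (T m x) x)"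
      if "x \<in> space P" for x
      using that by (cases "T m x \<le> t"; cases "B t x < k") (auto simp: space_P min_def A\<^sub>2_def)
  qed (use iT iS in \<open>auto intro!: pos mult A\<^sub>2 Bochner_Integration.integrable_diff\<close>)
  finally show "expectation (\<lambda>x. max 0 (k - ?S x)) \<le> expectation (\<lambda>x. max 0 (k - B (T m x) x))" .
qed

lemma stopped_abs_le:
  assumes m: "m \<ge> 1" and t: "0 \<le> t"
  shows "expectation (\<lambda>x. \<bar>B (min (T m x) t) x\<bar>) \<le> expectation (\<lambda>x. \<bar>B (T m x) x\<bar>)"
proof -
  have *: "expectation (\<lambda>x. \<bar>f x\<bar>) = expectation (\<lambda>x. max 0 (f x - 0)) + expectation (\<lambda>x. max 0 (0 - f x))"
    if f: "integrable P f" for f :: "_ \<Rightarrow> real"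
  proof -
    have "expectation (\<lambda>x. \<bar>f x\<bar>) = expectation (\<lambda>x. max 0 (f x - 0) + max 0 (0 - f x))"
      by (rule Bochner_Integration.integral_cong) auto
    also have "\<dots> = expectation (\<lambda>x. max 0 (f x - 0)) + expectation (\<lambda>x. max 0 (0 - f x))"
      using f by (intro Bochner_Integration.integral_add integrable_max) auto
    finally show ?thesis .
  qed
  show ?thesis
    unfolding *[OF stopped_integrable[OF t]] *[OF terminal_integrable[OF m]]
    by (intro add_mono stopped_call_put_le m t)
qed

lemma late_stopping_bound:
  assumes m: "m \<ge> 1" and L: "L > 0" and R: "R > 0"
  shows "prob {x \<in> space P. L < T m x} \<le> expectation (\<lambda>x. \<bar>B (T m x) x\<bar>) / R + 2 * R / sqrt (2 * pi * L)"
proof -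
  have [measurable]: "T m \<in> borel_measurable P" "B L \<in> borel_measurable P"
    using m L by (auto intro: P_measurable)
  let ?S = "\<lambda>x. B (min (T m x) L) x"
  have iS: "integrable P ?S" using L by (intro stopped_integrable) auto
  then have [measurable]: "?S \<in> borel_measurable P" by auto
  have "prob {x \<in> space P. L < T m x} \<le> prob ({x \<in> space P. R \<le> \<bar>?S x\<bar>} \<union> {x \<in> space P. B L x \<in> {-R..R}})"
  proof (rule finite_measure_mono)
    show "{x \<in> space P. R \<le> \<bar>?S x\<bar>} \<union> {x \<in> space P. B L x \<in> {-R..R}} \<in> events" by measurable
  qed (auto simp: min_def)
  also have "\<dots> \<le> prob {x \<in> space P. R \<le> \<bar>?S x\<bar>} + prob {x \<in> space P. B L x \<in> {-R..R}}"
    by (rule measure_Un_le) measurable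
  also have "prob {x \<in> space P. R \<le> \<bar>?S x\<bar>} \<le> expectation (\<lambda>x. \<bar>?S x\<bar>) / R"
    using iS R by (intro integral_Markov_inequality_measure[where A = "{}"]) auto
  also have "\<dots> \<le> expectation (\<lambda>x. \<bar>B (T m x) x\<bar>) / R"
    using stopped_abs_le[OF m, of L] L R by (intro divide_right_mono) auto
  \<comment> \<open>The normal density with variance \<open>L\<close> is at most 1/sqrt(2 pi L), and
    the interval has length 2 R.\<close>
  also have "prob {x \<in> space P. B L x \<in> {-R..R}} \<le> 2 * R / sqrt (2 * pi * L)"
  proof -
    have D: "distributed P lborel (\<lambda>x. B L x - B 0 x) (normal_density 0 (sqrt (L - 0)))"
      using L by (intro increment_distributed) auto
    have "emeasure P {x \<in> space P. B L x \<in> {-R..R}} = emeasure (distr P lborel (\<lambda>x. B L x - B 0 x)) {-R..R}"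
      using distributed_measurable[OF D] by (subst emeasure_distr)
        (auto intro!: arg_cong[where f = "emeasure P"] simp: space_P canonical_spaceD(2))
    also have "\<dots> = (\<integral>\<^sup>+y. ennreal (normal_density 0 (sqrt L) y) * indicator {-R..R} y \<partial>lborel)"
      unfolding distributed_distr_eq_density[OF D] by (subst emeasure_density) auto
    also have "\<dots> \<le> (\<integral>\<^sup>+y. ennreal (1 / sqrt (2 * pi * L)) * indicator {-R..R} y \<partial>lborel)"
    proof (intro nn_integral_mono mult_right_mono ennreal_leI)
      fix y
      have "1 / sqrt (2 * pi * L) * exp (- (y\<^sup>2 / (2 * L))) \<le> 1 / sqrt (2 * pi * L) * 1"
        using L by (intro mult_left_mono) auto
      then show "normal_density 0 (sqrt L) y \<le> 1 / sqrt (2 * pi * L)"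
        using L by (simp add: normal_density_def)
    qed auto
    also have "\<dots> = ennreal (1 / sqrt (2 * pi * L)) * ennreal (2 * R)"
      using R by (subst nn_integral_cmult_indicator) auto
    also have "\<dots> = ennreal (2 * R / sqrt (2 * pi * L))"
      using L R by (subst ennreal_mult[symmetric]) auto
    finally show ?thesis using L R by (simp add: emeasure_eq_measure)
  qed
  finally show ?thesis by simp
qed

end

section \<open>Uniform control of late stopping and countable cells of paths\<close>

lemma late_stopping_tight:
  assumes m: "m \<ge> 1" and e: "e > 0"
  shows "\<exists>L>0. \<forall>P\<in>embeddings m. (\<integral>x. \<bar>B (T m x) x\<bar> \<partial>P) \<le> c \<longrightarrow> measure P {x \<in> space P. L < T m x} \<le> e"
proof -
  \<comment> \<open>\<open>R\<close> makes the Markov term c/R at most e/2; then \<open>L\<close> is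
    chosen so that 2 R/sqrt(L) equals e/2, with the factor 2 pi dropped. The maximum with 1 keeps
    \<open>R\<close> positive whatever the sign of \<open>c\<close>.\<close>
  define R where "R = max 1 (2 * c / e)"
  have R: "R > 0" "2 * c \<le> e * R" using e by (auto simp: R_def max_def field_simps)
  define L where "L = (4 * R / e)\<^sup>2"
  have L: "L > 0" using R e by (simp add: L_def)
  have "measure P {x \<in> space P. L < T m x} \<le> e"
    if P: "P \<in> embeddings m" and c: "(\<integral>x. \<bar>B (T m x) x\<bar> \<partial>P) \<le> c" for P
  proof -
    interpret embedding m P using P by (rule embeddingI)
    have "sqrt (2 * pi * L) \<ge> sqrt L" using pi_gt3 L by (intro real_sqrt_le_mono) auto
    moreover have "sqrt L = 4 * R / e" using R e by (simp add: L_def)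
    ultimately have "2 * R / sqrt (2 * pi * L) \<le> 2 * R / (4 * R / e)"
      using R e L by (intro divide_left_mono mult_pos_pos divide_pos_pos) auto
    also have "\<dots> = e / 2" using R e by simp
    finally have 1: "2 * R / sqrt (2 * pi * L) \<le> e / 2" .
    have "(\<integral>x. \<bar>B (T m x) x\<bar> \<partial>P) / R \<le> c / R" using c R by (intro divide_right_mono) auto
    also have "\<dots> \<le> e / 2" using R by (simp add: field_simps)
    finally show ?thesis using late_stopping_bound[OF m L R(1)] 1 by linarith
  qed
  then show ?thesis using L by blast
qed

text \<open>The paths that stay within 2 h of a step function with mesh 1/N and values in h times
  the integers. Testing rational times only keeps the set measurable in the product sigma-algebra;
  continuity later recovers all times.\<close>

definition path_cell :: "real \<Rightarrow> real \<Rightarrow> nat \<Rightarrow> int list \<Rightarrow> (real \<Rightarrow> real) set" where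
  "path_cell L h N vs = {w \<in> space (\<Pi>\<^sub>M t\<in>{0..}. borel).
     \<forall>q\<in>\<rat> \<inter> {0..L}. \<bar>w q - h * real_of_int (vs ! nat \<lfloor>q * real N\<rfloor>)\<bar> \<le> 2 * h}"

lemma path_cell_measurable: "path_cell L h N vs \<in> sets (\<Pi>\<^sub>M t\<in>{0..}. borel)"
proof -
  have "countable (\<rat> \<inter> {0..L})" using countable_rat by (rule countable_subset[rotated]) auto
  moreover have "Measurable.pred (\<Pi>\<^sub>M t\<in>{0..}. borel) (\<lambda>w. \<bar>w q - c\<bar> \<le> d)" if "q \<in> \<rat> \<inter> {0..L}" for q c d :: real
  proof -
    have [measurable]: "(\<lambda>w. w q) \<in> borel_measurable (\<Pi>\<^sub>M t\<in>{0..}. borel)"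
      using that by (intro measurable_component_singleton) auto
    show ?thesis by measurable
  qed
  ultimately show ?thesis unfolding path_cell_def pred_def[symmetric] by (intro measurable_pred_countable) auto
qed

text \<open>Uniform continuity on [0, L] supplies the mesh. The oscillation within a mesh interval
  costs one \<open>h\<close>, rounding down to a multiple of \<open>h\<close> another.\<close>

lemma path_cell_cover:
  assumes w: "w \<in> space (\<Pi>\<^sub>M t\<in>{0..}. borel)" "continuous_on {0..} w" and h: "h > 0"
  shows "\<exists>N vs. w \<in> path_cell L h N vs"
proof -
  have "uniformly_continuous_on {0..L} w"
    using w(2) by (intro compact_uniformly_continuous) (auto elim: continuous_on_subset)
  then obtain \<delta> where \<delta>: "\<delta> > 0"
    "\<And>s t. s \<in> {0..L} \<Longrightarrow> t \<in> {0..L} \<Longrightarrow> dist s t < \<delta> \<Longrightarrow> dist (w s) (w t) < h"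
    using h unfolding uniformly_continuous_on_def by metis
  obtain n where n: "1 / real (Suc n) < \<delta>" using \<delta>(1) by (metis nat_approx_posE)
  define N where "N = Suc n"
  have N: "N > 0" "1 / real N < \<delta>" using n by (auto simp: N_def)
  \<comment> \<open>One entry more than the floor of L N, because the time \<open>L\<close> itself
    falls into the interval with that number.\<close>
  define vs where "vs = map (\<lambda>j. \<lfloor>w (real j / real N) / h\<rfloor>) [0..<Suc (nat \<lfloor>L * real N\<rfloor>)]"
  have "\<bar>w q - h * real_of_int (vs ! nat \<lfloor>q * real N\<rfloor>)\<bar> \<le> 2 * h" if q: "q \<in> {0..L}" for q
  proof -
    define j where "j = nat \<lfloor>q * real N\<rfloor>"
    have j: "real j \<le> q * real N" "q * real N < real j + 1" 
      using q by (auto simp: j_def)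
    have "j \<le> nat \<lfloor>L * real N\<rfloor>" unfolding j_def using q by (intro nat_mono floor_mono mult_right_mono) auto
    then have v: "vs ! j = \<lfloor>w (real j / real N) / h\<rfloor>" unfolding vs_def by (simp del: upt_Suc)
    have jq: "real j / real N \<le> q" "q < real j / real N + 1 / real N"
      using j N(1) by (auto simp: field_simps)
    then have "dist (w q) (w (real j / real N)) < h"
      using q N by (intro \<delta>(2)) (auto simp: dist_real_def)
    moreover have "\<bar>w (real j / real N) - h * \<lfloor>w (real j / real N) / h\<rfloor>\<bar> \<le> h"
    proof -
      have "h * real_of_int \<lfloor>w (real j / real N) / h\<rfloor> \<le> w (real j / real N)"
        "w (real j / real N) < h * real_of_int \<lfloor>w (real j / real N) / h\<rfloor> + h"
        using floor_divide_lower[OF h, of "w (real j / real N)"] floor_divide_upper[OF h, of "w (real j / real N)"]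
        by (simp_all add: algebra_simps)
      then show ?thesis by linarith
    qed
    ultimately show ?thesis unfolding j_def[symmetric] v dist_real_def by linarith
  qed
  then show ?thesis using w(1) unfolding path_cell_def by blast
qed

lemma path_cell_diameter:
  assumes w: "w \<in> path_cell L h N vs" "w' \<in> path_cell L h N vs"
    and cont: "continuous_on {0..} w" "continuous_on {0..} w'" and t: "t \<in> {0..L}"
  shows "\<bar>w t - w' t\<bar> \<le> 4 * h"
proof -
  \<comment> \<open>These rationals approach \<open>t\<close> from below, so they never leave
    [0, L].\<close>
  define q where "q n = real_of_int \<lfloor>t * real (Suc n)\<rfloor> / real (Suc n)" for n
  have q: "q n \<in> \<rat> \<inter> {0..L}" "\<bar>q n - t\<bar> \<le> 1 / real (Suc n)" for n
  proof -
    have f: "real_of_int \<lfloor>t * real (Suc n)\<rfloor> \<le> t * real (Suc n)" "t * real (Suc n) \<le> real_of_int \<lfloor>t * real (Suc n)\<rfloor> + 1"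
      by linarith+
    then have "q n \<le> t" "t \<le> q n + 1 / real (Suc n)"
      unfolding q_def by (simp_all only: add_divide_distrib[symmetric] pos_divide_le_eq pos_le_divide_eq of_nat_0_less_iff zero_less_Suc)
    moreover have "0 \<le> q n" using t by (simp add: q_def)
    moreover have "q n \<in> \<rat>" by (simp add: q_def)
    ultimately show "q n \<in> \<rat> \<inter> {0..L}" "\<bar>q n - t\<bar> \<le> 1 / real (Suc n)" using t by auto
  qed
  have "(\<lambda>n. q n - t) \<longlonglongrightarrow> 0"
    by (rule Lim_null_comparison[OF _ LIMSEQ_inverse_real_of_nat[unfolded inverse_eq_divide]]) (use q(2) in auto)
  then have qt: "q \<longlonglongrightarrow> t" by (simp add: LIM_zero_iff)
  have "(\<lambda>n. \<bar>w (q n) - w' (q n)\<bar>) \<longlonglongrightarrow> \<bar>w t - w' t\<bar>"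
    using t q(1) by (intro tendsto_intros continuous_on_tendsto_compose[OF cont(1) qt] continuous_on_tendsto_compose[OF cont(2) qt]) auto
  moreover have "\<bar>w (q n) - w' (q n)\<bar> \<le> 4 * h" for n
  proof -
    have "\<bar>w (q n) - h * real_of_int (vs ! nat \<lfloor>q n * real N\<rfloor>)\<bar> \<le> 2 * h"
      "\<bar>w' (q n) - h * real_of_int (vs ! nat \<lfloor>q n * real N\<rfloor>)\<bar> \<le> 2 * h"
      using w q(1)[of n] unfolding path_cell_def by blast+
    then show ?thesis by linarith
  qed
  ultimately show ?thesis by (intro LIMSEQ_le_const2) auto
qed

section \<open>Tightness of embeddings\<close>

text \<open>The index encodes a time mesh \<open>N\<close>, the approximate path values on it and the rounded stopping times.\<close>

definition canonical_cell :: "nat \<Rightarrow> nat \<Rightarrow> nat \<Rightarrow> ((real \<Rightarrow> real) \<times> (nat \<Rightarrow> real)) set" where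
  "canonical_cell m k j = (case from_nat j :: (nat \<times> int list) \<times> int list of ((N, vs), us) \<Rightarrow>
     {x \<in> canonical_space m. fst x \<in> path_cell (2 ^ k) (1 / 2 ^ (k + 2)) N vs \<and>
       (\<forall>i\<in>{1..m}. \<lfloor>T i x * 2 ^ k\<rfloor> = us ! i)})"

lemma canonical_cell_to_nat:
  "canonical_cell m k (to_nat ((N, vs), us)) =
     {x \<in> canonical_space m. fst x \<in> path_cell (2 ^ k) (1 / 2 ^ (k + 2)) N vs \<and>
       (\<forall>i\<in>{1..m}. \<lfloor>T i x * 2 ^ k\<rfloor> = us ! i)}"
  by (simp add: canonical_cell_def)

lemma canonical_cell_cases:
  obtains N vs us where "canonical_cell m k j =
     {x \<in> canonical_space m. fst x \<in> path_cell (2 ^ k) (1 / 2 ^ (k + 2)) N vs \<and>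
       (\<forall>i\<in>{1..m}. \<lfloor>T i x * 2 ^ k\<rfloor> = us ! i)}"
  unfolding canonical_cell_def by (cases "from_nat j :: (nat \<times> int list) \<times> int list") auto

lemma canonical_cell_measurable: "canonical_cell m k j \<in> sets (canonical_borel m)"
proof -
  obtain N vs us where *: "canonical_cell m k j =
     {x \<in> canonical_space m. fst x \<in> path_cell (2 ^ k) (1 / 2 ^ (k + 2)) N vs \<and>
       (\<forall>i\<in>{1..m}. \<lfloor>T i x * 2 ^ k\<rfloor> = us ! i)}" by (rule canonical_cell_cases)
  have [measurable]: "fst \<in> canonical_borel m \<rightarrow>\<^sub>M (\<Pi>\<^sub>M t\<in>{0..}. borel)" by (rule measurable_fst_canonical)
  have [measurable]: "path_cell L h N vs \<in> sets (\<Pi>\<^sub>M t\<in>{0..}. borel)" for L h N vs by (rule path_cell_measurable)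
  have "Measurable.pred (canonical_borel m) (\<lambda>x. \<lfloor>T i x * 2 ^ k\<rfloor> = us ! i)" if "i \<in> {1..m}" for i
  proof -
    have [measurable]: "T i \<in> borel_measurable (canonical_borel m)" using that by (rule measurable_T)
    show ?thesis by measurable
  qed
  then have [measurable]: "Measurable.pred (canonical_borel m) (\<lambda>x. \<forall>i\<in>{1..m}. \<lfloor>T i x * 2 ^ k\<rfloor> = us ! i)"
    by (intro measurable_pred_countable) auto
  have "{x \<in> space (canonical_borel m). fst x \<in> path_cell (2 ^ k) (1 / 2 ^ (k + 2)) N vs \<and>
       (\<forall>i\<in>{1..m}. \<lfloor>T i x * 2 ^ k\<rfloor> = us ! i)} \<in> sets (canonical_borel m)"
    by measurable
  then show ?thesis unfolding * space_canonical_borel .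
qed

lemma continuous_on_fst: "x \<in> canonical_space m \<Longrightarrow> continuous_on {0..} (fst x)"
  using canonical_spaceD(1)[of x m] by (simp add: B_def)

lemma canonical_cell_diameter:
  assumes "x \<in> canonical_cell m k j" "y \<in> canonical_cell m k j"
  shows "canonical_dist m x y \<le> 1 / 2 ^ k"
proof -
  obtain N vs us where *: "canonical_cell m k j =
     {x \<in> canonical_space m. fst x \<in> path_cell (2 ^ k) (1 / 2 ^ (k + 2)) N vs \<and>
       (\<forall>i\<in>{1..m}. \<lfloor>T i x * 2 ^ k\<rfloor> = us ! i)}" by (rule canonical_cell_cases)
  have xy: "x \<in> canonical_space m" "y \<in> canonical_space m"
    "fst x \<in> path_cell (2 ^ k) (1 / 2 ^ (k + 2)) N vs" "fst y \<in> path_cell (2 ^ k) (1 / 2 ^ (k + 2)) N vs"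
    and T: "\<And>i. i \<in> {1..m} \<Longrightarrow> \<lfloor>T i x * 2 ^ k\<rfloor> = \<lfloor>T i y * 2 ^ k\<rfloor>"
    using assms unfolding * by auto
  \<comment> \<open>The accuracy 1/2^(k+2) is a quarter of 1/2^k, to absorb the factor 4 in
    \<open>path_cell_diameter\<close>; the time 2^k is the horizon belonging to 1/2^k.\<close>
  have "\<bar>B t x - B t y\<bar> \<le> 1 / 2 ^ k" if "t \<in> {0..2 ^ k}" for t
    using path_cell_diameter[OF xy(3,4) continuous_on_fst[OF xy(1)] continuous_on_fst[OF xy(2)] that]
    by (simp add: B_def)
  moreover have "\<bar>T i x - T i y\<bar> \<le> 1 / 2 ^ k" if "i \<in> {1..m}" for i
  proof -
    have "\<bar>T i x * 2 ^ k - T i y * 2 ^ k\<bar> \<le> 1" using T[OF that] by linarith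
    then have "\<bar>T i x - T i y\<bar> * 2 ^ k \<le> 1" by (simp add: left_diff_distrib[symmetric] abs_mult)
    then show ?thesis by (simp add: pos_le_divide_eq)
  qed
  ultimately have "close_within m (1 / 2 ^ k) x y" by (simp add: close_within_def)
  then show ?thesis by (intro canonical_dist_le) auto
qed

lemma fst_in_space_PiM: "x \<in> canonical_space m \<Longrightarrow> fst x \<in> space (\<Pi>\<^sub>M t\<in>{0..}. borel)"
  using measurable_space[OF measurable_fst_canonical[of m], unfolded space_canonical_borel] .

lemma canonical_cell_cover: "canonical_space m \<subseteq> (\<Union>j. canonical_cell m k j)"
proof
  fix x assume x: "x \<in> canonical_space m"
  obtain N vs where "fst x \<in> path_cell (2 ^ k) (1 / 2 ^ (k + 2)) N vs"
    using path_cell_cover[OF fst_in_space_PiM[OF x] continuous_on_fst[OF x], of "1 / 2 ^ (k + 2)" "2 ^ k"] by auto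
  then have "x \<in> canonical_cell m k (to_nat ((N, vs), map (\<lambda>i. \<lfloor>T i x * 2 ^ k\<rfloor>) [0..<Suc m]))"
    unfolding canonical_cell_to_nat using x by (auto simp del: upt_Suc)
  then show "x \<in> (\<Union>j. canonical_cell m k j)" by blast
qed

text \<open>By \<open>path_law_unique\<close> a single embedding \<open>P0\<close> represents the
  path law of all of them, so uniform tightness reduces to continuity from below of one measure
  along the countable cover by cells.\<close>

lemma path_cells_tight:
  assumes h: "h > 0" and e: "e > 0"
  shows "\<exists>J. \<forall>P\<in>embeddings m. measure P {x \<in> space P. fst x \<notin> (\<Union>j\<le>J. case_prod (path_cell L h) (from_nat j))} \<le> e"
proof (cases "embeddings m = {}")
  case False
  define D where "D j = case_prod (path_cell L h) (from_nat j)" for j :: nat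
  have D: "D j \<in> sets (\<Pi>\<^sub>M t\<in>{0..}. borel)" for j
    by (simp add: D_def path_cell_measurable split: prod.split)
  define U where "U J = (\<Union>j\<le>J. D j)" for J
  have U: "U J \<in> sets (\<Pi>\<^sub>M t\<in>{0..}. borel)" for J unfolding U_def using D by auto
  obtain P0 where P0: "P0 \<in> embeddings m" using False by blast
  have law: "measure P {x \<in> space P. fst x \<in> U J} = measure P0 {x \<in> space P0. fst x \<in> U J}"
    if "P \<in> embeddings m" for P J
  proof -
    have *: "measure P {x \<in> space P. fst x \<in> U J} = measure (distr P (\<Pi>\<^sub>M t\<in>{0..}. borel) fst) (U J)"
      if "P \<in> embeddings m" for P
    proof -
      interpret embedding m P using that by (rule embeddingI)
      show ?thesis using fst_measurable U by (subst measure_distr) (auto intro!: arg_cong[where f = prob])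
    qed
    show ?thesis unfolding *[OF that] *[OF P0] path_law_unique[OF that P0] ..
  qed
  have events: "{x \<in> space P. fst x \<in> U J} \<in> sets P" if "P \<in> embeddings m" for P J
  proof -
    interpret embedding m P using that by (rule embeddingI)
    from measurable_sets[OF fst_measurable U] show ?thesis by (simp add: vimage_def Int_def conj_commute)
  qed
  interpret P0: embedding m P0 using P0 by (rule embeddingI)
  have "(\<lambda>J. measure P0 {x \<in> space P0. fst x \<in> U J}) \<longlonglongrightarrow> measure P0 (\<Union>J. {x \<in> space P0. fst x \<in> U J})"
    using events[OF P0] by (intro P0.finite_Lim_measure_incseq) (auto simp: incseq_def U_def)
  also have "(\<Union>J. {x \<in> space P0. fst x \<in> U J}) = space P0"
  proof -
    have "\<exists>J. fst x \<in> U J" if x: "x \<in> canonical_space m" for x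
    proof -
      obtain N vs where "fst x \<in> path_cell L h N vs"
        using path_cell_cover[OF fst_in_space_PiM[OF x] continuous_on_fst[OF x] h, of L] by blast
      then have "fst x \<in> D (to_nat (N, vs))" by (simp add: D_def)
      then show ?thesis unfolding U_def by blast
    qed
    then show ?thesis by (auto simp: P0.space_P)
  qed
  finally have "(\<lambda>J. measure P0 {x \<in> space P0. fst x \<in> U J}) \<longlonglongrightarrow> 1" by (simp add: P0.prob_space)
  then obtain J where J: "1 - e < measure P0 {x \<in> space P0. fst x \<in> U J}"
    using order_tendstoD(1)[of _ 1 sequentially "1 - e"] e by (auto simp: eventually_sequentially)
  have "measure P {x \<in> space P. fst x \<notin> U J} \<le> e" if P: "P \<in> embeddings m" for P
  proof -
    interpret embedding m P using P by (rule embeddingI)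
    have "{x \<in> space P. fst x \<notin> U J} = space P - {x \<in> space P. fst x \<in> U J}" by auto
    then show ?thesis using prob_compl[OF events[OF P]] law[OF P] J by simp
  qed
  then show ?thesis unfolding U_def D_def by blast
qed auto

text \<open>A bound \<open>L\<close> on the last time bounds all earlier ones, so only finitely many
  rounded time vectors remain; together with finitely many path cells they give finitely many
  indices, hence a largest one.\<close>

lemma canonical_cell_tight:
  assumes m: "m \<ge> 1" and e: "e > 0"
  shows "\<exists>N. \<forall>P\<in>embeddings m. (\<integral>x. \<bar>B (T m x) x\<bar> \<partial>P) \<le> c \<longrightarrow>
    measure P (canonical_space m - (\<Union>j\<le>N. canonical_cell m k j)) \<le> e"
proof -
  obtain L where L: "\<And>P. P \<in> embeddings m \<Longrightarrow> (\<integral>x. \<bar>B (T m x) x\<bar> \<partial>P) \<le> c \<Longrightarrow>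
      measure P {x \<in> space P. L < T m x} \<le> e / 2"
    using late_stopping_tight[OF m, of "e / 2" c] e by auto
  define p where "p j = (from_nat j :: nat \<times> int list)" for j
  obtain J where J: "\<And>P. P \<in> embeddings m \<Longrightarrow>
      measure P {x \<in> space P. fst x \<notin> (\<Union>j\<le>J. case_prod (path_cell (2 ^ k) (1 / 2 ^ (k + 2))) (p j))} \<le> e / 2"
    using path_cells_tight[of "1 / 2 ^ (k + 2)" "e / 2" m "2 ^ k"] e unfolding p_def by auto
  \<comment> \<open>Times are numbered from 1 but lists from 0. The dummy entry 0 is set to 0, and 0
    is adjoined in \<open>S\<close>, so that these lists range over a finite set.\<close>
  define us where "us x = map (\<lambda>i. if i = 0 then 0 else \<lfloor>T i x * 2 ^ k\<rfloor>) [0..<Suc m]" for x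
  define S where "S = {us :: int list. set us \<subseteq> {0..\<lfloor>L * 2 ^ k\<rfloor>} \<union> {0} \<and> length us = Suc m}"
  have "finite S" unfolding S_def by (rule finite_lists_length_eq) auto
  then have "finite ((\<lambda>(j, us). to_nat (p j, us)) ` ({..J} \<times> S))" by auto
  then obtain N where "\<forall>n\<in>(\<lambda>(j, us). to_nat (p j, us)) ` ({..J} \<times> S). n \<le> N"
    unfolding finite_nat_set_iff_bounded_le by blast
  then have N: "to_nat (p j, us) \<le> N" if "j \<le> J" "us \<in> S" for j us
    using that by (auto simp: ball_simps)
  have "measure P (canonical_space m - (\<Union>j\<le>N. canonical_cell m k j)) \<le> e"
    if P: "P \<in> embeddings m" and c: "(\<integral>x. \<bar>B (T m x) x\<bar> \<partial>P) \<le> c" for P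
  proof -
    interpret embedding m P using P by (rule embeddingI)
    let ?U = "\<Union>j\<le>J. case_prod (path_cell (2 ^ k) (1 / 2 ^ (k + 2))) (p j)"
    have [measurable]: "T m \<in> borel_measurable P" using m by (auto intro: P_measurable)
    note [measurable] = fst_measurable
    have [measurable]: "?U \<in> sets (\<Pi>\<^sub>M t\<in>{0..}. borel)"
      by (intro sets.finite_UN) (auto simp: path_cell_measurable split: prod.split)
    have "canonical_space m - (\<Union>j\<le>N. canonical_cell m k j)
        \<subseteq> {x \<in> space P. fst x \<notin> ?U} \<union> {x \<in> space P. L < T m x}"
    proof (rule subsetI, rule ccontr)
      fix x assume x: "x \<in> canonical_space m - (\<Union>j\<le>N. canonical_cell m k j)"
        and "x \<notin> {x \<in> space P. fst x \<notin> ?U} \<union> {x \<in> space P. L < T m x}"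
      then have xU: "fst x \<in> ?U" and xL: "T m x \<le> L" and xm: "x \<in> canonical_space m"
        by (auto simp: space_P)
      obtain j where "j \<in> {..J}" and j: "fst x \<in> case_prod (path_cell (2 ^ k) (1 / 2 ^ (k + 2))) (p j)"
        using xU by (rule UN_E)
      then have jJ: "j \<le> J" by simp
      have "us x \<in> S"
      proof -
        have "\<lfloor>T i x * 2 ^ k\<rfloor> \<in> {0..\<lfloor>L * 2 ^ k\<rfloor>}" if "i \<in> {1..m}" for i
        proof -
          have "0 \<le> T i x" "T i x \<le> L"
            using canonical_spaceD(5)[OF xm that] canonical_spaceD(6)[OF xm that, of m] m that xL by auto
          then show ?thesis by (auto intro!: floor_mono mult_right_mono)
        qed
        then show ?thesis unfolding S_def us_def by (auto simp del: upt_Suc)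
      qed
      then have "to_nat (p j, us x) \<le> N" using jJ N by blast
      moreover have "x \<in> canonical_cell m k (to_nat (p j, us x))"
      proof -
        obtain n vs where pj: "p j = (n, vs)" by (cases "p j")
        have "us x ! i = \<lfloor>T i x * 2 ^ k\<rfloor>" if "i \<in> {1..m}" for i
          using that unfolding us_def by (subst nth_map) (auto simp del: upt_Suc)
        then show ?thesis using xm j unfolding pj canonical_cell_to_nat by auto
      qed
      ultimately show False using x by blast
    qed
    then have "measure P (canonical_space m - (\<Union>j\<le>N. canonical_cell m k j))
        \<le> measure P ({x \<in> space P. fst x \<notin> ?U} \<union> {x \<in> space P. L < T m x})"
      by (intro finite_measure_mono) measurable
    also have "\<dots> \<le> measure P {x \<in> space P. fst x \<notin> ?U} + measure P {x \<in> space P. L < T m x}"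
      by (rule measure_Un_le) measurable
    also have "\<dots> \<le> e" using J[OF P] L[OF P c] by simp
    finally show ?thesis .
  qed
  then show ?thesis by blast
qed

lemma embeddings_subsequence:
  assumes m: "m \<ge> 1" and P: "\<And>n. P n \<in> embeddings m"
    and c: "\<And>n. (\<integral>x. \<bar>B (T m x) x\<bar> \<partial>P n) \<le> c"
  shows "\<exists>r (\<Omega>::real measure) X Y. strict_mono (r :: nat \<Rightarrow> nat) \<and> prob_space \<Omega> \<and>
    (\<forall>n. X n \<in> \<Omega> \<rightarrow>\<^sub>M canonical_borel m \<and> distr \<Omega> (canonical_borel m) (X n) = P (r n)) \<and>
    Y \<in> \<Omega> \<rightarrow>\<^sub>M canonical_borel m \<and> (\<forall>s\<in>space \<Omega>. (\<lambda>n. canonical_dist m (X n s) (Y s)) \<longlonglongrightarrow> 0)"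
  unfolding canonical_mtopology[symmetric]
proof (rule canonical.Skorokhod_subsequence[where A = "canonical_cell m"])
  show "prob_space (P n)" "sets (P n) = sets (borel_of (canonical.mtopology m))" for n
    using P[of n] by (simp_all add: embeddings_def canonical_mtopology)
  show "\<exists>N. \<forall>n. measure (P n) (canonical_space m - (\<Union>i\<le>N. canonical_cell m k i)) \<le> e" if "e > 0" for k e
    using canonical_cell_tight[OF m that, of c k] P c by meson
qed (use canonical_mcomplete canonical_cell_measurable canonical_cell_diameter canonical_cell_cover
  in \<open>auto simp: canonical_mtopology\<close>)

section \<open>Limits of embeddings\<close>

text \<open>A continuous substitute for the indicator of y <= a: it is 1 up to \<open>a\<close>,
  linear, and 0 from a + \<delta> on.\<close>

definition ramp :: "real \<Rightarrow> real \<Rightarrow> real \<Rightarrow> real" where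
  "ramp a \<delta> y = max 0 (min 1 (1 - (y - a) / \<delta>))"

lemma ramp_bounds: "0 \<le> ramp a \<delta> y" "ramp a \<delta> y \<le> 1" "\<bar>ramp a \<delta> y\<bar> \<le> 1"
  by (auto simp: ramp_def)

lemma ramp_measurable [measurable]: "ramp a \<delta> \<in> borel_measurable borel"
  unfolding ramp_def[abs_def] by measurable

lemma tendsto_ramp: "(f \<longlongrightarrow> y) F \<Longrightarrow> \<delta> > 0 \<Longrightarrow> ((\<lambda>n. ramp a \<delta> (f n)) \<longlongrightarrow> ramp a \<delta> y) F"
  unfolding ramp_def by (intro tendsto_intros) auto

lemma ramp_tendsto_indicator: "(\<lambda>k. ramp a (1 / real (Suc k)) y) \<longlonglongrightarrow> indicator {..a} y"
proof (cases "y \<le> a")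
  case True
  then have "(y - a) / (1 / real (Suc k)) \<le> 0" for k by (intro divide_nonpos_pos) auto
  then have "ramp a (1 / real (Suc k)) y = 1" for k unfolding ramp_def by (smt (verit))
  then show ?thesis using True by simp
next
  case False
  then obtain N where N: "1 / (y - a) \<le> real N" using real_arch_simple by blast
  have "ramp a (1 / real (Suc k)) y = 0" if "k \<ge> N" for k
  proof -
    have "1 / (y - a) \<le> real (Suc k)" using N that by linarith
    then have "1 \<le> (y - a) * real (Suc k)" using False by (simp add: field_simps)
    then show ?thesis by (simp add: ramp_def)
  qed
  then have "\<forall>\<^sub>F k in sequentially. ramp a (1 / real (Suc k)) y = 0"
    by (auto simp: eventually_sequentially)
  then show ?thesis using False by (simp add: tendsto_eventually)
qed

lemma (in prob_space) integral_bounded_limit: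
  fixes f :: "nat \<Rightarrow> 'a \<Rightarrow> real"
  assumes "\<And>n. f n \<in> borel_measurable M" "g \<in> borel_measurable M"
    and "\<And>x. x \<in> space M \<Longrightarrow> (\<lambda>n. f n x) \<longlonglongrightarrow> g x" "\<And>n x. \<bar>f n x\<bar> \<le> b"
  shows "(\<lambda>n. \<integral>x. f n x \<partial>M) \<longlonglongrightarrow> (\<integral>x. g x \<partial>M)"
  using assms by (intro integral_dominated_convergence[where w = "\<lambda>_. b"]) auto

text \<open>As the width shrinks, the ramps converge boundedly to the indicator, so their integrals
  recover the distribution function.\<close>

lemma ramp_determines_distribution:
  assumes M: "prob_space M" "sets M = sets borel" and N: "prob_space N" "sets N = sets borel"
    and eq: "\<And>a k. (\<integral>y. ramp a (1 / real (Suc k)) y \<partial>M) = (\<integral>y. ramp a (1 / real (Suc k)) y \<partial>N)"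
  shows "M = N"
proof (rule cdf_unique)
  show "real_distribution M" "real_distribution N"
    using M N by (auto simp: real_distribution_def real_distribution_axioms_def)
  have lim: "(\<lambda>k. \<integral>y. ramp a (1 / real (Suc k)) y \<partial>L) \<longlonglongrightarrow> cdf L a"
    if L: "prob_space L" "sets L = sets borel" for L a
  proof -
    interpret prob_space L by fact
    have [measurable_cong]: "sets L = sets borel" by fact
    have "(\<lambda>k. \<integral>y. ramp a (1 / real (Suc k)) y \<partial>L) \<longlonglongrightarrow> (\<integral>y. indicator {..a} y \<partial>L)"
      by (rule integral_bounded_limit[where b = 1, OF _ _ ramp_tendsto_indicator]) (auto simp: ramp_bounds)
    then show ?thesis using sets_eq_imp_space_eq[OF L(2)] by (simp add: cdf_def)
  qed
  show "cdf M = cdf N"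
  proof
    fix a show "cdf M a = cdf N a"
      using lim[OF M, of a] lim[OF N, of a] unfolding eq by (rule LIMSEQ_unique)
  qed
qed

locale canonical_limit = prob_space \<Omega> for \<Omega> :: "'b measure" +
  fixes m :: nat and X :: "nat \<Rightarrow> 'b \<Rightarrow> (real \<Rightarrow> real) \<times> (nat \<Rightarrow> real)" and Y
  assumes m: "m \<ge> 1"
    and X: "\<And>n. X n \<in> \<Omega> \<rightarrow>\<^sub>M canonical_borel m"
    and X_embedding: "\<And>n. distr \<Omega> (canonical_borel m) (X n) \<in> embeddings m"
    and Y: "Y \<in> \<Omega> \<rightarrow>\<^sub>M canonical_borel m"
    and lim: "\<And>s. s \<in> space \<Omega> \<Longrightarrow> (\<lambda>n. canonical_dist m (X n s) (Y s)) \<longlonglongrightarrow> 0"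
begin

abbreviation "P n \<equiv> distr \<Omega> (canonical_borel m) (X n)"
abbreviation "Q \<equiv> distr \<Omega> (canonical_borel m) Y"

lemma X_space: "s \<in> space \<Omega> \<Longrightarrow> X n s \<in> canonical_space m"
  using measurable_space[OF X] unfolding space_canonical_borel .

lemma Y_space: "s \<in> space \<Omega> \<Longrightarrow> Y s \<in> canonical_space m"
  using measurable_space[OF Y] unfolding space_canonical_borel .

lemma prob_Q: "prob_space Q" by (rule prob_space_distr[OF Y])

lemma space_Q: "space Q = canonical_space m" by (simp add: topspace_canonical_topology)

lemma integral_P: "f \<in> borel_measurable (canonical_borel m) \<Longrightarrow> (\<integral>x. f x \<partial>P n) = (\<integral>s. f (X n s) \<partial>\<Omega>)"
  for f :: "_ \<Rightarrow> real"
  by (rule integral_distr[OF X])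

lemma integral_Q: "f \<in> borel_measurable (canonical_borel m) \<Longrightarrow> (\<integral>x. f x \<partial>Q) = (\<integral>s. f (Y s) \<partial>\<Omega>)"
  for f :: "_ \<Rightarrow> real"
  by (rule integral_distr[OF Y])

lemma integral_limit:
  fixes f :: "_ \<Rightarrow> real"
  assumes f: "f \<in> borel_measurable (canonical_borel m)" "\<And>x. \<bar>f x\<bar> \<le> b"
    and cont: "\<And>s. s \<in> space \<Omega> \<Longrightarrow> (\<lambda>n. f (X n s)) \<longlonglongrightarrow> f (Y s)"
  shows "(\<lambda>n. \<integral>x. f x \<partial>P n) \<longlonglongrightarrow> (\<integral>x. f x \<partial>Q)"
  unfolding integral_P[OF f(1)] integral_Q[OF f(1)]
  using measurable_compose[OF X f(1)] measurable_compose[OF Y f(1)] f(2) cont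
  by (intro integral_bounded_limit[where b = b]) auto

lemma B_limit: "s \<in> space \<Omega> \<Longrightarrow> 0 \<le> t \<Longrightarrow> (\<lambda>n. B t (X n s)) \<longlonglongrightarrow> B t (Y s)"
  by (rule canonical_tendsto_B[OF X_space Y_space lim]) auto

lemma T_limit: "s \<in> space \<Omega> \<Longrightarrow> i \<in> {1..m} \<Longrightarrow> (\<lambda>n. T i (X n s)) \<longlonglongrightarrow> T i (Y s)"
  by (rule canonical_tendsto_T[OF X_space Y_space lim])

lemma B_T_limit: "s \<in> space \<Omega> \<Longrightarrow> i \<in> {1..m} \<Longrightarrow> (\<lambda>n. B (T i (X n s)) (X n s)) \<longlonglongrightarrow> B (T i (Y s)) (Y s)"
  by (rule canonical_tendsto_B_T[OF X_space Y_space lim])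

lemma B_min_T_limit: "s \<in> space \<Omega> \<Longrightarrow> i \<in> {1..m} \<Longrightarrow> 0 \<le> t \<Longrightarrow>
    (\<lambda>n. B (min (T i (X n s)) t) (X n s)) \<longlonglongrightarrow> B (min (T i (Y s)) t) (Y s)"
  by (rule canonical_tendsto_B_min_T[OF X_space Y_space lim])

text \<open>Every \<open>P n\<close> gives the increment the same normal law, so the integrals of
  each ramp form a constant sequence, and continuity hands the value to \<open>Q\<close>.\<close>

lemma limit_increment_distributed:
  assumes st: "0 \<le> s" "s < t"
  shows "distributed Q lborel (\<lambda>x. B t x - B s x) (normal_density 0 (sqrt (t - s)))"
proof -
  let ?D = "\<lambda>x. B t x - B s x" and ?N = "density lborel (normal_density 0 (sqrt (t - s)))"
  have D [measurable]: "?D \<in> borel_measurable (canonical_borel m)"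
    using st by (intro borel_measurable_diff measurable_B) auto
  have "distr Q borel ?D = ?N"
  proof (rule ramp_determines_distribution)
    show "prob_space (distr Q borel ?D)" using prob_Q by (rule prob_space.prob_space_distr) simp
    show "prob_space ?N" using st by (intro prob_space_normal_density) auto
    fix a k
    let ?f = "\<lambda>x. ramp a (1 / real (Suc k)) (?D x)"
    have 1: "(\<lambda>n. \<integral>x. ?f x \<partial>P n) \<longlonglongrightarrow> (\<integral>x. ?f x \<partial>Q)"
      using st by (intro integral_limit[where b = 1])
        (auto simp: ramp_bounds intro!: tendsto_ramp tendsto_diff B_limit)
    have 2: "(\<integral>x. ?f x \<partial>P n) = (\<integral>y. ramp a (1 / real (Suc k)) y \<partial>?N)" for n
    proof -
      interpret E: embedding m "P n" using X_embedding by (rule embeddingI)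
      have "(\<integral>x. ?f x \<partial>P n) = (\<integral>y. ramp a (1 / real (Suc k)) y \<partial>distr (P n) lborel ?D)"
        by (subst integral_distr) auto
      then show ?thesis
        unfolding distributed_distr_eq_density[OF E.increment_distributed[OF st]] .
    qed
    have "(\<integral>x. ?f x \<partial>Q) = (\<integral>y. ramp a (1 / real (Suc k)) y \<partial>?N)"
      using 1 unfolding 2 by (rule LIMSEQ_const_iff[THEN iffD1, symmetric])
    then show "(\<integral>y. ramp a (1 / real (Suc k)) y \<partial>distr Q borel ?D) = (\<integral>y. ramp a (1 / real (Suc k)) y \<partial>?N)"
      by (subst integral_distr) auto
  qed auto
  moreover have "distr Q borel ?D = distr Q lborel ?D" by (rule distr_cong) auto
  ultimately show ?thesis by (simp add: distributed_def)
qed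

end

section \<open>Cylinder events generating the filtration\<close>

fun coordinate :: "real + nat \<Rightarrow> (real \<Rightarrow> real) \<times> (nat \<Rightarrow> real) \<Rightarrow> real" where
  "coordinate (Inl r) x = B r x"
| "coordinate (Inr i) x = T i x"

lemma coordinate_eq: "coordinate (Inl r) = B r" "coordinate (Inr i) = T i"
  by auto

text \<open>The threshold is restricted only for stopping times: a value of the path is fully known
  at time \<open>s\<close>, whereas a stopping time can only be compared with levels up to
  \<open>s\<close>.\<close>

fun observable :: "nat \<Rightarrow> real \<Rightarrow> (real + nat) \<times> real \<Rightarrow> bool" where
  "observable m s (Inl r, a) \<longleftrightarrow> 0 \<le> r \<and> r \<le> s"
| "observable m s (Inr i, a) \<longleftrightarrow> i \<in> {1..m} \<and> a \<le> s"

lemma coordinate_measurable: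
  "observable m s (c, a) \<Longrightarrow> coordinate c \<in> borel_measurable (canonical_borel m)"
  by (cases c) (auto simp: coordinate_eq measurable_B measurable_T)

text \<open>Up to time \<open>s\<close> the filtration does not see \<open>T\<^sub>i\<close> itself but only the events \<open>T\<^sub>i \<le> r\<close> with
  \<open>r \<le> s\<close>; the ramp is constant beyond \<open>a + \<delta>\<close>.\<close>

lemma ramp_T_measurable:
  assumes i: "i \<in> {1..m}" and a: "a + \<delta> \<le> s" and \<delta>: "\<delta> > 0"
  shows "(\<lambda>x. ramp a \<delta> (T i x)) \<in> borel_measurable (canonical_filtration m s)"
  unfolding borel_measurable_iff_ge
proof
  fix y :: real
  consider "y \<le> 0" | "0 < y" "y \<le> 1" | "1 < y" by linarith
  then show "{x \<in> space (canonical_filtration m s). y \<le> ramp a \<delta> (T i x)} \<in> sets (canonical_filtration m s)"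
  proof cases
    case 1
    then have "{x \<in> space (canonical_filtration m s). y \<le> ramp a \<delta> (T i x)} = space (canonical_filtration m s)"
      using ramp_bounds(1) order_trans by blast
    then show ?thesis by (metis sets.top)
  next
    case 2
    \<comment> \<open>For levels strictly above 0 a superlevel set of the ramp is an event that the
      time lies below some value at most a + \<delta>, hence visible at \<open>s\<close>.\<close>
    then have "y \<le> ramp a \<delta> z \<longleftrightarrow> z \<le> a + \<delta> * (1 - y)" for z
      using \<delta> by (auto simp: ramp_def le_max_iff_disj field_simps)
    moreover have "a + \<delta> * (1 - y) \<le> s" using 2 \<delta> a by (smt (verit) mult_left_le)
    ultimately show ?thesis using i by (simp add: T_stopping)
  next
    case 3
    then have "{x \<in> space (canonical_filtration m s). y \<le> ramp a \<delta> (T i x)} = {}"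
      using ramp_bounds(2) by (auto simp: not_le intro: le_less_trans)
    then show ?thesis by (metis sets.empty_sets)
  qed
qed

lemma ramp_coordinate_measurable:
  assumes "observable m s (c, a)" "s + \<delta> \<le> u" "\<delta> > 0"
  shows "(\<lambda>x. ramp a \<delta> (coordinate c x)) \<in> borel_measurable (canonical_filtration m u)"
proof (cases c)
  case (Inl r)
  then have "B r \<in> borel_measurable (canonical_filtration m u)" using assms by (intro B_adapted) auto
  then show ?thesis using Inl by simp
next
  case (Inr i)
  then show ?thesis using assms ramp_T_measurable[of i m a \<delta> u] by simp
qed

definition coordinate_cylinder :: "nat \<Rightarrow> ((real + nat) \<times> real) set \<Rightarrow> ((real \<Rightarrow> real) \<times> (nat \<Rightarrow> real)) set" where
  "coordinate_cylinder m I = {x \<in> canonical_space m. \<forall>(c, a)\<in>I. coordinate c x \<le> a}"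

text \<open>Finite intersections of half-line events, instead of the original generators: they are
  stable under intersection, so independence has to be checked on them only.\<close>

definition observable_cylinders :: "nat \<Rightarrow> real \<Rightarrow> ((real \<Rightarrow> real) \<times> (nat \<Rightarrow> real)) set set" where
  "observable_cylinders m s = {coordinate_cylinder m I | I. finite I \<and> (\<forall>p\<in>I. observable m s p)}"

lemma observable_cylinders_measurable: "observable_cylinders m s \<subseteq> sets (canonical_borel m)"
proof
  fix A assume "A \<in> observable_cylinders m s"
  then obtain I where I: "finite I" "\<And>p. p \<in> I \<Longrightarrow> observable m s p" and A: "A = coordinate_cylinder m I"
    by (auto simp: observable_cylinders_def)
  have "Measurable.pred (canonical_borel m) (\<lambda>x. \<forall>p\<in>I. coordinate (fst p) x \<le> snd p)"
  proof (rule measurable_pred_countable)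
    fix p assume "p \<in> I"
    then have [measurable]: "coordinate (fst p) \<in> borel_measurable (canonical_borel m)"
      using I(2)[of p] by (cases p) (auto intro: coordinate_measurable)
    show "Measurable.pred (canonical_borel m) (\<lambda>x. coordinate (fst p) x \<le> snd p)" by measurable
  qed (simp add: I countable_finite)
  then have "{x \<in> space (canonical_borel m). \<forall>p\<in>I. coordinate (fst p) x \<le> snd p} \<in> sets (canonical_borel m)"
    by measurable
  moreover have "A = {x \<in> space (canonical_borel m). \<forall>p\<in>I. coordinate (fst p) x \<le> snd p}"
    unfolding space_canonical_borel A coordinate_cylinder_def by (auto simp: split_beta)
  ultimately show "A \<in> sets (canonical_borel m)" by simp
qed

lemma observable_cylinders_Int_stable: "Int_stable (observable_cylinders m s)"
  unfolding Int_stable_def observable_cylinders_def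
proof clarify
  fix I J assume *: "finite I" "\<forall>p\<in>I. observable m s p" "finite J" "\<forall>p\<in>J. observable m s p"
  have "coordinate_cylinder m I \<inter> coordinate_cylinder m J = coordinate_cylinder m (I \<union> J)"
    by (auto simp: coordinate_cylinder_def)
  then show "\<exists>L. coordinate_cylinder m I \<inter> coordinate_cylinder m J = coordinate_cylinder m L
      \<and> finite L \<and> (\<forall>p\<in>L. observable m s p)"
    using * by (intro exI[of _ "I \<union> J"]) auto
qed

lemma filtration_subset_cylinders:
  "sets (canonical_filtration m s) \<subseteq> sigma_sets (canonical_space m) (observable_cylinders m s)"
proof -
  have sub: "observable_cylinders m s \<subseteq> Pow (canonical_space m)"
    by (auto simp: observable_cylinders_def coordinate_cylinder_def)
  define N where "N = sigma (canonical_space m) (observable_cylinders m s)"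
  have N: "space N = canonical_space m" "sets N = sigma_sets (canonical_space m) (observable_cylinders m s)"
    unfolding N_def using sub by (auto simp: space_measure_of sets_measure_of)
  have half: "{x \<in> canonical_space m. coordinate c x \<le> a} \<in> sets N" if "observable m s (c, a)" for c a
  proof -
    have "{x \<in> canonical_space m. coordinate c x \<le> a} = coordinate_cylinder m {(c, a)}"
      by (auto simp: coordinate_cylinder_def)
    then show ?thesis unfolding N observable_cylinders_def using that
      by (intro sigma_sets.Basic) (auto intro!: exI[of _ "{(c, a)}"])
  qed
  have "C \<in> sets N" if "C \<in> filtration_generator m s" for C
  proof -
    from that consider r A where "C = {x \<in> canonical_space m. B r x \<in> A}" "0 \<le> r" "r \<le> s" "A \<in> sets borel"
      | i r where "C = {x \<in> canonical_space m. T i x \<le> r}" "r \<le> s" "i \<in> {1..m}"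
      unfolding filtration_generator_def by blast
    then show ?thesis
    proof cases
      case 1
      have "B r \<in> borel_measurable N"
        unfolding borel_measurable_iff_le using 1 half[of "Inl r"] by (simp add: N)
      then show ?thesis using 1 measurable_sets[of "B r" N borel A] by (simp add: vimage_def Int_def N conj_commute)
    next
      case 2
      then show ?thesis using half[of "Inr i" r] by simp
    qed
  qed
  then have "sigma_sets (space N) (filtration_generator m s) \<subseteq> sets N"
    by (intro sets.sigma_sets_subset) auto
  then show ?thesis unfolding sets_filtration N .
qed

section \<open>Independence and uniform integrability in the limit\<close>

context canonical_limit
begin

text \<open>The ramps in \<open>G\<close> see the times up to s + \<delta>, so \<open>G\<close> is
  known at s + \<delta> and the increment is started there. The product rule then holds exactly for
  every \<open>P n\<close>, and all three integrands are bounded and continuous along the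
  sequence.\<close>

lemma limit_ramp_indep:
  fixes b :: real
  assumes st: "0 \<le> s" "s < t" and \<delta>: "\<delta> > 0" "s + \<delta> < t" and \<eta>: "\<eta> > 0"
    and I: "finite I" "\<And>p. p \<in> I \<Longrightarrow> observable m s p"
  defines "G \<equiv> \<lambda>x. \<Prod>(c, a)\<in>I. ramp a \<delta> (coordinate c x)"
    and "f \<equiv> \<lambda>x. ramp b \<eta> (B t x - B (s + \<delta>) x)"
  shows "(\<integral>x. G x * f x \<partial>Q) = (\<integral>x. G x \<partial>Q) * (\<integral>x. f x \<partial>Q)"
proof -
  have GF: "G \<in> borel_measurable (canonical_filtration m (s + \<delta>))"
    unfolding G_def using I \<delta>
    by (intro borel_measurable_prod) (auto intro!: ramp_coordinate_measurable)
  have G [measurable]: "G \<in> borel_measurable (canonical_borel m)"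
    unfolding G_def using I
    by (intro borel_measurable_prod) (auto intro!: measurable_compose[OF coordinate_measurable ramp_measurable])
  have [measurable]: "B t \<in> borel_measurable (canonical_borel m)" "B (s + \<delta>) \<in> borel_measurable (canonical_borel m)"
    using st \<delta> by (auto intro: measurable_B)
  have f [measurable]: "f \<in> borel_measurable (canonical_borel m)"
    unfolding f_def by measurable
  have Gb: "\<bar>G x\<bar> \<le> 1" for x
    unfolding G_def abs_prod by (intro prod_le_1) (auto simp: ramp_bounds split: prod.split)
  have fb: "\<bar>f x\<bar> \<le> 1" for x by (simp add: f_def ramp_bounds)
  have GL: "(\<lambda>n. G (X n z)) \<longlonglongrightarrow> G (Y z)" if z: "z \<in> space \<Omega>" for z
    unfolding G_def
  proof (intro tendsto_prod)
    fix p assume p: "p \<in> I"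
    obtain c a where ca: "p = (c, a)" by (cases p)
    have "(\<lambda>n. coordinate c (X n z)) \<longlonglongrightarrow> coordinate c (Y z)"
      using I(2)[OF p] z unfolding ca by (cases c) (auto intro: B_limit T_limit)
    then show "(\<lambda>n. case p of (c, a) \<Rightarrow> ramp a \<delta> (coordinate c (X n z)))
       \<longlonglongrightarrow> (case p of (c, a) \<Rightarrow> ramp a \<delta> (coordinate c (Y z)))"
      unfolding ca using \<delta>(1) by (auto intro: tendsto_ramp)
  qed
  have fL: "(\<lambda>n. f (X n z)) \<longlonglongrightarrow> f (Y z)" if z: "z \<in> space \<Omega>" for z
    unfolding f_def using z st \<delta> \<eta> by (intro tendsto_ramp tendsto_diff B_limit) auto
  have "(\<integral>x. G x * f x \<partial>P n) = (\<integral>x. G x \<partial>P n) * (\<integral>x. f x \<partial>P n)" for n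
  proof -
    interpret E: embedding m "P n" using X_embedding by (rule embeddingI)
    have "E.indep_var borel G borel (\<lambda>x. B t x - B (s + \<delta>) x)"
      using st \<delta> GF by (intro E.increment_indep) auto
    then have "E.indep_var borel (id \<circ> G) borel (ramp b \<eta> \<circ> (\<lambda>x. B t x - B (s + \<delta>) x))"
      by (rule E.indep_var_compose) auto
    then have "E.indep_var borel G borel f" by (simp add: f_def comp_def)
    then show ?thesis
      by (rule E.indep_var_lebesgue_integral)
        (use Gb fb in \<open>auto intro!: E.integrable_const_bound[where B = 1]\<close>)
  qed
  moreover have "(\<lambda>n. \<integral>x. G x * f x \<partial>P n) \<longlonglongrightarrow> (\<integral>x. G x * f x \<partial>Q)"
    using Gb fb GL fL by (intro integral_limit[where b = 1])
      (auto simp: abs_mult intro!: mult_le_one tendsto_mult)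
  moreover have "(\<lambda>n. (\<integral>x. G x \<partial>P n) * (\<integral>x. f x \<partial>P n)) \<longlonglongrightarrow> (\<integral>x. G x \<partial>Q) * (\<integral>x. f x \<partial>Q)"
    using Gb fb GL fL by (intro tendsto_mult integral_limit[where b = 1]) auto
  ultimately show ?thesis by (auto intro: LIMSEQ_unique)
qed

text \<open>Two limits are taken in order. With \<eta> fixed, \<delta> tends to 0: \<open>G\<close>
  becomes the indicator of the cylinder and path continuity moves the start of the increment back to
  \<open>s\<close>, which the continuous ramp of width \<eta> tolerates. Only then does \<eta> tend
  to 0, making that ramp an indicator.\<close>

lemma limit_cylinder_indep:
  assumes st: "0 \<le> s" "s < t" and A: "A \<in> observable_cylinders m s"
  shows "measure Q (A \<inter> {x \<in> space Q. B t x - B s x \<le> b})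
    = measure Q A * measure Q {x \<in> space Q. B t x - B s x \<le> b}"
proof -
  interpret Q: prob_space Q by (rule prob_Q)
  obtain I where I: "finite I" "\<And>p. p \<in> I \<Longrightarrow> observable m s p" and A_eq: "A = coordinate_cylinder m I"
    using A by (auto simp: observable_cylinders_def)
  define \<delta> where "\<delta> k = 1 / real (Suc k)" for k
  have \<delta>: "\<delta> k > 0" for k by (simp add: \<delta>_def)
  have \<delta>0: "\<delta> \<longlonglongrightarrow> 0" unfolding \<delta>_def by (rule LIMSEQ_inverse_real_of_nat[unfolded inverse_eq_divide])
  define G where "G d x = (\<Prod>(c, a)\<in>I. ramp a d (coordinate c x))" for d x
  define f where "f \<eta> d x = ramp b \<eta> (B t x - B (s + d) x)" for \<eta> d x
  have G [measurable]: "G d \<in> borel_measurable (canonical_borel m)" for d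
    unfolding G_def using I
    by (intro borel_measurable_prod) (auto intro!: measurable_compose[OF coordinate_measurable ramp_measurable])
  have f [measurable]: "f \<eta> d \<in> borel_measurable (canonical_borel m)" if "d \<ge> 0" for \<eta> d
  proof -
    have [measurable]: "B t \<in> borel_measurable (canonical_borel m)" "B (s + d) \<in> borel_measurable (canonical_borel m)"
      using st that by (auto intro: measurable_B)
    show ?thesis unfolding f_def by measurable
  qed
  have Gb: "\<bar>G d x\<bar> \<le> 1" for d x
    unfolding G_def abs_prod by (intro prod_le_1) (auto simp: ramp_bounds split: prod.split)
  have fb: "\<bar>f \<eta> d x\<bar> \<le> 1" for \<eta> d x by (simp add: f_def ramp_bounds)
  have A_meas [measurable]: "A \<in> sets (canonical_borel m)"
    using A observable_cylinders_measurable by blast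
  have GA: "(\<lambda>k. G (\<delta> k) x) \<longlonglongrightarrow> indicator A x" if x: "x \<in> space Q" for x
  proof -
    have "(\<lambda>k. G (\<delta> k) x) \<longlonglongrightarrow> (\<Prod>(c, a)\<in>I. indicator {..a} (coordinate c x))"
      unfolding G_def \<delta>_def
      by (intro tendsto_prod) (auto simp del: of_nat_Suc intro: ramp_tendsto_indicator)
    also have "(\<Prod>(c, a)\<in>I. indicator {..a} (coordinate c x)) = (indicator A x :: real)"
    proof (cases "x \<in> A")
      case True
      then have "(\<Prod>(c, a)\<in>I. indicator {..a} (coordinate c x)) = (\<Prod>p\<in>I. 1 :: real)"
        unfolding A_eq coordinate_cylinder_def by (intro prod.cong) auto
      then show ?thesis using True by simp
    next
      case False
      then obtain c a where "(c, a) \<in> I" "\<not> coordinate c x \<le> a"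
        using x unfolding A_eq coordinate_cylinder_def space_Q by blast
      then have "(\<Prod>(c, a)\<in>I. indicator {..a} (coordinate c x)) = (0 :: real)"
        using I(1) by (intro prod_zero) (auto intro!: bexI[of _ "(c, a)"])
      then show ?thesis using False by simp
    qed
    finally show ?thesis .
  qed
  have fD: "(\<lambda>k. f \<eta> (\<delta> k) x) \<longlonglongrightarrow> f \<eta> 0 x" if x: "x \<in> space Q" and \<eta>: "\<eta> > 0" for x \<eta>
  proof -
    have sd: "(\<lambda>k. s + \<delta> k) \<longlonglongrightarrow> s + 0" by (intro tendsto_intros \<delta>0)
    have "(\<lambda>k. B (s + \<delta> k) x) \<longlonglongrightarrow> B (s + 0) x"
    proof (rule continuous_on_tendsto_compose[of "{0..}" "\<lambda>t. B t x", OF _ sd])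
      show "continuous_on {0..} (\<lambda>t. B t x)" using x unfolding space_Q by (rule canonical_spaceD(1))
      show "\<forall>\<^sub>F k in sequentially. s + \<delta> k \<in> {0..}"
        using st less_imp_le[OF \<delta>] by (intro always_eventually) simp
    qed (use st in auto)
    then show ?thesis unfolding f_def using \<eta> by (intro tendsto_ramp tendsto_intros) auto
  qed
  have step: "(\<integral>x. indicator A x * f \<eta> 0 x \<partial>Q) = measure Q A * (\<integral>x. f \<eta> 0 x \<partial>Q)" if \<eta>: "\<eta> > 0" for \<eta>
  proof -
    have l1: "(\<lambda>k. \<integral>x. G (\<delta> k) x * f \<eta> (\<delta> k) x \<partial>Q) \<longlonglongrightarrow> (\<integral>x. indicator A x * f \<eta> 0 x \<partial>Q)"
      using Gb fb GA fD[OF _ \<eta>] f less_imp_le[OF \<delta>]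
      by (intro Q.integral_bounded_limit[where b = 1])
        (auto simp: abs_mult intro!: mult_le_one tendsto_mult borel_measurable_times)
    \<comment> \<open>Only eventually, because \<open>limit_ramp_indep\<close> requires s + \<delta>
      < t.\<close>
    have l2: "\<forall>\<^sub>F k in sequentially. (\<integral>x. G (\<delta> k) x * f \<eta> (\<delta> k) x \<partial>Q) = (\<integral>x. G (\<delta> k) x \<partial>Q) * (\<integral>x. f \<eta> (\<delta> k) x \<partial>Q)"
      using order_tendstoD(2)[OF \<delta>0, of "t - s"] st
      unfolding G_def f_def
      by (auto elim!: eventually_mono intro!: limit_ramp_indep[OF st \<delta> _ \<eta> I])
    have l3: "(\<lambda>k. (\<integral>x. G (\<delta> k) x \<partial>Q) * (\<integral>x. f \<eta> (\<delta> k) x \<partial>Q)) \<longlonglongrightarrow> (\<integral>x. indicator A x \<partial>Q) * (\<integral>x. f \<eta> 0 x \<partial>Q)"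
      using Gb fb GA fD[OF _ \<eta>] f less_imp_le[OF \<delta>]
      by (intro tendsto_mult Q.integral_bounded_limit[where b = 1]) auto
    have "(\<integral>x. indicator A x * f \<eta> 0 x \<partial>Q) = (\<integral>x. indicator A x \<partial>Q) * (\<integral>x. f \<eta> 0 x \<partial>Q)"
      by (rule LIMSEQ_unique[OF Lim_transform_eventually[OF l1 l2] l3])
    then show ?thesis using A_meas sets.sets_into_space[OF A_meas] by (simp add: Int_absorb2)
  qed
  define D where "D = {x \<in> space Q. B t x - B s x \<le> b}"
  have [measurable]: "B t \<in> borel_measurable (canonical_borel m)" "B s \<in> borel_measurable (canonical_borel m)"
    using st by (auto intro: measurable_B)
  have D_meas: "D \<in> sets Q" unfolding D_def by measurable
  have fI: "(\<lambda>k. f (\<delta> k) 0 x) \<longlonglongrightarrow> indicator D x" if "x \<in> space Q" for x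
    using ramp_tendsto_indicator[of b "B t x - B s x"] that
    by (simp add: f_def \<delta>_def D_def indicator_def)
  \<comment> \<open>The second limit: the shift is 0 now, and \<delta> k serves as the width
    \<eta>.\<close>
  have "(\<lambda>k. \<integral>x. indicator A x * f (\<delta> k) 0 x \<partial>Q) \<longlonglongrightarrow> (\<integral>x. indicator A x * indicator D x \<partial>Q)"
  proof (rule Q.integral_bounded_limit[where b = 1])
    show "(\<lambda>x. indicator A x * f (\<delta> k) 0 x) \<in> borel_measurable Q"
      "(\<lambda>x. indicator A x * indicator D x :: real) \<in> borel_measurable Q" for k
      using A_meas D_meas f[of 0 "\<delta> k"] by (auto intro!: borel_measurable_times)
    show "(\<lambda>k. indicator A x * f (\<delta> k) 0 x) \<longlonglongrightarrow> indicator A x * indicator D x" if "x \<in> space Q" for x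
      using that by (intro tendsto_mult tendsto_const fI)
    show "\<bar>indicator A x * f (\<delta> k) 0 x\<bar> \<le> 1" for k x
      using fb by (simp add: indicator_def)
  qed
  moreover have "(\<lambda>k. measure Q A * (\<integral>x. f (\<delta> k) 0 x \<partial>Q)) \<longlonglongrightarrow> measure Q A * (\<integral>x. indicator D x \<partial>Q)"
    using fb fI f D_meas by (intro tendsto_mult tendsto_const Q.integral_bounded_limit[where b = 1]) auto
  ultimately have "(\<integral>x. indicator A x * indicator D x \<partial>Q) = measure Q A * (\<integral>x. indicator D x \<partial>Q)"
    unfolding step[OF \<delta>] by (rule LIMSEQ_unique)
  moreover have "(\<integral>x. indicator A x * indicator D x \<partial>Q) = measure Q (A \<inter> D)"
    using A_meas D_meas sets.sets_into_space[OF D_meas] by (simp flip: indicator_inter_arith add: Int_absorb2 Int_assoc)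
  moreover have "(\<integral>x. indicator D x \<partial>Q) = measure Q D"
    using sets.sets_into_space[OF D_meas] by (simp add: Int_absorb2)
  ultimately show ?thesis unfolding D_def by simp
qed

lemma limit_brownian_motion: "brownian_motion Q (canonical_filtration m) B"
  unfolding brownian_motion_def
proof (intro conjI allI impI ballI)
  interpret Q: prob_space Q by (rule prob_Q)
  interpret E: embedding m "P 0" using X_embedding by (rule embeddingI)
  show "B t \<in> borel_measurable (canonical_filtration m t)" if "0 \<le> t" for t
    using that by (intro B_adapted) auto
  show "B 0 x = 0" "continuous_on {0..} (\<lambda>t. B t x)" if "x \<in> space Q" for x
    using that unfolding space_Q by (auto intro: canonical_spaceD)
  fix s t :: real assume "0 \<le> s \<and> s < t"
  then have st: "0 \<le> s" "s < t" by auto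
  show "distributed Q lborel (\<lambda>x. B t x - B s x) (normal_density 0 (sqrt (t - s)))"
    by (rule limit_increment_distributed[OF st])
  let ?D = "\<lambda>x. B t x - B s x"
  have D [measurable]: "?D \<in> borel_measurable (canonical_borel m)"
    using st by (intro borel_measurable_diff measurable_B) auto
  \<comment> \<open>Half-lines form an intersection-stable generator on the side of the increment,
    so independence extends from cylinders and half-lines to the generated sigma-algebras.\<close>
  let ?E = "{?D -` A \<inter> space Q | A. A \<in> range atMost}"
  have cyl: "observable_cylinders m s \<subseteq> Q.events" using observable_cylinders_measurable by simp
  have "Q.indep_set (observable_cylinders m s) ?E"
  proof (rule Q.indep_setI[OF cyl])
    show "?E \<subseteq> Q.events" by (auto intro: measurable_sets[OF D, unfolded space_borel_of])
    fix a b assume a: "a \<in> observable_cylinders m s" and "b \<in> ?E"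
    then obtain c where "b = {x \<in> space Q. B t x - B s x \<le> c}" by auto
    then show "Q.prob (a \<inter> b) = Q.prob a * Q.prob b" using limit_cylinder_indep[OF st a] by simp
  qed
  moreover have "Int_stable ?E"
    unfolding Int_stable_def
  proof clarify
    fix a b :: real
    have "(?D -` {..a} \<inter> space Q) \<inter> (?D -` {..b} \<inter> space Q) = ?D -` {..min a b} \<inter> space Q" by auto
    then show "\<exists>A. ?D -` {..a} \<inter> space Q \<inter> (?D -` {..b} \<inter> space Q) = ?D -` A \<inter> space Q \<and> A \<in> range atMost"
      by blast
  qed
  ultimately have ind: "Q.indep_set (sigma_sets (space Q) (observable_cylinders m s)) (sigma_sets (space Q) ?E)"
    using observable_cylinders_Int_stable by (intro Q.indep_set_sigma_sets)
  have E_eq: "sigma_sets (space Q) ?E = sets (vimage_algebra (space Q) ?D borel)"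
  proof -
    have "sets (borel :: real measure) = sigma_sets UNIV (range atMost)"
      by (subst borel_eq_atMost) (simp add: sets_measure_of)
    then have "sigma_sets (space Q) ?E = {?D -` A \<inter> space Q | A. A \<in> sets borel}"
      using sigma_sets_vimage_commute[of ?D "space Q" UNIV "range atMost"] by simp
    then show ?thesis by (simp add: sets_vimage_algebra2)
  qed
  have F_sub: "sets (canonical_filtration m s) \<subseteq> sigma_sets (space Q) (observable_cylinders m s)"
    unfolding space_Q by (rule filtration_subset_cylinders)
  note ind' = ind[unfolded E_eq Q.indep_sets2_eq]
  show "Q.indep_set (sets (canonical_filtration m s)) (sets (vimage_algebra (space Q) ?D borel))"
  proof (rule Q.indep_setI)
    show "sets (canonical_filtration m s) \<subseteq> Q.events"
      using F_sub ind'[THEN conjunct1] by (rule subset_trans)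
    show "sets (vimage_algebra (space Q) ?D borel) \<subseteq> Q.events"
      using ind'[THEN conjunct2, THEN conjunct1] .
    show "Q.prob (a \<inter> b) = Q.prob a * Q.prob b"
      if "a \<in> sets (canonical_filtration m s)" "b \<in> sets (vimage_algebra (space Q) ?D borel)" for a b
      using ind'[THEN conjunct2, THEN conjunct2, THEN bspec, OF subsetD[OF F_sub that(1)], THEN bspec, OF that(2)] .
  qed
qed

text \<open>The hypothesis concerns terminal values only. Convexity of the call and the put gives
  the same bound for the stopped values at every \<open>t\<close>, so the resulting level
  \<open>c\<close> works for all times at once.\<close>

lemma limit_uniformly_integrable:
  assumes tail: "\<And>e. e > 0 \<Longrightarrow> \<exists>k l. \<forall>\<^sub>F n in sequentially.
    (\<integral>x. max 0 (B (T m x) x - k) \<partial>P n) + (\<integral>x. max 0 (l - B (T m x) x) \<partial>P n) \<le> e"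
  shows "uniformly_integrable Q {0..} (\<lambda>t x. B (min (T m x) t) x)"
  unfolding uniformly_integrable_def
proof (intro conjI allI impI ballI)
  have mm: "m \<in> {1..m}" using m by simp
  show "(\<lambda>x. B (min (T m x) t) x) \<in> borel_measurable Q" if "t \<in> {0..}" for t
    using measurable_B_min_T[OF mm, of t] that by simp
  fix e :: real assume e: "e > 0"
  then obtain k l where kl: "\<forall>\<^sub>F n in sequentially.
      (\<integral>x. max 0 (B (T m x) x - k) \<partial>P n) + (\<integral>x. max 0 (l - B (T m x) x) \<partial>P n) \<le> e / 2"
    using tail[of "e / 2"] by auto
  define \<psi> where "\<psi> y = max 0 (y - k) + max 0 (l - y)" for y :: real
  have \<psi>0: "\<psi> y \<ge> 0" for y by (simp add: \<psi>_def)
  have [measurable]: "\<psi> \<in> borel_measurable borel" unfolding \<psi>_def by measurable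
  \<comment> \<open>If |y| is at least twice both |k| and |l|, then y - k or l - y is at least
    |y|/2. The resulting factor 2 is paid for by the tolerance e/2.\<close>
  define c where "c = 2 * max \<bar>k\<bar> \<bar>l\<bar>"
  have c: "\<bar>y\<bar> \<le> 2 * \<psi> y" if "c \<le> \<bar>y\<bar>" for y
    using that unfolding c_def \<psi>_def by (auto simp: max_def abs_if split: if_splits)
  have "(\<integral>\<^sup>+x. ennreal \<bar>B (min (T m x) t) x\<bar> * indicator {x. c \<le> \<bar>B (min (T m x) t) x\<bar>} x \<partial>Q) \<le> ennreal e"
    if t: "t \<in> {0..}" for t
  proof -
    let ?S = "\<lambda>x. B (min (T m x) t) x"
    have S [measurable]: "?S \<in> borel_measurable (canonical_borel m)"
      using t by (intro measurable_B_min_T mm) auto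
    have "(\<integral>\<^sup>+x. ennreal \<bar>?S x\<bar> * indicator {x. c \<le> \<bar>?S x\<bar>} x \<partial>Q) \<le> (\<integral>\<^sup>+x. 2 * ennreal (\<psi> (?S x)) \<partial>Q)"
    proof (rule nn_integral_mono)
      fix x
      have "ennreal \<bar>?S x\<bar> \<le> ennreal (2 * \<psi> (?S x))" if "c \<le> \<bar>?S x\<bar>"
        using c[OF that] by (rule ennreal_leI)
      then show "ennreal \<bar>?S x\<bar> * indicator {x. c \<le> \<bar>?S x\<bar>} x \<le> 2 * ennreal (\<psi> (?S x))"
        using \<psi>0 by (auto simp: indicator_def ennreal_mult)
    qed
    also have "\<dots> = 2 * (\<integral>\<^sup>+x. ennreal (\<psi> (?S x)) \<partial>Q)" by (rule nn_integral_cmult) simp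
    also have "(\<integral>\<^sup>+x. ennreal (\<psi> (?S x)) \<partial>Q) = (\<integral>\<^sup>+z. ennreal (\<psi> (?S (Y z))) \<partial>\<Omega>)"
      by (rule nn_integral_distr[OF Y]) simp
    also have "\<dots> = (\<integral>\<^sup>+z. liminf (\<lambda>n. ennreal (\<psi> (?S (X n z)))) \<partial>\<Omega>)"
    proof (rule nn_integral_cong)
      fix z assume z: "z \<in> space \<Omega>"
      have "(\<lambda>n. ennreal (\<psi> (?S (X n z)))) \<longlonglongrightarrow> ennreal (\<psi> (?S (Y z)))"
        unfolding \<psi>_def using z t mm by (intro tendsto_ennrealI tendsto_intros B_min_T_limit) auto
      then show "ennreal (\<psi> (?S (Y z))) = liminf (\<lambda>n. ennreal (\<psi> (?S (X n z))))"
        by (simp add: lim_imp_Liminf)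
    qed
    also have "\<dots> \<le> liminf (\<lambda>n. \<integral>\<^sup>+z. ennreal (\<psi> (?S (X n z))) \<partial>\<Omega>)"
    proof (rule nn_integral_liminf)
      show "(\<lambda>z. ennreal (\<psi> (?S (X n z)))) \<in> borel_measurable \<Omega>" for n
        using measurable_compose[OF X S, of n] by measurable
    qed
    also have "\<dots> \<le> ennreal (e / 2)"
    proof (rule Liminf_le)
      show "\<forall>\<^sub>F n in sequentially. (\<integral>\<^sup>+z. ennreal (\<psi> (?S (X n z))) \<partial>\<Omega>) \<le> ennreal (e / 2)"
        using kl
      proof (rule eventually_mono)
        fix n assume n: "(\<integral>x. max 0 (B (T m x) x - k) \<partial>P n) + (\<integral>x. max 0 (l - B (T m x) x) \<partial>P n) \<le> e / 2"
        interpret E: embedding m "P n" using X_embedding by (rule embeddingI)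
        have iS: "integrable (P n) ?S" using t by (intro E.stopped_integrable) auto
        have "(\<integral>\<^sup>+z. ennreal (\<psi> (?S (X n z))) \<partial>\<Omega>) = (\<integral>\<^sup>+x. ennreal (\<psi> (?S x)) \<partial>P n)"
          by (rule nn_integral_distr[OF X, symmetric]) simp
        also have "\<dots> = ennreal (\<integral>x. \<psi> (?S x) \<partial>P n)"
          using iS \<psi>0 unfolding \<psi>_def
          by (intro nn_integral_eq_integral Bochner_Integration.integrable_add integrable_max) auto
        also have "(\<integral>x. \<psi> (?S x) \<partial>P n) = (\<integral>x. max 0 (?S x - k) \<partial>P n) + (\<integral>x. max 0 (l - ?S x) \<partial>P n)"
          using iS unfolding \<psi>_def by (intro Bochner_Integration.integral_add integrable_max) auto
        also have "\<dots> \<le> (\<integral>x. max 0 (B (T m x) x - k) \<partial>P n) + (\<integral>x. max 0 (l - B (T m x) x) \<partial>P n)"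
          using t by (intro add_mono E.stopped_call_put_le m) auto
        also note n
        finally show "(\<integral>\<^sup>+z. ennreal (\<psi> (?S (X n z))) \<partial>\<Omega>) \<le> ennreal (e / 2)"
          by (simp add: ennreal_leI)
      qed
    qed simp
    also have "2 * ennreal (e / 2) = ennreal e"
      using e by (simp add: ennreal_mult'[symmetric] flip: ennreal_numeral)
    finally show ?thesis by (simp add: mult_left_mono)
  qed
  then show "\<exists>c. \<forall>t\<in>{0..}. (\<integral>\<^sup>+x. ennreal \<bar>B (min (T m x) t) x\<bar> * indicator {x. c \<le> \<bar>B (min (T m x) t) x\<bar>} x \<partial>Q) \<le> ennreal e"
    by blast
qed

lemma limit_embedding:
  assumes "\<And>e. e > 0 \<Longrightarrow> \<exists>k l. \<forall>\<^sub>F n in sequentially.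
    (\<integral>x. max 0 (B (T m x) x - k) \<partial>P n) + (\<integral>x. max 0 (l - B (T m x) x) \<partial>P n) \<le> e"
  shows "Q \<in> embeddings m"
  using prob_Q limit_brownian_motion limit_uniformly_integrable[OF assms] by (simp add: embeddings_def)

end

section \<open>Convergence of prices\<close>

text \<open>Expresses the extended integral through the nonnegative function b - f, to which Fatou's
  lemma applies. The positive part has integral at most \<open>b\<close>; if the negative part has
  infinite integral, both sides are -\<infinity>.\<close>

lemma ext_integral_bounded_above:
  assumes M: "prob_space M" and f: "f \<in> borel_measurable M" and b: "0 \<le> b" "\<And>x. x \<in> space M \<Longrightarrow> f x \<le> b"
  shows "ext_integral M f = ereal b - enn2ereal (\<integral>\<^sup>+x. ennreal (b - f x) \<partial>M)"
proof -
  interpret prob_space M by (rule M)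
  note [measurable] = f
  let ?N = "\<integral>\<^sup>+x. ennreal (b - f x) \<partial>M" and ?p = "\<integral>\<^sup>+x. ennreal (f x) \<partial>M" and ?n = "\<integral>\<^sup>+x. ennreal (- f x) \<partial>M"
  have "?N + ?p = (\<integral>\<^sup>+x. ennreal (b - f x) + ennreal (f x) \<partial>M)"
    by (rule nn_integral_add[symmetric]) auto
  also have "\<dots> = (\<integral>\<^sup>+x. ennreal b + ennreal (- f x) \<partial>M)"
  proof (rule nn_integral_cong)
    fix x assume x: "x \<in> space M"
    show "ennreal (b - f x) + ennreal (f x) = ennreal b + ennreal (- f x)"
    proof (cases "0 \<le> f x")
      case True
      then show ?thesis using b(2)[OF x] by (simp add: ennreal_neg flip: ennreal_plus)
    next
      case False
      then show ?thesis using b(1) by (simp add: ennreal_neg flip: ennreal_plus)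
    qed
  qed
  also have "\<dots> = ennreal b + ?n" by (subst nn_integral_add) (auto simp: emeasure_space_1)
  finally have eq: "?N + ?p = ennreal b + ?n" .
  have "?p \<le> (\<integral>\<^sup>+x. ennreal b \<partial>M)" using b(2) by (intro nn_integral_mono ennreal_leI) auto
  also have "\<dots> = ennreal b" by (simp add: emeasure_space_1)
  finally have "?p < \<top>" by (simp add: le_less_trans)
  then obtain p where p: "?p = ennreal p" "0 \<le> p" by (cases ?p) auto
  show ?thesis
  proof (cases ?n)
    case (real n)
    then have "?N + ennreal p = ennreal (b + n)" using eq p b by (simp add: ennreal_plus)
    then obtain N where N: "?N = ennreal N" "0 \<le> N" by (cases ?N) auto
    then have "ennreal (N + p) = ennreal (b + n)" using \<open>?N + ennreal p = _\<close> p by (simp add: ennreal_plus)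
    then have "N + p = b + n" using N p real b by (subst (asm) ennreal_inj) auto
    then show ?thesis
      unfolding ext_integral_def using N p real by (simp add: enn2ereal_ennreal)
  next
    case top
    then have "?N = \<top>" using eq p by (metis ennreal_add_eq_top ennreal_neq_top)
    then show ?thesis unfolding ext_integral_def using top p by (simp add: enn2ereal_ennreal)
  qed
qed

text \<open>Call spreads divided by the gap between their strikes approximate the indicator of x > a
  when both strikes decrease to \<open>a\<close>. Spreads rather than calls appear in the hypothesis
  because they are bounded, and so pass to limits of laws.\<close>

lemma calls_determine_distribution:
  fixes M N :: "real measure" and S :: "real set"
  assumes M: "prob_space M" "sets M = sets borel" and N: "prob_space N" "sets N = sets borel"
    and S: "\<And>a b. a < b \<Longrightarrow> \<exists>k\<in>S. a < k \<and> k < b"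
    and eq: "\<And>k k'. k \<in> S \<Longrightarrow> k' \<in> S \<Longrightarrow> k < k' \<Longrightarrow>
      (\<integral>x. max 0 (x - k) - max 0 (x - k') \<partial>M) = (\<integral>x. max 0 (x - k) - max 0 (x - k') \<partial>N)"
  shows "M = N"
proof (rule cdf_unique)
  show "real_distribution M" "real_distribution N"
    using M N by (auto simp: real_distribution_def real_distribution_axioms_def)
  show "cdf M = cdf N"
  proof
    fix a :: real
    \<comment> \<open>Both strikes lie strictly above \<open>a\<close>, so the quotient vanishes on
      x <= a; both are within 1/(j+1), so at each x > a it is eventually 1.\<close>
    have "\<exists>k k'. k \<in> S \<and> k' \<in> S \<and> a < k \<and> k < k' \<and> k' < a + 1 / real (Suc j)" for j
    proof -
      obtain k' where k': "k' \<in> S" "a < k'" "k' < a + 1 / real (Suc j)" using S[of a "a + 1 / real (Suc j)"] by auto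
      moreover obtain k where "k \<in> S" "a < k" "k < k'" using S[OF k'(2)] by auto
      ultimately show ?thesis by blast
    qed
    then obtain k k' where k: "\<And>j. k j \<in> S" "\<And>j. k' j \<in> S" "\<And>j. a < k j" "\<And>j. k j < k' j"
        "\<And>j. k' j < a + 1 / real (Suc j)"
      by metis
    define f where "f j x = (max 0 (x - k j) - max 0 (x - k' j)) / (k' j - k j)" for j x
    have [measurable]: "f j \<in> borel_measurable borel" for j unfolding f_def by measurable
    have fb: "\<bar>f j x\<bar> \<le> 1" for j x
    proof -
      have "0 \<le> max 0 (x - k j) - max 0 (x - k' j)" "max 0 (x - k j) - max 0 (x - k' j) \<le> k' j - k j"
        using k(4)[of j] by auto
      then have "0 \<le> f j x" "f j x \<le> 1" using k(4)[of j] by (auto simp: f_def divide_le_eq)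
      then show ?thesis by simp
    qed
    have f_lim: "(\<lambda>j. f j x) \<longlonglongrightarrow> indicator {a<..} x" for x
    proof (cases "x \<le> a")
      case True
      then have "f j x = 0" for j using k(3)[of j] k(4)[of j] by (auto simp: f_def max_def)
      then show ?thesis using True by simp
    next
      case False
      then obtain J where J: "1 / real (Suc J) < x - a" using nat_approx_posE[of "x - a"] by auto
      have "f j x = 1" if "j \<ge> J" for j
      proof -
        have "1 / real (Suc j) \<le> 1 / real (Suc J)" using that by (simp add: frac_le)
        then have "k' j < x" using k(5)[of j] J by linarith
        then show ?thesis using k(4)[of j] by (auto simp: f_def max_def)
      qed
      then have "\<forall>\<^sub>F j in sequentially. f j x = 1" by (auto simp: eventually_sequentially)
      then show ?thesis using False by (simp add: tendsto_eventually)
    qed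
    have tail: "(\<lambda>j. \<integral>x. f j x \<partial>L) \<longlonglongrightarrow> 1 - cdf L a" if L: "prob_space L" "sets L = sets borel" for L
    proof -
      interpret prob_space L by fact
      have [measurable_cong]: "sets L = sets borel" by fact
      have sp: "space L = UNIV" using sets_eq_imp_space_eq[OF L(2)] by simp
      have "(\<lambda>j. \<integral>x. f j x \<partial>L) \<longlonglongrightarrow> (\<integral>x. indicator {a<..} x \<partial>L)"
        by (rule integral_bounded_limit[where b = 1, OF _ _ f_lim fb]) auto
      moreover have "(\<integral>x. indicator {a<..} x \<partial>L) = 1 - measure L {..a}"
        using prob_compl[of "{..a}"] sp by (simp add: Compl_eq_Diff_UNIV[symmetric] Compl_atMost L(2))
      ultimately show ?thesis by (simp add: cdf_def)
    qed
    have "(\<integral>x. f j x \<partial>M) = (\<integral>x. f j x \<partial>N)" for j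
      unfolding f_def using eq[OF k(1) k(2) k(4)] by simp
    then have "1 - cdf M a = 1 - cdf N a"
      using tail[OF M] tail[OF N] by (simp add: LIMSEQ_unique)
    then show "cdf M a = cdf N a" by simp
  qed
qed

section \<open>Payoff, marginals and tails in the limit\<close>

context canonical_limit
begin

lemma limit_payoff:
  assumes \<Phi>: "\<Phi> \<in> borel_measurable (canonical_borel m)" "upper_semicontinuous (canonical_topology m) \<Phi>"
    and b: "\<And>x. x \<in> canonical_space m \<Longrightarrow> \<Phi> x \<le> b" and y: "\<And>n. ereal y \<le> ext_integral (P n) \<Phi>"
  shows "ereal y \<le> ext_integral Q \<Phi>"
proof -
  \<comment> \<open>\<open>ext_integral_bounded_above\<close> asks for a nonnegative upper
    bound.\<close>
  define c where "c = max 0 b"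
  have c: "0 \<le> c" "\<And>x. x \<in> canonical_space m \<Longrightarrow> \<Phi> x \<le> c" using b by (force simp: c_def)+
  let ?f = "\<lambda>x. ennreal (c - \<Phi> x)"
  have f: "?f \<in> borel_measurable (canonical_borel m)" using \<Phi>(1) by measurable
  have fPQ: "?f \<in> borel_measurable Q" "\<And>n. ?f \<in> borel_measurable (P n)" using f by simp_all
  have P_ext: "ext_integral (P n) \<Phi> = ereal c - enn2ereal (\<integral>\<^sup>+x. ?f x \<partial>P n)" for n
    using \<Phi>(1) c prob_space_distr[OF X] by (intro ext_integral_bounded_above) (auto simp: topspace_canonical_topology)
  have Q_ext: "ext_integral Q \<Phi> = ereal c - enn2ereal (\<integral>\<^sup>+x. ?f x \<partial>Q)"
    using \<Phi>(1) c prob_Q by (intro ext_integral_bounded_above) (auto simp: topspace_canonical_topology)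
  have le: "(\<integral>\<^sup>+x. ?f x \<partial>P n) \<le> ennreal (c - y)" for n
  proof -
    have "ereal y \<le> ereal c - enn2ereal (\<integral>\<^sup>+x. ?f x \<partial>P n)" using y P_ext by simp
    then show ?thesis
      by (cases "\<integral>\<^sup>+x. ?f x \<partial>P n") (auto simp: enn2ereal_ennreal intro: ennreal_leI)
  qed
  \<comment> \<open>\<open>ennreal\<close> truncates negative numbers to 0, so the final bound by
    \<open>ennreal (c - y)\<close> can be converted back only if c - y is nonnegative.\<close>
  have yc: "y \<le> c"
  proof -
    have "ereal y \<le> ereal c - enn2ereal (\<integral>\<^sup>+x. ?f x \<partial>P 0)" using y[of 0] P_ext by simp
    then show ?thesis by (cases "\<integral>\<^sup>+x. ?f x \<partial>P 0") (auto simp: enn2ereal_ennreal)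
  qed
  \<comment> \<open>Superlevel sets of c - \<Phi> are sublevel sets of \<Phi>, hence open; the
    sequence eventually enters each one that contains its limit.\<close>
  have lsc: "?f (Y z) \<le> liminf (\<lambda>n. ?f (X n z))" if z: "z \<in> space \<Omega>" for z
    unfolding le_Liminf_iff
  proof (intro allI impI)
    fix v assume v: "v < ?f (Y z)"
    then obtain r where r: "v = ennreal r" "0 \<le> r" by (cases v) auto
    then have "\<Phi> (Y z) < c - r" using v by (simp add: ennreal_less_iff)
    moreover have "openin (canonical.mtopology m) {x \<in> canonical_space m. \<Phi> x < c - r}"
      using \<Phi>(2) unfolding upper_semicontinuous_def canonical_mtopology topspace_canonical_topology by blast
    moreover have "limitin (canonical.mtopology m) (\<lambda>n. X n z) (Y z) sequentially"
      using X_space[OF z] Y_space[OF z] lim[OF z] by (simp add: canonical.limitin_metric_dist_null)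
    ultimately have "\<forall>\<^sub>F n in sequentially. X n z \<in> {x \<in> canonical_space m. \<Phi> x < c - r}"
      using Y_space[OF z] unfolding limitin_def by blast
    then show "\<forall>\<^sub>F n in sequentially. v < ?f (X n z)"
      by (rule eventually_mono) (use r in \<open>simp add: ennreal_less_iff\<close>)
  qed
  have "(\<integral>\<^sup>+x. ?f x \<partial>Q) = (\<integral>\<^sup>+z. ?f (Y z) \<partial>\<Omega>)" by (rule nn_integral_distr[OF Y fPQ(1)])
  also have "\<dots> \<le> (\<integral>\<^sup>+z. liminf (\<lambda>n. ?f (X n z)) \<partial>\<Omega>)" using lsc by (rule nn_integral_mono)
  also have "\<dots> \<le> liminf (\<lambda>n. \<integral>\<^sup>+z. ?f (X n z) \<partial>\<Omega>)"
    by (rule nn_integral_liminf) (rule measurable_compose[OF X f])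
  also have "\<dots> = liminf (\<lambda>n. \<integral>\<^sup>+x. ?f x \<partial>P n)" by (simp only: nn_integral_distr[OF X fPQ(2)])
  also have "\<dots> \<le> ennreal (c - y)" using le by (intro Liminf_le) auto
  finally have "(\<integral>\<^sup>+x. ?f x \<partial>Q) \<le> ennreal (c - y)" .
  then show ?thesis
    unfolding Q_ext using yc
    by (cases "\<integral>\<^sup>+x. ?f x \<partial>Q") (auto simp: enn2ereal_ennreal top_unique)
qed

text \<open>At two strikes of \<open>S\<close> the spread has its target price from some index on.
  Being bounded by k' - k, it keeps that price under \<open>Q\<close>, and spreads at dense strikes
  determine the law.\<close>

lemma limit_marginal:
  assumes \<nu>: "prob_space \<nu>" "sets \<nu> = sets borel" "integrable \<nu> (\<lambda>x. x)" and i: "i \<in> {1..m}"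
    and S: "\<And>a b. a < b \<Longrightarrow> \<exists>k\<in>S. a < k \<and> k < b"
    and calls: "\<And>k. k \<in> S \<Longrightarrow> \<forall>\<^sub>F n in sequentially.
      has_bochner_integral (P n) (\<lambda>x. max 0 (B (T i x) x - k)) (\<integral>x. max 0 (x - k) \<partial>\<nu>)"
  shows "distr Q borel (\<lambda>x. B (T i x) x) = \<nu>"
proof (rule calls_determine_distribution[OF _ _ \<nu>(1,2) S])
  interpret \<nu>: prob_space \<nu> by (rule \<nu>)
  have BT [measurable]: "(\<lambda>x. B (T i x) x) \<in> borel_measurable (canonical_borel m)" by (rule measurable_B_T[OF i])
  show "prob_space (distr Q borel (\<lambda>x. B (T i x) x))" using prob_Q by (rule prob_space.prob_space_distr) simp
  fix k k' assume k: "k \<in> S" "k' \<in> S" "k < k'"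
  let ?g = "\<lambda>y. max 0 (y - k) - max 0 (y - k') :: real"
  have \<nu>i: "integrable \<nu> (\<lambda>x. max 0 (x - a))" for a using \<nu>(3) by (intro integrable_max) auto
  have "\<forall>\<^sub>F n in sequentially. (\<integral>x. ?g (B (T i x) x) \<partial>P n) = (\<integral>x. ?g x \<partial>\<nu>)"
    using calls[OF k(1)] calls[OF k(2)]
    by eventually_elim (use \<nu>i in \<open>simp add: has_bochner_integral_iff\<close>)
  then have "(\<lambda>n. \<integral>x. ?g (B (T i x) x) \<partial>P n) \<longlonglongrightarrow> (\<integral>x. ?g x \<partial>\<nu>)" by (rule tendsto_eventually)
  moreover have "(\<lambda>n. \<integral>x. ?g (B (T i x) x) \<partial>P n) \<longlonglongrightarrow> (\<integral>x. ?g (B (T i x) x) \<partial>Q)"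
  proof (rule integral_limit[where b = "k' - k"])
    show "\<bar>?g (B (T i x) x)\<bar> \<le> k' - k" for x using k(3) by auto
    show "(\<lambda>n. ?g (B (T i (X n s)) (X n s))) \<longlonglongrightarrow> ?g (B (T i (Y s)) (Y s))" if "s \<in> space \<Omega>" for s
      using that i by (intro tendsto_intros B_T_limit)
  qed simp
  ultimately have "(\<integral>x. ?g (B (T i x) x) \<partial>Q) = (\<integral>x. ?g x \<partial>\<nu>)" by (rule LIMSEQ_unique[rotated])
  then show "(\<integral>x. ?g x \<partial>distr Q borel (\<lambda>x. B (T i x) x)) = (\<integral>x. ?g x \<partial>\<nu>)"
    by (subst integral_distr) auto
qed auto

text \<open>Far out, the calls and puts of \<open>\<nu>\<close> are small. From some index on
  \<open>P n\<close> has the same calls at the two chosen strikes, and the same put as well by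
  put-call parity, because both \<open>\<nu>\<close> and the terminal value under \<open>P n\<close>
  have mean zero.\<close>

lemma limit_tail:
  assumes \<nu>: "prob_space \<nu>" "integrable \<nu> (\<lambda>x. x)" "(\<integral>x. x \<partial>\<nu>) = 0"
    and S: "\<And>a b. a < b \<Longrightarrow> \<exists>k\<in>S. a < k \<and> k < b"
    and calls: "\<And>k. k \<in> S \<Longrightarrow> \<forall>\<^sub>F n in sequentially.
      has_bochner_integral (P n) (\<lambda>x. max 0 (B (T m x) x - k)) (\<integral>x. max 0 (x - k) \<partial>\<nu>)"
    and e: "e > 0"
  shows "\<exists>k l. \<forall>\<^sub>F n in sequentially.
    (\<integral>x. max 0 (B (T m x) x - k) \<partial>P n) + (\<integral>x. max 0 (l - B (T m x) x) \<partial>P n) \<le> e"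
proof -
  interpret \<nu>: prob_space \<nu> by (rule \<nu>)
  have \<nu>m [measurable]: "(\<lambda>x. x) \<in> borel_measurable \<nu>" using \<nu>(2) by auto
  have \<nu>i: "integrable \<nu> (\<lambda>x. max 0 (x - a))" "integrable \<nu> (\<lambda>x. max 0 (a - x))" for a
    using \<nu>(2) by (auto intro!: integrable_max)
  have parity: "max 0 (l - x) = max 0 (x - l) - x + l" for l x :: real by auto
  have vanish: "(\<lambda>j. \<integral>x. max 0 (h x - real j) \<partial>\<nu>) \<longlonglongrightarrow> (\<integral>x. 0 \<partial>\<nu>)"
    if h: "integrable \<nu> h" for h :: "real \<Rightarrow> real"
  proof (rule integral_dominated_convergence[where w = "\<lambda>x. \<bar>h x\<bar>"])
    show "AE x in \<nu>. (\<lambda>j. max 0 (h x - real j)) \<longlonglongrightarrow> 0"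
    proof (rule AE_I2, rule tendsto_eventually)
      fix x
      obtain J where J: "h x \<le> real J" using real_arch_simple by blast
      then have "max 0 (h x - real j) = 0" if "j \<ge> J" for j
      proof -
        have "real J \<le> real j" using that by simp
        then show ?thesis using J by simp
      qed
      then show "\<forall>\<^sub>F j in sequentially. max 0 (h x - real j) = 0"
        by (auto simp: eventually_sequentially)
    qed
    show "(\<lambda>x. max 0 (h x - real j)) \<in> borel_measurable \<nu>" for j using h by measurable
  qed (use h in auto)
  obtain j1 where j1: "(\<integral>x. max 0 (x - real j1) \<partial>\<nu>) < e / 2"
    using order_tendstoD(2)[OF vanish[OF \<nu>(2)], of "e / 2"] e by (auto simp: eventually_sequentially)
  obtain j2 where j2: "(\<integral>x. max 0 (- x - real j2) \<partial>\<nu>) < e / 2"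
    using order_tendstoD(2)[OF vanish[of "\<lambda>x. - x"], of "e / 2"] \<nu>(2) e by (auto simp: eventually_sequentially)
  \<comment> \<open>The cutoffs j1 and -j2 are replaced by strikes of \<open>S\<close> lying further
    out, which only lowers the prices.\<close>
  obtain k where k: "k \<in> S" "real j1 < k" using S[of "real j1" "real j1 + 1"] by auto
  obtain l where l: "l \<in> S" "l < - real j2" using S[of "- real j2 - 1" "- real j2"] by auto
  have "(\<integral>x. max 0 (x - k) \<partial>\<nu>) \<le> (\<integral>x. max 0 (x - real j1) \<partial>\<nu>)"
    using \<nu>i k(2) by (intro integral_mono) auto
  moreover have "(\<integral>x. max 0 (l - x) \<partial>\<nu>) \<le> (\<integral>x. max 0 (- x - real j2) \<partial>\<nu>)"
    using \<nu>(2) l(2) by (intro integral_mono integrable_max) auto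
  moreover have "(\<integral>x. max 0 (l - x) \<partial>\<nu>) = (\<integral>x. max 0 (x - l) \<partial>\<nu>) + l"
    unfolding parity[of l] using \<nu>i(1)[of l] \<nu>(2,3) \<nu>.prob_space by simp
  ultimately have small: "(\<integral>x. max 0 (x - k) \<partial>\<nu>) + ((\<integral>x. max 0 (x - l) \<partial>\<nu>) + l) \<le> e"
    using j1 j2 by linarith
  have "\<forall>\<^sub>F n in sequentially.
    (\<integral>x. max 0 (B (T m x) x - k) \<partial>P n) + (\<integral>x. max 0 (l - B (T m x) x) \<partial>P n) \<le> e"
    using calls[OF k(1)] calls[OF l(1)]
  proof eventually_elim
    case (elim n)
    interpret E: embedding m "P n" using X_embedding by (rule embeddingI)
    have "(\<integral>x. max 0 (l - B (T m x) x) \<partial>P n) = (\<integral>x. max 0 (B (T m x) x - l) - B (T m x) x + l \<partial>P n)"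
      by (rule Bochner_Integration.integral_cong[OF refl parity])
    also have "\<dots> = (\<integral>x. max 0 (B (T m x) x - l) \<partial>P n) + l"
      using elim(2) E.terminal_integrable[OF m] E.terminal_expectation[OF m] E.prob_space
      by (simp add: has_bochner_integral_iff)
    finally show ?case using elim small by (simp add: has_bochner_integral_iff)
  qed
  then show ?thesis by blast
qed

end

text \<open>The strike following the last one at or below \<open>a\<close> lies above
  \<open>a\<close> by at most one mesh width, which is smaller than b - a.\<close>

lemma strikes_dense:
  fixes K :: "nat \<Rightarrow> nat \<Rightarrow> real"
  assumes range: "filterlim (\<lambda>n. strike_range n (K n)) at_top sequentially"
    and mesh: "(\<lambda>n. strike_mesh n (K n)) \<longlonglongrightarrow> 0" and ab: "a < b"
  shows "\<exists>k\<in>(\<Union>n\<in>{1..}. K n ` {1..n}). a < k \<and> k < b"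
proof -
  \<comment> \<open>The added 1 makes the required range positive, so the positive parts in
    \<open>strike_range\<close> are the strikes themselves, and the last strike lies strictly above
    \<open>a\<close>.\<close>
  have "\<forall>\<^sub>F n in sequentially. max \<bar>a\<bar> \<bar>b\<bar> + 1 \<le> strike_range n (K n)"
    using range by (simp add: filterlim_at_top)
  moreover have "\<forall>\<^sub>F n in sequentially. strike_mesh n (K n) < b - a"
    using order_tendstoD(2)[OF mesh] ab by simp
  ultimately have "\<forall>\<^sub>F n in sequentially. 1 \<le> n \<and> max \<bar>a\<bar> \<bar>b\<bar> + 1 \<le> strike_range n (K n) \<and> strike_mesh n (K n) < b - a"
    using eventually_ge_at_top[of 1] by eventually_elim auto
  then obtain n where n: "1 \<le> n" "max \<bar>a\<bar> \<bar>b\<bar> + 1 \<le> strike_range n (K n)" "strike_mesh n (K n) < b - a"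
    by (auto simp: eventually_sequentially)
  have K1: "K n 1 \<le> a" and Kn: "a < K n n" using n(2) by (auto simp: strike_range_def)
  define j where "j = Max {i \<in> {1..n}. K n i \<le> a}"
  have "j \<in> {i \<in> {1..n}. K n i \<le> a}"
    unfolding j_def using K1 n(1) by (intro Max_in) auto
  then have j: "1 \<le> j" "j \<le> n" "K n j \<le> a" by auto
  then have jn: "j < n" using Kn by (cases "j = n") auto
  have "a < K n (Suc j)"
  proof (rule ccontr)
    assume "\<not> a < K n (Suc j)"
    then have "Suc j \<le> j" unfolding j_def[symmetric] using jn
      by (subst (2) j_def) (intro Max_ge, auto)
    then show False by simp
  qed
  moreover have "K n (Suc j) - K n (Suc j - 1) \<le> strike_mesh n (K n)"
    unfolding strike_mesh_def using j jn by (intro Max_ge imageI finite_imageI) auto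
  then have "K n (Suc j) < b" using n(3) j(3) by simp
  moreover have "K n (Suc j) \<in> (\<Union>n\<in>{1..}. K n ` {1..n})"
    using n(1) jn by (intro UN_I[of n] imageI) auto
  ultimately show ?thesis by blast
qed

theorem theorem2p8:
  fixes m :: nat
    and \<Phi> :: "(real \<Rightarrow> real) \<times> (nat \<Rightarrow> real) \<Rightarrow> real"
    and \<mu> :: "nat \<Rightarrow> real measure"
    and K :: "nat \<Rightarrow> nat \<Rightarrow> real"
    and C :: "nat \<Rightarrow> nat \<Rightarrow> nat \<Rightarrow> real"
  assumes "m \<ge> 1"
    and "non_anticipative m \<Phi>"
    and "\<exists>b. \<forall>x\<in>canonical_space m. \<Phi> x \<le> b"
    and "upper_semicontinuous (canonical_topology m) \<Phi>"
    and "centered_peacock m \<mu>"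
    and "\<And>n. n \<ge> 1 \<Longrightarrow> strict_mono_on {1..n} (K n)"
    and "\<And>n. n \<ge> 1 \<Longrightarrow> K n ` {1..n} \<subseteq> K (Suc n) ` {1..Suc n}"
    and "filterlim (\<lambda>n. strike_range n (K n)) at_top sequentially"
    and "(\<lambda>n. strike_mesh n (K n)) \<longlonglongrightarrow> 0"
    and "\<And>n i j. n \<ge> 1 \<Longrightarrow> i \<in> {1..m} \<Longrightarrow> j \<in> {1..n} \<Longrightarrow>
           C n i j = (\<integral>x. max 0 (x - K n j) \<partial>\<mu> i)"
  shows "(\<lambda>n. price_calls m \<Phi> n (K n) (C n)) \<longlonglongrightarrow> price_marginals m \<Phi> \<mu>"
proof -
  have peacock: "prob_space (\<mu> i)" "sets (\<mu> i) = sets borel" "integrable (\<mu> i) (\<lambda>x. x)" "(\<integral>x. x \<partial>\<mu> i) = 0"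
    if "i \<in> {1..m}" for i
    using assms(5) that by (auto simp: centered_peacock_def)
  define S where "S = (\<Union>n\<in>{1..}. K n ` {1..n})"
  have S: "\<exists>k\<in>S. a < k \<and> k < b" if "a < b" for a b
    unfolding S_def using strikes_dense[OF assms(8,9) that] .
  have nested: "K n ` {1..n} \<subseteq> K n' ` {1..n'}" if "1 \<le> n" "n \<le> n'" for n n'
    using that(2,1)
  proof (induction n' rule: dec_induct)
    case (step l)
    then show ?case using assms(7)[of l] by simp
  qed simp
  define call where "call i k = (\<integral>x. max 0 (x - k) \<partial>\<mu> i)" for i k
  \<comment> \<open>The constraints are indexed by strike instead of position: the position of a
    given strike changes with \<open>n\<close>, and only in this form are the constraints
    nested.\<close>
  have calls: "P \<in> embeddings_calls m n (K n) (C n) \<longleftrightarrow> P \<in> embeddings m \<and>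
      (\<forall>i\<in>{1..m}. \<forall>k\<in>K n ` {1..n}. has_bochner_integral P (\<lambda>x. max 0 (B (T i x) x - k)) (call i k))"
    if "1 \<le> n" for P n
    using assms(10)[OF that] by (auto simp: embeddings_calls_def call_def)
  have antimono: "price_calls m \<Phi> n' (K n') (C n') \<le> price_calls m \<Phi> n (K n) (C n)" if "1 \<le> n" "n \<le> n'" for n n'
  proof -
    have "embeddings_calls m n' (K n') (C n') \<subseteq> embeddings_calls m n (K n) (C n)"
    proof
      fix P assume "P \<in> embeddings_calls m n' (K n') (C n')"
      with calls[OF order_trans[OF that]] have "P \<in> embeddings m"
        "\<forall>i\<in>{1..m}. \<forall>k\<in>K n' ` {1..n'}. has_bochner_integral P (\<lambda>x. max 0 (B (T i x) x - k)) (call i k)"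
        by simp_all
      then show "P \<in> embeddings_calls m n (K n) (C n)"
        unfolding calls[OF that(1)] using subsetD[OF nested[OF that]] by meson
    qed
    then show ?thesis unfolding price_calls_def by (rule SUP_subset_mono) simp
  qed
  have lower: "price_marginals m \<Phi> \<mu> \<le> price_calls m \<Phi> n (K n) (C n)" if n: "1 \<le> n" for n
  proof -
    have "P \<in> embeddings_calls m n (K n) (C n)" if P: "P \<in> embeddings_marginals m \<mu>" for P
    proof -
      have "P \<in> embeddings m" using P by (simp add: embeddings_marginals_def)
      then interpret embedding m P by (rule embeddingI)
      have "has_bochner_integral P (\<lambda>x. max 0 (B (T i x) x - k)) (call i k)" if i: "i \<in> {1..m}" for i k
      proof -
        have [measurable]: "(\<lambda>x. B (T i x) x) \<in> borel_measurable P" using i by (rule P_measurable)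
        have \<mu>: "distr P borel (\<lambda>x. B (T i x) x) = \<mu> i" using P i by (simp add: embeddings_marginals_def)
        have g: "(\<lambda>y. max 0 (y - k)) \<in> borel_measurable (borel :: real measure)" by measurable
        interpret \<mu>: prob_space "\<mu> i" using i by (rule peacock)
        have "integrable (\<mu> i) (\<lambda>y. max 0 (y - k))" using peacock(3)[OF i] by (intro integrable_max) auto
        then show ?thesis
          unfolding \<mu>[symmetric] call_def
          by (simp add: has_bochner_integral_iff integrable_distr_eq[OF _ g] integral_distr[OF _ g])
      qed
      then show ?thesis using calls[OF n] \<open>P \<in> embeddings m\<close> by blast
    qed
    then show ?thesis unfolding price_marginals_def price_calls_def by (intro SUP_subset_mono) auto
  qed
  show ?thesis
  proof (rule order_tendstoI)
    fix y assume "y < price_marginals m \<Phi> \<mu>"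
    then have "y < price_calls m \<Phi> n (K n) (C n)" if "1 \<le> n" for n
      using lower[OF that] by (rule less_le_trans)
    then show "\<forall>\<^sub>F n in sequentially. y < price_calls m \<Phi> n (K n) (C n)"
      using eventually_ge_at_top[of 1] by (rule eventually_mono[rotated])
  next
    fix y assume "price_marginals m \<Phi> \<mu> < y"
    then obtain z where z: "price_marginals m \<Phi> \<mu> < ereal z" "ereal z < y"
      using ereal_dense2 by blast
    show "\<forall>\<^sub>F n in sequentially. price_calls m \<Phi> n (K n) (C n) < y"
    proof (rule ccontr)
      assume not: "\<not> ?thesis"
      \<comment> \<open>Prices decrease in \<open>n\<close>, so failing infinitely often means
        failing at every index from 1 on. The shift by one avoids \<open>n = 0\<close>, about which
        nothing is assumed.\<close>
      have "\<exists>P\<in>embeddings_calls m (Suc n) (K (Suc n)) (C (Suc n)). ereal z < ext_integral P \<Phi>" for n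
      proof -
        obtain n' where "n' \<ge> Suc n" "y \<le> price_calls m \<Phi> n' (K n') (C n')"
          using not by (auto simp: eventually_sequentially not_less)
        then have "ereal z < price_calls m \<Phi> (Suc n) (K (Suc n)) (C (Suc n))"
          using antimono[of "Suc n" n'] z(2) by auto
        then show ?thesis unfolding price_calls_def less_SUP_iff .
      qed
      then obtain P where P_calls: "\<And>n. P n \<in> embeddings_calls m (Suc n) (K (Suc n)) (C (Suc n))"
        and Pz: "\<And>n. ereal z < ext_integral (P n) \<Phi>"
        by metis
      have P: "P n \<in> embeddings m" for n using P_calls[of n] calls[of "Suc n"] by simp
      have P_call: "has_bochner_integral (P n) (\<lambda>x. max 0 (B (T i x) x - k)) (call i k)"
        if "i \<in> {1..m}" "k \<in> K (Suc n) ` {1..Suc n}" for n i k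
      proof -
        have "1 \<le> Suc n" by simp
        from calls[OF this] P_calls[of n] that show ?thesis by blast
      qed
      have mm: "m \<in> {1..m}" using assms(1) by simp
      \<comment> \<open>The single strike of the first vector occurs in all later ones, so its call
        price is prescribed for every \<open>P n\<close> and yields a moment bound that is uniform
        in \<open>n\<close>.\<close>
      define k0 where "k0 = K 1 1"
      have bound: "(\<integral>x. \<bar>B (T m x) x\<bar> \<partial>P n) \<le> 2 * (call m k0 + \<bar>k0\<bar>)" for n
      proof -
        interpret embedding m "P n" using P by (rule embeddingI)
        have "k0 \<in> K (Suc n) ` {1..Suc n}" using nested[of 1 "Suc n"] by (auto simp: k0_def)
        note c = P_call[OF mm this]
        \<comment> \<open>The absolute value is twice the positive part minus the number itself, the
          positive part is at most the call at \<open>k0\<close> plus |k0|, and the terminal value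
          has mean zero.\<close>
        have "(\<integral>x. \<bar>B (T m x) x\<bar> \<partial>P n) \<le> (\<integral>x. 2 * (max 0 (B (T m x) x - k0) + \<bar>k0\<bar>) - B (T m x) x \<partial>P n)"
        proof (rule integral_mono)
          have "\<bar>y\<bar> \<le> 2 * (max 0 (y - k0) + \<bar>k0\<bar>) - y" for y by (smt (verit))
          then show "\<bar>B (T m x) x\<bar> \<le> 2 * (max 0 (B (T m x) x - k0) + \<bar>k0\<bar>) - B (T m x) x" for x .
        qed (use c terminal_integrable[OF assms(1)] in \<open>auto simp: has_bochner_integral_iff\<close>)
        also have "\<dots> = 2 * (call m k0 + \<bar>k0\<bar>)"
          using c terminal_integrable[OF assms(1)] terminal_expectation[OF assms(1)] prob_space
          by (simp add: has_bochner_integral_iff)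
        finally show ?thesis .
      qed
      obtain r and \<Omega> :: "real measure" and X Y where r: "strict_mono (r :: nat \<Rightarrow> nat)" and \<Omega>: "prob_space \<Omega>"
        and X: "\<And>n. X n \<in> \<Omega> \<rightarrow>\<^sub>M canonical_borel m" "\<And>n. distr \<Omega> (canonical_borel m) (X n) = P (r n)"
        and Y: "Y \<in> \<Omega> \<rightarrow>\<^sub>M canonical_borel m"
        and XY: "\<And>s. s \<in> space \<Omega> \<Longrightarrow> (\<lambda>n. canonical_dist m (X n s) (Y s)) \<longlonglongrightarrow> 0"
        using embeddings_subsequence[of m P, OF assms(1) P bound] by blast
      interpret L: canonical_limit \<Omega> m X Y
        using \<Omega> by (rule canonical_limit.intro) (unfold_locales, use assms(1) X Y XY P in auto)
      have ev: "\<forall>\<^sub>F n in sequentially.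
          has_bochner_integral (L.P n) (\<lambda>x. max 0 (B (T i x) x - k)) (\<integral>x. max 0 (x - k) \<partial>\<mu> i)"
        if i: "i \<in> {1..m}" and k: "k \<in> S" for i k
      proof -
        obtain n0 where n0: "1 \<le> n0" "k \<in> K n0 ` {1..n0}" using k by (auto simp: S_def)
        have "has_bochner_integral (L.P n) (\<lambda>x. max 0 (B (T i x) x - k)) (\<integral>x. max 0 (x - k) \<partial>\<mu> i)" if "n \<ge> n0" for n
        proof -
          \<comment> \<open>A subsequence index satisfies r n >= n, so a strike present at
            \<open>n0\<close> stays present along the subsequence from \<open>n0\<close> on.\<close>
          have "n0 \<le> Suc (r n)" using seq_suble[OF r, of n] that by simp
          then have "k \<in> K (Suc (r n)) ` {1..Suc (r n)}" using nested[OF n0(1)] n0(2) by blast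
          then show ?thesis using P_call[OF i] unfolding X(2) call_def by blast
        qed
        then show ?thesis by (auto simp: eventually_sequentially)
      qed
      have "L.Q \<in> embeddings m"
        using L.limit_embedding L.limit_tail[OF peacock(1,3,4)[OF mm] S ev[OF mm]] by blast
      moreover have "distr L.Q borel (\<lambda>x. B (T i x) x) = \<mu> i" if i: "i \<in> {1..m}" for i
        by (rule L.limit_marginal[OF peacock(1,2,3)[OF i] i S ev[OF i]])
      ultimately have "L.Q \<in> embeddings_marginals m \<mu>" by (simp add: embeddings_marginals_def)
      then have "ext_integral L.Q \<Phi> \<le> price_marginals m \<Phi> \<mu>"
        unfolding price_marginals_def by (rule SUP_upper)
      moreover obtain b where "\<And>x. x \<in> canonical_space m \<Longrightarrow> \<Phi> x \<le> b" using assms(3) by blast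
      then have "ereal z \<le> ext_integral L.Q \<Phi>"
        using assms(2,4) Pz unfolding non_anticipative_def
        by (intro L.limit_payoff) (auto simp: X(2) less_imp_le)
      ultimately show False using z(1) by simp
    qed
  qed
qed

end
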